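(* Let $\Omega\subset\mathbb R^n$ be open, let $x_0\in\Omega$ and $0<r_1<r_2<d(x_0,\partial\Omega)$. Write $B_j=B(x_0,r_j)$, $j=1,2$. Let $T>0$ and $0<\epsilon<T$. Write $L=\partial_t-\Delta$. Then there are $C>0$ and $\kappa\in(0,1)$ such that for all $u\in C^2(\mathbb R\times\Omega)$ $$\|u\|_{L^2(\epsilon,T-\epsilon;H^1(B_2))}\le C\left(\|u\|_{L^2(0,T;H^1(B_1))}+\|Lu\|_{L^2((0,T)\times\Omega)}\right)^\kappa\|u\|_{L^2(0,T;H^1(\Omega))}^{1-\kappa}.$$
   Context: $d$ is the Euclidean distance and $B(x,r)=\{y\in\Omega: d(y,x)<r\}$. The Laplacian $\Delta$ acts in the spatial variable only. *)

theory Defs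
  imports "HOL-Analysis.Analysis"
begin

text \<open>Meaningful for exponents \<open>p > 0\<close>; the value at \<open>top\<close> is then \<open>top\<close>.\<close>

definition ennpowr :: "ennreal \<Rightarrow> real \<Rightarrow> ennreal" where
  "ennpowr a p = (if a = top then top else ennreal (enn2real a powr p))"

text \<open>Extended-real valued, so that the distance to the empty set is \<open>\<infinity>\<close>
  (\<open>infdist x {} = 0\<close>). This matters for the boundary of the whole space.\<close>

definition edist_to :: "'a::metric_space \<Rightarrow> 'a set \<Rightarrow> ereal" where
  "edist_to x S = (INF y\<in>S. ereal (dist x y))"

definition rel_ball :: "'a::metric_space set \<Rightarrow> 'a \<Rightarrow> real \<Rightarrow> 'a set" where
  "rel_ball \<Omega> x r = {y \<in> \<Omega>. dist y x < r}"

text \<open>To be used for open \<open>S\<close>.\<close>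

definition C2_on :: "'a::real_normed_vector set \<Rightarrow> ('a \<Rightarrow> 'b::real_normed_vector) \<Rightarrow> bool" where
  "C2_on S f \<longleftrightarrow>
    (\<exists>(f' :: 'a \<Rightarrow> 'a \<Rightarrow>\<^sub>L 'b) (f'' :: 'a \<Rightarrow> 'a \<Rightarrow>\<^sub>L ('a \<Rightarrow>\<^sub>L 'b)).
      (\<forall>z\<in>S. (f has_derivative blinfun_apply (f' z)) (at z)) \<and>
      (\<forall>z\<in>S. (f' has_derivative blinfun_apply (f'' z)) (at z)) \<and>
      continuous_on S f' \<and> continuous_on S f'')"

definition pderivative :: "'a::real_normed_vector \<Rightarrow> ('a \<Rightarrow> real) \<Rightarrow> 'a \<Rightarrow> real" where
  "pderivative b v x = deriv (\<lambda>s. v (x + s *\<^sub>R b)) 0"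

definition grad :: "('a::euclidean_space \<Rightarrow> real) \<Rightarrow> 'a \<Rightarrow> 'a" where
  "grad v x = (\<Sum>b\<in>Basis. pderivative b v x *\<^sub>R b)"

definition laplacian :: "('a::euclidean_space \<Rightarrow> real) \<Rightarrow> 'a \<Rightarrow> real" where
  "laplacian v x = (\<Sum>b\<in>Basis. pderivative b (pderivative b v) x)"

definition heat_op :: "(real \<times> 'a::euclidean_space \<Rightarrow> real) \<Rightarrow> real \<times> 'a \<Rightarrow> real" where
  "heat_op u = (\<lambda>(t, x). deriv (\<lambda>s. u (s, x)) t - laplacian (\<lambda>y. u (t, y)) x)"

definition L2_norm_on :: "'a::euclidean_space set \<Rightarrow> ('a \<Rightarrow> real) \<Rightarrow> ennreal" where
  "L2_norm_on S f = ennpowr (\<integral>\<^sup>+ z\<in>S. ennreal ((f z)\<^sup>2) \<partial>lborel) (1/2)"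

definition H1_norm_on :: "'a::euclidean_space set \<Rightarrow> ('a \<Rightarrow> real) \<Rightarrow> ennreal" where
  "H1_norm_on S v =
    ennpowr (\<integral>\<^sup>+ x\<in>S. ennreal ((v x)\<^sup>2 + (norm (grad v x))\<^sup>2) \<partial>lborel) (1/2)"

definition L2_H1_norm ::
    "real \<Rightarrow> real \<Rightarrow> 'a::euclidean_space set \<Rightarrow> (real \<times> 'a \<Rightarrow> real) \<Rightarrow> ennreal" where
  "L2_H1_norm a b S u =
    ennpowr (\<integral>\<^sup>+ t\<in>{a<..<b}. (H1_norm_on S (\<lambda>x. u (t, x)))\<^sup>2 \<partial>lborel) (1/2)"

end

theory Submission
  imports Defs
begin

text \<open>
  The inequality follows from a Carleman estimate with the weight
  \<open>\<phi> (t, x) = exp (- \<mu> * |x - x0|\<^sup>2) - g t\<close>, where \<open>g\<close> vanishes on \<open>[\<epsilon>, T - \<epsilon>]\<close> and is at least 1 near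
  \<open>0\<close> and \<open>T\<close>. Conjugating the heat operator with \<open>exp (\<tau> * \<phi>)\<close> splits it into a symmetric part \<open>S\<close> and
  an antisymmetric part \<open>A\<close>; since \<open>(S v + A v)\<^sup>2 \<ge> 4 * S v * A v\<close>, it is enough to write the product
  as a divergence plus a quadratic form in \<open>v\<close> and its gradient that is positive for large \<open>\<mu>\<close> and
  \<open>\<tau>\<close> away from \<open>x0\<close>. The estimate is applied to \<open>u\<close> times a cutoff. The commutator with the cutoff
  lives near \<open>x0\<close>, where \<open>u\<close> is controlled by its norm on the small ball, or where \<open>\<phi>\<close> is smaller than
  on \<open>[\<epsilon>, T - \<epsilon>] \<times> B(x0, r2)\<close>. Optimising in \<open>\<tau>\<close> gives the interpolation inequality.

  Only a ball slightly larger than \<open>B(x0, r2)\<close> is used, where all norms are finite; infinite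
  norms over the whole domain are then handled by monotonicity.
\<close>

section \<open>Directional derivatives and local smoothness\<close>

text \<open>Two features of the given function shape the argument. It is only C2, so third
  derivatives must never appear: the divergence in the Carleman identity is arranged so that its
  fluxes contain first derivatives only, and they integrate to zero without any approximation. It
  also has no prescribed behaviour at the times 0 and \<open>T\<close>, so the cutoff in time
  produces errors there; the term \<open>- g\<close> pushes the weight at those errors below its
  values on the target region. Since \<open>g\<close> does not depend on \<open>\<tau>\<close>, its
  derivatives enter only at orders \<open>\<tau>\<close> and \<open>\<tau>\<^sup>2\<close>, while
  the gain in the zeroth-order term is of order \<open>\<tau>^3\<close>. The Gaussian is convex
  along rays where \<open>\<mu> * |x - x0|\<^sup>2\<close> is not too small, but its Hessian is
  negative in tangential directions. A multiple of the identity shifted between the symmetric and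
  the antisymmetric part repairs the gradient term; its price in the zeroth-order term is affordable
  once \<open>\<mu> * |x - x0|\<^sup>2 \<ge> 2\<close>. Hence a ball around \<open>x0\<close>, where
  the gradient of the weight degenerates, has to be cut out.\<close>

lemma pderivative_eqI:
  assumes "(f has_derivative f') (at z)"
  shows "pderivative e f z = f' e"
proof -
  have lin: "bounded_linear f'" using assms by (rule has_derivative_bounded_linear)
  have "((\<lambda>s. f (z + s *\<^sub>R e)) has_derivative (\<lambda>s. f' (s *\<^sub>R e))) (at 0)"
    by (rule has_derivative_compose[of "\<lambda>s. z + s *\<^sub>R e" "\<lambda>s. s *\<^sub>R e" 0 UNIV f f'])
      (use assms in \<open>auto intro!: derivative_eq_intros\<close>)
  then have "((\<lambda>s. f (z + s *\<^sub>R e)) has_field_derivative f' e) (at 0)"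
    using linear_scale[OF bounded_linear.linear[OF lin]]
    by (simp add: has_field_derivative_def mult_commute_abs)
  then show ?thesis unfolding pderivative_def by (rule DERIV_imp_deriv)
qed

lemma has_derivative_pderivative:
  assumes "f differentiable (at z)"
  shows "(f has_derivative (\<lambda>e. pderivative e f z)) (at z)"
proof -
  obtain f' where "(f has_derivative f') (at z)" using assms by (auto simp: differentiable_def)
  moreover from pderivative_eqI[OF this] have "(\<lambda>e. pderivative e f z) = f'" by auto
  ultimately show ?thesis by simp
qed

lemma pderivative_cong:
  assumes "open S" "z \<in> S" "\<And>y. y \<in> S \<Longrightarrow> f y = g y"
  shows "pderivative e f z = pderivative e g z"
proof -
  have "((\<lambda>s. z + s *\<^sub>R e) \<longlongrightarrow> z + 0 *\<^sub>R e) (nhds 0)"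
    by (intro tendsto_intros filterlim_ident)
  then have "eventually (\<lambda>s. z + s *\<^sub>R e \<in> S) (nhds (0::real))"
    using assms(1,2) by (simp add: tendsto_def)
  then have "eventually (\<lambda>s. f (z + s *\<^sub>R e) = g (z + s *\<^sub>R e)) (nhds (0::real))"
    by eventually_elim (use assms(3) in auto)
  then show ?thesis unfolding pderivative_def by (intro deriv_cong_ev) auto
qed

lemma DERIV_along_line:
  assumes "f differentiable (at (z + r *\<^sub>R e))"
  shows "((\<lambda>r. f (z + r *\<^sub>R e)) has_field_derivative pderivative e f (z + r *\<^sub>R e)) (at r)"
proof -
  have d: "(f has_derivative (\<lambda>e'. pderivative e' f (z + r *\<^sub>R e))) (at (z + r *\<^sub>R e))"
    by (rule has_derivative_pderivative[OF assms])
  have "((\<lambda>r. f (z + r *\<^sub>R e)) has_derivative (\<lambda>s. pderivative (s *\<^sub>R e) f (z + r *\<^sub>R e))) (at r)"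
    by (rule has_derivative_compose[of "\<lambda>s. z + s *\<^sub>R e" "\<lambda>s. s *\<^sub>R e" r UNIV f, OF _ d])
      (auto intro!: derivative_eq_intros)
  then show ?thesis
    using linear_scale[OF bounded_linear.linear[OF has_derivative_bounded_linear[OF d]]]
    by (simp add: has_field_derivative_def mult_commute_abs)
qed

text \<open>Smoothness is phrased through directional derivatives, which are again real-valued
  functions on the same space, so the predicate can be iterated. All directions are allowed, so time
  \<open>(1, 0)\<close> and space \<open>(0, b)\<close> are treated alike.\<close>

definition C1_local :: "'a::real_normed_vector set \<Rightarrow> ('a \<Rightarrow> real) \<Rightarrow> bool" where
  "C1_local S f \<longleftrightarrow> (\<forall>z\<in>S. f differentiable (at z)) \<and> (\<forall>e. continuous_on S (pderivative e f))"

text \<open>Symmetry of the second derivatives is part of the definition: it is inherited by products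
  and compositions, so Schwarz's theorem is only needed for the given function.\<close>

definition C2_local :: "'a::real_normed_vector set \<Rightarrow> ('a \<Rightarrow> real) \<Rightarrow> bool" where
  "C2_local S f \<longleftrightarrow> C1_local S f \<and> (\<forall>e. C1_local S (pderivative e f)) \<and>
    (\<forall>e h. \<forall>z\<in>S. pderivative e (pderivative h f) z = pderivative h (pderivative e f) z)"

lemma C1_local_imp_continuous_on: "C1_local S f \<Longrightarrow> continuous_on S f"
  by (auto simp: C1_local_def continuous_on_eq_continuous_within
      intro: differentiable_imp_continuous_within differentiable_at_withinI)

lemma C1_local_continuous_on_pderivative: "C1_local S f \<Longrightarrow> continuous_on S (pderivative e f)"
  by (simp add: C1_local_def)

lemma C2_local_imp_C1: "C2_local S f \<Longrightarrow> C1_local S f"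
  and C2_local_imp_C1_pderivative: "C2_local S f \<Longrightarrow> C1_local S (pderivative e f)"
  by (auto simp: C2_local_def)

lemma C2_local_commute:
  "C2_local S f \<Longrightarrow> z \<in> S \<Longrightarrow>
    pderivative e (pderivative h f) z = pderivative h (pderivative e f) z"
  by (auto simp: C2_local_def)

lemma C1_local_differentiable: "C1_local S f \<Longrightarrow> z \<in> S \<Longrightarrow> f differentiable (at z)"
  by (auto simp: C1_local_def)

lemma C1_local_subset: "C1_local S f \<Longrightarrow> T \<subseteq> S \<Longrightarrow> C1_local T f"
  unfolding C1_local_def by (blast intro: continuous_on_subset)

lemma C2_local_subset: "C2_local S f \<Longrightarrow> T \<subseteq> S \<Longrightarrow> C2_local T f"
  unfolding C2_local_def by (blast intro: C1_local_subset)

lemma C1_local_cong: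
  assumes "open S" "\<And>y. y \<in> S \<Longrightarrow> f y = g y" "C1_local S g"
  shows "C1_local S f"
proof -
  have "f differentiable (at z)" if "z \<in> S" for z
    using assms that
    by (metis C1_local_differentiable differentiable_def has_derivative_transform_within_open)
  moreover have "continuous_on S (pderivative e f)" for e
    using assms(3) continuous_on_cong[of S S "pderivative e f" "pderivative e g"]
      pderivative_cong[OF assms(1) _ assms(2)] by (auto simp: C1_local_def)
  ultimately show ?thesis by (auto simp: C1_local_def)
qed

lemma C2_local_cong:
  assumes S: "open S" and eq: "\<And>y. y \<in> S \<Longrightarrow> f y = g y" and g: "C2_local S g"
  shows "C2_local S f"
proof -
  have eq': "pderivative e f y = pderivative e g y" if "y \<in> S" for e y
    using pderivative_cong[OF S that eq] .
  then have "pderivative e (pderivative h f) y = pderivative e (pderivative h g) y"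
    if "y \<in> S" for e h y by (rule pderivative_cong[OF S that])
  then show ?thesis
    using g C1_local_cong[OF S eq] C1_local_cong[OF S eq'] by (auto simp: C2_local_def)
qed

lemma C1_local_Un:
  "open S \<Longrightarrow> open T \<Longrightarrow> C1_local S f \<Longrightarrow> C1_local T f \<Longrightarrow> C1_local (S \<union> T) f"
  by (auto simp: C1_local_def intro: continuous_on_open_Un)

lemma C2_local_Un:
  "open S \<Longrightarrow> open T \<Longrightarrow> C2_local S f \<Longrightarrow> C2_local T f \<Longrightarrow> C2_local (S \<union> T) f"
  by (auto simp: C2_local_def intro: C1_local_Un)

section \<open>Derivative rules and closure properties of the local classes\<close>

lemma pderivative_const [simp]: "pderivative e (\<lambda>z. c) z = 0"
  by (simp add: pderivative_def)

lemma pderivative_add: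
  "f differentiable (at z) \<Longrightarrow> g differentiable (at z) \<Longrightarrow>
    pderivative e (\<lambda>z. f z + g z) z = pderivative e f z + pderivative e g z"
  by (rule pderivative_eqI) (auto intro!: has_derivative_add has_derivative_pderivative)

lemma pderivative_cmult:
  "f differentiable (at z) \<Longrightarrow> pderivative e (\<lambda>z. c * f z) z = c * pderivative e f z"
  by (rule pderivative_eqI) (auto intro!: has_derivative_mult_right has_derivative_pderivative)

lemma pderivative_mult:
  "f differentiable (at z) \<Longrightarrow> g differentiable (at z) \<Longrightarrow>
    pderivative e (\<lambda>z. f z * g z) z = f z * pderivative e g z + pderivative e f z * g z"
  by (rule pderivative_eqI) (auto intro!: has_derivative_mult has_derivative_pderivative)

lemma pderivative_sum:
  "(\<And>i. i \<in> I \<Longrightarrow> f i differentiable (at z)) \<Longrightarrow>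
    pderivative e (\<lambda>z. \<Sum>i\<in>I. f i z) z = (\<Sum>i\<in>I. pderivative e (f i) z)"
  by (rule pderivative_eqI) (auto intro!: has_derivative_sum has_derivative_pderivative)

lemma has_derivative_compose_field:
  assumes "(h has_field_derivative h') (at (f z))" "f differentiable (at z)"
  shows "((\<lambda>z. h (f z)) has_derivative (\<lambda>e. h' * pderivative e f z)) (at z)"
  using has_derivative_compose[OF has_derivative_pderivative[OF assms(2)],
      of h "\<lambda>x. h' * x"] assms(1)
  by (simp add: has_field_derivative_def)

lemma pderivative_compose:
  "(h has_field_derivative h') (at (f z)) \<Longrightarrow> f differentiable (at z) \<Longrightarrow>
    pderivative e (\<lambda>z. h (f z)) z = h' * pderivative e f z"
  by (rule pderivative_eqI[OF has_derivative_compose_field])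

lemma pderivative_linear:
  "bounded_linear f \<Longrightarrow> pderivative e f z = f e"
  by (rule pderivative_eqI) (rule bounded_linear_imp_has_derivative)

lemma C1_local_const [simp]: "C1_local S (\<lambda>z. c)"
  by (auto simp: C1_local_def)

lemma C1_local_add:
  assumes "C1_local S f" "C1_local S g" shows "C1_local S (\<lambda>z. f z + g z)"
  using assms pderivative_add[of f _ g]
  by (auto simp: C1_local_def cong: continuous_on_cong
      intro!: differentiable_add continuous_on_add)

lemma C1_local_mult:
  assumes "C1_local S f" "C1_local S g" shows "C1_local S (\<lambda>z. f z * g z)"
  using assms C1_local_imp_continuous_on[OF assms(1)] C1_local_imp_continuous_on[OF assms(2)]
    pderivative_mult[of f _ g]
  by (auto simp: C1_local_def cong: continuous_on_cong
      intro!: differentiable_mult continuous_on_add continuous_on_mult)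

lemma C1_local_cmult: "C1_local S f \<Longrightarrow> C1_local S (\<lambda>z. c * f z)"
  by (rule C1_local_mult) auto

lemma C1_local_sum:
  "(\<And>i. i \<in> I \<Longrightarrow> C1_local S (f i)) \<Longrightarrow> C1_local S (\<lambda>z. \<Sum>i\<in>I. f i z)"
  by (induction I rule: infinite_finite_induct) (auto intro: C1_local_add)

lemma C1_local_compose:
  assumes f: "C1_local S f" and h: "\<And>x. (h has_field_derivative h' x) (at x)"
    and h': "continuous_on UNIV h'"
  shows "C1_local S (\<lambda>z. h (f z))"
proof -
  have "continuous_on S (\<lambda>z. h' (f z) * pderivative e f z)" for e
    using f C1_local_imp_continuous_on[OF f] 
    by (auto simp: C1_local_def intro!: continuous_on_mult continuous_on_compose2[OF h'])
  then have "continuous_on S (pderivative e (\<lambda>z. h (f z)))" for e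
    using pderivative_compose[OF h C1_local_differentiable[OF f]] by (simp cong: continuous_on_cong)
  then show ?thesis
    using f has_derivative_compose_field[OF h]
    unfolding C1_local_def differentiable_def by blast
qed

lemma C1_local_linear:
  "bounded_linear f \<Longrightarrow> C1_local S f"
  using pderivative_linear[of f] bounded_linear_imp_differentiable[of f]
  by (auto simp: C1_local_def cong: continuous_on_cong)

lemma C2_local_const [simp]: "C2_local S (\<lambda>z. c)"
proof -
  have "pderivative e (\<lambda>z. c) = (\<lambda>z::'a. 0)" for e by auto
  then show ?thesis by (simp add: C2_local_def)
qed

lemma C2_local_linear: "bounded_linear f \<Longrightarrow> C2_local S f"
proof -
  assume f: "bounded_linear f"
  have "pderivative e f = (\<lambda>z. f e)" for e using pderivative_linear[OF f] by auto
  then show ?thesis using f by (simp add: C2_local_def C1_local_linear)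
qed

lemma C2_local_add:
  assumes S: "open S" and f: "C2_local S f" and g: "C2_local S g"
  shows "C2_local S (\<lambda>z. f z + g z)"
proof -
  note d = C1_local_differentiable[OF C2_local_imp_C1[OF f]]
    C1_local_differentiable[OF C2_local_imp_C1[OF g]]
    C1_local_differentiable[OF C2_local_imp_C1_pderivative[OF f]]
    C1_local_differentiable[OF C2_local_imp_C1_pderivative[OF g]]
  have 1: "pderivative e (\<lambda>z. f z + g z) z = pderivative e f z + pderivative e g z"
    if "z \<in> S" for e z using d that by (simp add: pderivative_add)
  have 2: "pderivative h (pderivative e (\<lambda>z. f z + g z)) z =
      pderivative h (pderivative e f) z + pderivative h (pderivative e g) z" if "z \<in> S" for e h z
    using pderivative_cong[OF S that 1] d that by (simp add: pderivative_add)
  show ?thesis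
    using f g C2_local_commute[OF f] C2_local_commute[OF g] C1_local_cong[OF S 1] 2
    by (auto simp: C2_local_def C1_local_add)
qed

lemma C2_local_sum:
  "open S \<Longrightarrow> (\<And>i. i \<in> I \<Longrightarrow> C2_local S (f i)) \<Longrightarrow> C2_local S (\<lambda>z. \<Sum>i\<in>I. f i z)"
  by (induction I rule: infinite_finite_induct) (auto intro: C2_local_add)

lemma C2_local_mult:
  assumes S: "open S" and f: "C2_local S f" and g: "C2_local S g"
  shows "C2_local S (\<lambda>z. f z * g z)"
proof -
  note c = C2_local_imp_C1[OF f] C2_local_imp_C1[OF g]
    C2_local_imp_C1_pderivative[OF f] C2_local_imp_C1_pderivative[OF g]
  note d = c[THEN C1_local_differentiable]
  have 1: "pderivative e (\<lambda>z. f z * g z) z = f z * pderivative e g z + pderivative e f z * g z"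
    if "z \<in> S" for e z using d that by (simp add: pderivative_mult)
  have 2: "pderivative h (pderivative e (\<lambda>z. f z * g z)) z =
      (f z * pderivative h (pderivative e g) z + pderivative h f z * pderivative e g z) +
      (pderivative e f z * pderivative h g z + pderivative h (pderivative e f) z * g z)"
    if "z \<in> S" for e h z
    using pderivative_cong[OF S that 1] d that
    by (simp add: pderivative_add pderivative_mult differentiable_mult)
  show ?thesis unfolding C2_local_def
    using C2_local_commute[OF f] C2_local_commute[OF g] C1_local_cong[OF S 1] 2 c
    by (auto simp: C1_local_add C1_local_mult)
qed

lemma C2_local_compose:
  assumes S: "open S" and f: "C2_local S f"
    and h: "\<And>x. (h has_field_derivative h' x) (at x)"
    and h': "\<And>x. (h' has_field_derivative h'' x) (at x)" and h'': "continuous_on UNIV h''"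
  shows "C2_local S (\<lambda>z. h (f z))"
proof -
  note c = C2_local_imp_C1[OF f] C2_local_imp_C1_pderivative[OF f]
  note d = c[THEN C1_local_differentiable]
  have ch': "continuous_on UNIV h'"
    using h' by (meson DERIV_continuous_on has_field_derivative_at_within)
  have c': "C1_local S (\<lambda>z. h' (f z))" by (rule C1_local_compose[OF c(1) h' h''])
  have 1: "pderivative e (\<lambda>z. h (f z)) z = h' (f z) * pderivative e f z" if "z \<in> S" for e z
    using pderivative_compose[OF h] d that by blast
  have 2: "pderivative k (pderivative e (\<lambda>z. h (f z))) z =
      h' (f z) * pderivative k (pderivative e f) z +
      h'' (f z) * pderivative k f z * pderivative e f z" if "z \<in> S" for e k z
    using pderivative_cong[OF S that 1] d that C1_local_differentiable[OF c' that]
    by (simp add: pderivative_mult pderivative_compose[OF h'])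
  show ?thesis unfolding C2_local_def
    using C2_local_commute[OF f] C1_local_cong[OF S 1] 2 c c' C1_local_compose[OF c(1) h ch']
    by (auto simp: C1_local_mult algebra_simps)
qed

section \<open>Symmetry of mixed second derivatives\<close>

lemma second_difference_mvt:
  fixes f :: "'a::real_normed_vector \<Rightarrow> real"
  assumes s: "0 < s" and sub: "ball z (\<delta>::real) \<subseteq> S" and sm: "s * (norm e + norm h) < \<delta>"
    and f: "\<And>y. y \<in> S \<Longrightarrow> f differentiable (at y)"
    and f': "\<And>y. y \<in> S \<Longrightarrow> pderivative e f differentiable (at y)"
  obtains y where "dist z y < \<delta>" "f (z + s *\<^sub>R e + s *\<^sub>R h) - f (z + s *\<^sub>R e) - f (z + s *\<^sub>R h) + f z
      = s\<^sup>2 * pderivative h (pderivative e f) y"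
proof -
  have near: "z + r *\<^sub>R e + q *\<^sub>R h \<in> ball z \<delta>" if "0 \<le> r" "r \<le> s" "0 \<le> q" "q \<le> s" for r q
  proof -
    have "norm (r *\<^sub>R e + q *\<^sub>R h) \<le> r * norm e + q * norm h"
      using norm_triangle_ineq[of "r *\<^sub>R e" "q *\<^sub>R h"] that by simp
    also have "\<dots> \<le> s * norm e + s * norm h"
      using that by (intro add_mono mult_right_mono) auto
    also have "\<dots> < \<delta>" using sm by (simp add: algebra_simps)
    finally show ?thesis by (simp add: dist_norm norm_minus_commute add.assoc)
      (metis add.commute add_diff_cancel_left' norm_minus_commute)
  qed
  have near0: "z + r *\<^sub>R e \<in> ball z \<delta>" if "0 \<le> r" "r \<le> s" for r
    using near[of r 0] that s by simp
  have d1: "((\<lambda>r. f (z + r *\<^sub>R e + s *\<^sub>R h) - f (z + r *\<^sub>R e)) has_field_derivative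
      pderivative e f (z + r *\<^sub>R e + s *\<^sub>R h) - pderivative e f (z + r *\<^sub>R e)) (at r)"
    if "0 \<le> r" "r \<le> s" for r
  proof -
    have "((\<lambda>r. f ((z + s *\<^sub>R h) + r *\<^sub>R e)) has_field_derivative
        pderivative e f ((z + s *\<^sub>R h) + r *\<^sub>R e)) (at r)"
      using near[of r s] that s sub by (intro DERIV_along_line f) (auto simp: algebra_simps)
    moreover have "((\<lambda>r. f (z + r *\<^sub>R e)) has_field_derivative pderivative e f (z + r *\<^sub>R e)) (at r)"
      using near0[of r] that s sub by (intro DERIV_along_line f) auto
    ultimately show ?thesis by (auto intro!: DERIV_diff simp: algebra_simps)
  qed
  \<comment> \<open>The mean value theorem is applied to the difference of \<open>f\<close> along
    two parallel edges in direction \<open>e\<close>; a second application in direction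
    \<open>h\<close> then produces one mixed derivative at a point of the parallelogram.\<close>
  obtain r where r: "0 < r" "r < s" "(f (z + s *\<^sub>R e + s *\<^sub>R h) - f (z + s *\<^sub>R e)) -
      (f (z + 0 *\<^sub>R e + s *\<^sub>R h) - f (z + 0 *\<^sub>R e)) =
      (s - 0) * (pderivative e f (z + r *\<^sub>R e + s *\<^sub>R h) - pderivative e f (z + r *\<^sub>R e))"
    using MVT2[OF s d1] by blast
  have "((\<lambda>q. pderivative e f (z + r *\<^sub>R e + q *\<^sub>R h)) has_field_derivative
      pderivative h (pderivative e f) (z + r *\<^sub>R e + q *\<^sub>R h)) (at q)"
    if "0 \<le> q" "q \<le> s" for q
    using near[of r q] that r s sub by (intro DERIV_along_line f') auto
  from MVT2[OF s this] obtain q where q: "0 < q" "q < s"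
    "pderivative e f (z + r *\<^sub>R e + s *\<^sub>R h) - pderivative e f (z + r *\<^sub>R e + 0 *\<^sub>R h) =
      (s - 0) * pderivative h (pderivative e f) (z + r *\<^sub>R e + q *\<^sub>R h)"
    by blast
  show ?thesis
    using that[of "z + r *\<^sub>R e + q *\<^sub>R h"] near[of r q] r q
    by (auto simp: power2_eq_square algebra_simps)
qed

text \<open>The second difference over a small parallelogram is symmetric in \<open>e\<close> and
  \<open>h\<close>, so the two mixed derivatives share a value, attained at two points near
  \<open>z\<close>. Continuity at \<open>z\<close>, with tolerance half the supposed gap, gives the
  contradiction.\<close>

lemma pderivative_commute:
  fixes f :: "'a::real_normed_vector \<Rightarrow> real"
  assumes S: "open S" "z \<in> S" and f: "C1_local S f" and f': "\<And>e. C1_local S (pderivative e f)"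
  shows "pderivative e (pderivative h f) z = pderivative h (pderivative e f) z"
proof (rule ccontr)
  let ?F = "pderivative e (pderivative h f)" and ?G = "pderivative h (pderivative e f)"
  assume "?F z \<noteq> ?G z"
  then have eps: "\<bar>?F z - ?G z\<bar> / 2 > 0" by simp
  have cont: "isCont ?F z" "isCont ?G z"
    using f' S by (auto simp: C1_local_def continuous_on_eq_continuous_at)
  obtain d1 where d1: "d1 > 0" "\<And>y. dist y z < d1 \<Longrightarrow> dist (?F y) (?F z) < \<bar>?F z - ?G z\<bar> / 2"
    using cont(1) eps by (metis continuous_at_eps_delta)
  obtain d2 where d2: "d2 > 0" "\<And>y. dist y z < d2 \<Longrightarrow> dist (?G y) (?G z) < \<bar>?F z - ?G z\<bar> / 2"
    using cont(2) eps by (metis continuous_at_eps_delta)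
  obtain d3 where d3: "d3 > 0" "ball z d3 \<subseteq> S" using S openE by blast
  define d where "d = min d1 (min d2 d3)"
  have d: "d > 0" "ball z d \<subseteq> S" using d1 d2 d3 by (auto simp: d_def)
  \<comment> \<open>The summand 1 keeps the denominator positive for \<open>e = h = 0\<close> and
    makes the parallelogram fit strictly inside the ball.\<close>
  define s where "s = d / (norm e + norm h + 1)"
  have p: "norm e + norm h + 1 > 0" by (simp add: add_nonneg_pos)
  have s: "s > 0" using d p by (simp add: s_def)
  have "s * (norm e + norm h) < s * (norm e + norm h + 1)" using s by simp
  also have "\<dots> = d" using p by (simp add: s_def)
  finally have sm: "s * (norm e + norm h) < d" .
  obtain y1 where y1: "dist z y1 < d"
    "f (z + s *\<^sub>R e + s *\<^sub>R h) - f (z + s *\<^sub>R e) - f (z + s *\<^sub>R h) + f z = s\<^sup>2 * ?G y1"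
    using second_difference_mvt[OF s d(2) sm, of f] C1_local_differentiable[OF f] C1_local_differentiable[OF f']
    by blast
  have sm': "s * (norm h + norm e) < d" using sm by (simp add: add.commute)
  obtain y2 where y2: "dist z y2 < d"
    "f (z + s *\<^sub>R h + s *\<^sub>R e) - f (z + s *\<^sub>R h) - f (z + s *\<^sub>R e) + f z = s\<^sup>2 * ?F y2"
    using second_difference_mvt[OF s d(2) sm', of f] C1_local_differentiable[OF f] C1_local_differentiable[OF f']
    by blast
  have sw: "z + s *\<^sub>R h + s *\<^sub>R e = z + s *\<^sub>R e + s *\<^sub>R h" by (simp add: algebra_simps)
  have "s\<^sup>2 * ?G y1 = s\<^sup>2 * ?F y2" using y1(2) y2(2) unfolding sw by linarith
  then have "?G y1 = ?F y2" using s by simp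
  moreover have "dist (?G y1) (?G z) < \<bar>?F z - ?G z\<bar> / 2"
    using y1 by (intro d2) (auto simp: d_def dist_commute)
  moreover have "dist (?F y2) (?F z) < \<bar>?F z - ?G z\<bar> / 2"
    using y2 by (intro d1) (auto simp: d_def dist_commute)
  ultimately show False unfolding dist_real_def by (smt (verit) field_sum_of_halves)
qed

lemma C2_on_imp_C2_local:
  assumes S: "open S" and u: "C2_on S u"
  shows "C2_local S u"
proof -
  obtain u' u'' where u': "\<And>z. z \<in> S \<Longrightarrow> (u has_derivative blinfun_apply (u' z)) (at z)"
    and u'': "\<And>z. z \<in> S \<Longrightarrow> (u' has_derivative blinfun_apply (u'' z)) (at z)"
    and c: "continuous_on S u'" "continuous_on S u''"
    using u by (auto simp: C2_on_def)
  have D1: "pderivative e u z = blinfun_apply (u' z) e" if "z \<in> S" for e z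
    by (rule pderivative_eqI[OF u'[OF that]])
  have d2: "((\<lambda>z. blinfun_apply (u' z) e) has_derivative (\<lambda>h. blinfun_apply (blinfun_apply (u'' z) h) e)) (at z)"
    if "z \<in> S" for e z
    using u''[OF that] by (auto intro!: derivative_eq_intros)
  have D2: "pderivative h (\<lambda>z. blinfun_apply (u' z) e) z = blinfun_apply (blinfun_apply (u'' z) h) e"
    if "z \<in> S" for e h z by (rule pderivative_eqI[OF d2[OF that]])
  have 1: "C1_local S u"
    unfolding C1_local_def using u' c
    by (auto simp: differentiable_def D1 cong: continuous_on_cong intro!: continuous_intros)
  have "C1_local S (\<lambda>z. blinfun_apply (u' z) e)" for e
    unfolding C1_local_def using d2 c
    by (auto simp: differentiable_def D2 cong: continuous_on_cong intro!: continuous_intros) 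
  then have 2: "C1_local S (pderivative e u)" for e
    using C1_local_cong[OF S, of "pderivative e u" "\<lambda>z. blinfun_apply (u' z) e"] D1 by blast
  show ?thesis
    using 1 2 pderivative_commute[OF S _ 1 2] by (auto simp: C2_local_def)
qed

text \<open>Outside \<open>S\<close> nothing is known about \<open>f\<close>, but there the product
  is identically zero. Since \<open>K\<close> is closed and lies in \<open>S\<close>, the open sets
  \<open>S\<close> and \<open>- K\<close> cover the space, and smoothness on each of them
  suffices.\<close>

lemma C2_local_extend:
  assumes S: "open S" "closed K" "K \<subseteq> S" and f: "C2_local S f" and \<eta>: "C2_local UNIV \<eta>"
    and supp: "\<And>z. z \<notin> K \<Longrightarrow> \<eta> z = 0"
  shows "C2_local UNIV (\<lambda>z. \<eta> z * f z)"
proof -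
  have "C2_local S (\<lambda>z. \<eta> z * f z)"
    using S f C2_local_subset[OF \<eta>] by (intro C2_local_mult) auto
  moreover have "C2_local (- K) (\<lambda>z. \<eta> z * f z)"
    by (rule C2_local_cong[of "- K" _ "\<lambda>z. 0"]) (use S supp in auto)
  ultimately have "C2_local (S \<union> - K) (\<lambda>z. \<eta> z * f z)" using S by (intro C2_local_Un) auto
  moreover have "S \<union> - K = UNIV" using S by auto
  ultimately show ?thesis by simp
qed

section \<open>Integration of divergences\<close>

lemma pderivative_eq_0_outside:
  assumes "closed K" "\<And>z. z \<notin> K \<Longrightarrow> f z = 0" "z \<notin> K"
  shows "pderivative e f z = 0"
  using pderivative_cong[of "- K" z f "\<lambda>_. 0" e] assms by auto

lemma continuous_bounded_on_compact:
  fixes f :: "'b::topological_space \<Rightarrow> real"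
  assumes "compact K" "continuous_on K f"
  obtains M where "0 \<le> M" "\<And>z. z \<in> K \<Longrightarrow> \<bar>f z\<bar> \<le> M"
proof -
  obtain M where "\<forall>y\<in>f ` K. norm y \<le> M"
    using compact_imp_bounded[OF compact_continuous_image[OF assms(2,1)]] bounded_iff by blast
  then have "\<bar>f z\<bar> \<le> max M 0" if "z \<in> K" for z
    using that by (simp add: le_max_iff_disj)
  then show ?thesis using that[of "max M 0"] by simp
qed

lemma integrable_compact_support:
  fixes f :: "'a::euclidean_space \<Rightarrow> real"
  assumes "continuous_on UNIV f" "compact K" "\<And>z. z \<notin> K \<Longrightarrow> f z = 0"
  shows "integrable lborel f"
proof -
  have "integrable lborel (\<lambda>x. indicator K x *\<^sub>R f x)"
    using assms by (intro borel_integrable_compact) (auto intro: continuous_on_subset)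
  moreover have "(\<lambda>x. indicator K x *\<^sub>R f x) = f"
    using assms(3) by (force simp: indicator_def)
  ultimately show ?thesis by simp
qed

lemma integral_lborel_translate:
  fixes f :: "'a::euclidean_space \<Rightarrow> real"
  assumes "f \<in> borel_measurable borel"
  shows "(\<integral>z. f (z + c) \<partial>lborel) = (\<integral>z. f z \<partial>lborel)"
proof -
  have "(\<integral>z. f z \<partial>lborel) = (\<integral>z. f z \<partial>distr lborel borel ((+) c))"
    by (simp add: lborel_distr_plus)
  also have "\<dots> = (\<integral>z. f (c + z) \<partial>lborel)"
    using assms by (intro integral_distr) auto
  finally show ?thesis by (simp add: add.commute)
qed

text \<open>Difference quotients integrate to zero by translation invariance, and they converge
  dominatedly to the directional derivative.\<close>

lemma integral_pderivative_eq_0: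
  fixes f :: "'a::euclidean_space \<Rightarrow> real"
  assumes f: "C1_local UNIV f" and K: "compact K" and supp: "\<And>z. z \<notin> K \<Longrightarrow> f z = 0"
  shows "(\<integral>z. pderivative e f z \<partial>lborel) = 0"
proof -
  have cf: "continuous_on UNIV f" by (rule C1_local_imp_continuous_on[OF f])
  have cD: "continuous_on UNIV (pderivative e f)" using f by (auto simp: C1_local_def)
  have D0: "pderivative e f z = 0" if "z \<notin> K" for z
    using pderivative_eq_0_outside[OF compact_imp_closed[OF K] supp that] .
  have "compact (pderivative e f ` K)"
    using K cD by (intro compact_continuous_image) (auto intro: continuous_on_subset)
  then obtain M0 where M0: "\<And>z. z \<in> K \<Longrightarrow> \<bar>pderivative e f z\<bar> \<le> M0"
    by (force dest!: compact_imp_bounded simp: bounded_iff)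
  define M where "M = max M0 0"
  have M: "\<bar>pderivative e f z\<bar> \<le> M" for z
    using M0[of z] D0[of z] by (cases "z \<in> K") (auto simp: M_def)
  obtain B where B: "\<And>z. z \<in> K \<Longrightarrow> norm z \<le> B"
    using compact_imp_bounded[OF K] by (auto simp: bounded_iff)
  \<comment> \<open>The step sizes \<open>h n\<close> are at most 1, so all translated supports stay
    in this one ball; it carries the dominating function.\<close>
  define K' where "K' = cball (0::'a) (B + norm e)"
  define h where "h n = inverse (real (Suc n))" for n
  have h: "0 < h n" "h n \<le> 1" for n by (auto simp: h_def divide_simps)
  define q where "q n z = (f (z + h n *\<^sub>R e) - f z) / h n" for n z
  have meas: "f \<in> borel_measurable borel" by (rule borel_measurable_continuous_onI[OF cf])
  have q0: "(\<integral>z. q n z \<partial>lborel) = 0" for n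
  proof -
    have i1: "integrable lborel f" by (rule integrable_compact_support[OF cf K supp])
    have "continuous_on UNIV (\<lambda>z. f (z + h n *\<^sub>R e))"
      by (intro continuous_on_compose2[OF cf] continuous_intros) auto
    then have i2: "integrable lborel (\<lambda>z. f (z + h n *\<^sub>R e))"
    proof (rule integrable_compact_support[where K = "K'"])
      show "compact K'" by (simp add: K'_def)
      show "f (z + h n *\<^sub>R e) = 0" if "z \<notin> K'" for z
      proof (rule supp, rule)
        assume "z + h n *\<^sub>R e \<in> K"
        then have "norm (z + h n *\<^sub>R e) \<le> B" by (rule B)
        moreover have "norm z \<le> norm (z + h n *\<^sub>R e) + norm (h n *\<^sub>R e)"
          using norm_triangle_ineq4[of "z + h n *\<^sub>R e" "h n *\<^sub>R e"] by simp
        moreover have "norm (h n *\<^sub>R e) \<le> norm e"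
          using h[of n] by (simp add: mult_left_le_one_le)
        ultimately show False using that by (simp add: K'_def)
      qed
    qed
    show ?thesis unfolding q_def
      using i1 i2 integral_lborel_translate[OF meas] by simp
  qed
  have qM: "\<bar>q n z\<bar> \<le> M * indicator K' z" for n z
  proof (cases "z \<in> K'")
    case True
    have "\<And>r. 0 \<le> r \<Longrightarrow> r \<le> h n \<Longrightarrow>
        ((\<lambda>r. f (z + r *\<^sub>R e)) has_field_derivative pderivative e f (z + r *\<^sub>R e)) (at r)"
      using C1_local_differentiable[OF f] by (intro DERIV_along_line) auto
    from MVT2[OF h(1) this] obtain r where
      "f (z + h n *\<^sub>R e) - f (z + 0 *\<^sub>R e) = (h n - 0) * pderivative e f (z + r *\<^sub>R e)" by blast
    then have "q n z = pderivative e f (z + r *\<^sub>R e)" using h[of n] by (simp add: q_def)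
    then show ?thesis using True M by simp
  next
    case False
    have "f z = 0"
    proof (rule supp, rule)
      assume "z \<in> K" then show False using B[of z] False norm_ge_zero[of e] by (simp add: K'_def)
    qed
    moreover have "f (z + h n *\<^sub>R e) = 0"
    proof (rule supp, rule)
      assume "z + h n *\<^sub>R e \<in> K"
      then have "norm (z + h n *\<^sub>R e) \<le> B" by (rule B)
      moreover have "norm z \<le> norm (z + h n *\<^sub>R e) + norm (h n *\<^sub>R e)"
        using norm_triangle_ineq4[of "z + h n *\<^sub>R e" "h n *\<^sub>R e"] by simp
      moreover have "norm (h n *\<^sub>R e) \<le> norm e"
        using h[of n] by (simp add: mult_left_le_one_le)
      ultimately show False using False by (simp add: K'_def)
    qed
    ultimately show ?thesis by (simp add: q_def False)
  qed
  have lim: "(\<lambda>n. q n z) \<longlonglongrightarrow> pderivative e f z" for z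
  proof -
    have "((\<lambda>r. f (z + r *\<^sub>R e)) has_field_derivative pderivative e f (z + 0 *\<^sub>R e)) (at 0)"
      using C1_local_differentiable[OF f] by (intro DERIV_along_line) auto
    then have "((\<lambda>r. (f (z + r *\<^sub>R e) - f z) / r) \<longlongrightarrow> pderivative e f z) (at 0)"
      by (simp add: DERIV_def)
    moreover have "filterlim h (at 0) sequentially"
      unfolding filterlim_at using h LIMSEQ_inverse_real_of_nat
      by (auto simp: h_def[abs_def] eventually_sequentially)
    ultimately show ?thesis unfolding q_def by (rule filterlim_compose)
  qed
  have cq: "q n \<in> borel_measurable lborel" for n
    unfolding q_def using meas by measurable
  have "(\<lambda>n. (\<integral>z. q n z \<partial>lborel)) \<longlonglongrightarrow> (\<integral>z. pderivative e f z \<partial>lborel)"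
  proof (rule integral_dominated_convergence)
    show "integrable lborel (\<lambda>z. M * indicator K' z)"
      unfolding K'_def by (intro integrable_mult_right integrable_real_indicator)
        (use emeasure_lborel_cball_finite in \<open>auto simp: less_top\<close>)
    show "pderivative e f \<in> borel_measurable lborel"
      using borel_measurable_continuous_onI[OF cD] by simp
  qed (use cq lim qM in auto)
  then show ?thesis using q0 LIMSEQ_unique by (simp add: LIMSEQ_const_iff)
qed

section \<open>The Carleman identity\<close>

text \<open>The product of the symmetric and the antisymmetric part of the conjugated heat operator,
  written as a divergence plus the commutator terms.\<close>

lemma carleman_identity:
  fixes v Q p :: "real \<times> 'a::euclidean_space \<Rightarrow> real" and a :: "'a \<Rightarrow> real \<times> 'a \<Rightarrow> real" and \<tau> :: real
  assumes v: "C2_local UNIV v" and Q: "C1_local UNIV Q" and p: "C1_local UNIV p"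
    and a: "\<And>b. C1_local UNIV (a b)"
  defines "V \<equiv> \<lambda>b. pderivative (0, b) v"
  defines "Vt \<equiv> pderivative (1, 0) v"
  defines "Ft \<equiv> \<lambda>z. 1 / 2 * (\<Sum>b\<in>Basis. V b z * V b z) + (- 1 / 2) * (Q z * (v z * v z))"
  defines "F \<equiv> \<lambda>j z. (- 1) * (Vt z * V j z) + ((- 2 * \<tau>) * (V j z * (\<Sum>i\<in>Basis. a i z * V i z))
      + (\<tau> * (a j z * (\<Sum>i\<in>Basis. V i z * V i z))
      + ((- \<tau>) * (p z * (v z * V j z)) + (- \<tau>) * (Q z * (a j z * (v z * v z))))))"
  shows "(- (\<Sum>b\<in>Basis. pderivative (0, b) (V b) z) - Q z * v z) *
      (Vt z + 2 * \<tau> * (\<Sum>b\<in>Basis. a b z * V b z) + \<tau> * p z * v z) =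
    pderivative (1, 0) Ft z + (\<Sum>j\<in>Basis. pderivative (0, j) (F j) z) +
    (2 * \<tau> * (\<Sum>j\<in>Basis. \<Sum>i\<in>Basis. pderivative (0, j) (a i) z * V i z * V j z) +
     \<tau> * (p z - (\<Sum>j\<in>Basis. pderivative (0, j) (a j) z)) * (\<Sum>b\<in>Basis. V b z * V b z) +
     \<tau> * v z * (\<Sum>j\<in>Basis. pderivative (0, j) p z * V j z) +
     (1 / 2 * pderivative (1, 0) Q z + \<tau> * (\<Sum>j\<in>Basis. pderivative (0, j) Q z * a j z) +
       \<tau> * Q z * ((\<Sum>j\<in>Basis. pderivative (0, j) (a j) z) - p z)) * (v z * v z))"
    and "C1_local UNIV Ft" and "C1_local UNIV (F j)"
proof -
  have cv: "C1_local UNIV v" and cV: "C1_local UNIV (V b)" and cVt: "C1_local UNIV Vt" for b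
    unfolding V_def Vt_def using v by (auto intro: C2_local_imp_C1 C2_local_imp_C1_pderivative)
  note c = cv cV cVt Q p a
  note d = c[THEN C1_local_differentiable, OF UNIV_I]
  show "C1_local UNIV Ft" unfolding Ft_def
    by (intro C1_local_add C1_local_cmult C1_local_sum C1_local_mult c)
  show "C1_local UNIV (F j)" unfolding F_def
    by (intro C1_local_add C1_local_cmult C1_local_sum C1_local_mult c)
  have dsum: "(\<lambda>z. \<Sum>i\<in>Basis. V i z * V i z) differentiable (at z)"
    "(\<lambda>z. \<Sum>i\<in>Basis. a i z * V i z) differentiable (at z)" for z
    by (intro C1_local_differentiable[OF _ UNIV_I] C1_local_sum C1_local_mult c)+
  define H where "H j i = pderivative (0, j) (V i) z" for i j
  define Ht where "Ht j = pderivative (0, j) Vt z" for j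
  have sym: "H j i = H i j" for i j
    unfolding H_def V_def by (rule C2_local_commute[OF v]) simp
  \<comment> \<open>Because time and space derivatives commute, the mixed term \<open>T\<close> from
    the time derivative of \<open>Ft\<close> cancels the one from the divergence of the flux
    \<open>- Vt * V j\<close>.\<close>
  have symt: "pderivative (1, 0) (V j) z = Ht j" for j
    unfolding Ht_def V_def Vt_def by (rule C2_local_commute[OF v]) simp
  have symt': "pderivative (1, 0) v z = Vt z" "pderivative (0, j) v z = V j z" for j
    by (auto simp: V_def Vt_def)
  note simps = pderivative_add pderivative_cmult pderivative_mult pderivative_sum
    differentiable_add differentiable_mult d dsum symt symt'
  define L G AV dA W W' T where "L = (\<Sum>b\<in>Basis. H b b)" and "G = (\<Sum>b\<in>Basis. V b z * V b z)"
    and "AV = (\<Sum>b\<in>Basis. a b z * V b z)" and "dA = (\<Sum>j\<in>Basis. pderivative (0, j) (a j) z)"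
    and "W = (\<Sum>j\<in>Basis. V j z * (\<Sum>i\<in>Basis. a i z * H j i))"
    and "W' = (\<Sum>j\<in>Basis. a j z * (\<Sum>i\<in>Basis. V i z * H j i))"
    and "T = (\<Sum>j\<in>Basis. V j z * Ht j)"
  define Y where "Y = (\<Sum>j\<in>Basis. \<Sum>i\<in>Basis. pderivative (0, j) (a i) z * V i z * V j z)"
  define dp where "dp = (\<Sum>j\<in>Basis. pderivative (0, j) p z * V j z)"
  define dQ where "dQ = (\<Sum>j\<in>Basis. pderivative (0, j) Q z * a j z)"
  have Y': "Y = (\<Sum>j\<in>Basis. (\<Sum>i\<in>Basis. pderivative (0, j) (a i) z * V i z) * V j z)"
    by (simp add: Y_def sum_distrib_right)
  \<comment> \<open>Both contractions pair the Hessian of \<open>v\<close> with \<open>a\<close> and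
    the gradient. They come from the fluxes with coefficients \<open>- 2 * \<tau>\<close> and
    \<open>\<tau>\<close>, the latter doubled by differentiating a square. Symmetry of the Hessian
    makes them cancel, so no second derivatives are left outside the divergence.\<close>
  have WW: "W' = W"
  proof -
    have "W' = (\<Sum>j\<in>Basis. \<Sum>i\<in>Basis. a j z * V i z * H j i)"
      by (simp add: W'_def sum_distrib_left mult.assoc)
    also have "\<dots> = (\<Sum>i\<in>Basis. \<Sum>j\<in>Basis. a j z * V i z * H j i)" by (rule sum.swap)
    also have "\<dots> = W" unfolding W_def sum_distrib_left
      by (intro sum.cong refl) (simp add: sym mult_ac)
    finally show ?thesis .
  qed
  have 0: "pderivative (1, 0) Ft z =
      T - 1 / 2 * pderivative (1, 0) Q z * (v z * v z) - Q z * v z * Vt z"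
  proof -
    have "pderivative (1, 0) (\<lambda>z. \<Sum>b\<in>Basis. V b z * V b z) z = (\<Sum>b\<in>Basis. 2 * (V b z * Ht b))"
      by (simp add: simps mult.commute)
    also have "\<dots> = 2 * T" by (simp add: T_def sum_distrib_left)
    finally show ?thesis unfolding Ft_def
      by (subst pderivative_add; (subst pderivative_cmult)?; (subst pderivative_cmult)?;
          (intro differentiable_mult differentiable_const d dsum)?)
        (simp add: simps algebra_simps)
  qed
  have dG: "pderivative (0, j) (\<lambda>z. \<Sum>i\<in>Basis. V i z * V i z) z = 2 * (\<Sum>i\<in>Basis. V i z * H j i)" for j
    by (simp add: simps H_def sum_distrib_left mult.commute)
  have dAV: "pderivative (0, j) (\<lambda>z. \<Sum>i\<in>Basis. a i z * V i z) z =
      (\<Sum>i\<in>Basis. a i z * H j i) + (\<Sum>i\<in>Basis. pderivative (0, j) (a i) z * V i z)" for j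
    by (simp add: simps H_def sum.distrib)
  \<comment> \<open>The five fluxes come from four products: minus the Laplacian times
    \<open>Vt\<close>, times the transport term along \<open>a\<close> (two fluxes) and times
    \<open>\<tau> * p * v\<close>, and finally \<open>- Q * v\<close> times the transport term. The
    product of \<open>- Q * v\<close> with \<open>\<tau> * p * v\<close> is left as it is.\<close>
  have Fj: "pderivative (0, j) (F j) z =
      (- (V j z * Ht j) - Vt z * H j j)
      + (- 2 * \<tau>) * (H j j * AV + V j z * (\<Sum>i\<in>Basis. a i z * H j i)
          + (\<Sum>i\<in>Basis. pderivative (0, j) (a i) z * V i z) * V j z)
      + \<tau> * (pderivative (0, j) (a j) z * G + 2 * (a j z * (\<Sum>i\<in>Basis. V i z * H j i)))
      + (- \<tau>) * (v z * (pderivative (0, j) p z * V j z) + p z * (V j z * V j z) + p z * v z * H j j)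
      + (- \<tau>) * ((pderivative (0, j) Q z * a j z) * (v z * v z)
          + Q z * (v z * v z) * pderivative (0, j) (a j) z + 2 * Q z * v z * (a j z * V j z))" for j
    unfolding F_def
    by (simp only: pderivative_add pderivative_cmult pderivative_mult
        differentiable_add differentiable_mult differentiable_const d dsum symt' dG dAV,
      simp add: H_def[symmetric] Ht_def[symmetric] AV_def[symmetric] G_def[symmetric],
      simp add: sum_distrib_right[symmetric] algebra_simps)
  have "(\<Sum>j\<in>Basis. pderivative (0, j) (F j) z) =
      (- T - Vt z * L) + (- 2 * \<tau>) * (L * AV + W + Y) + \<tau> * (dA * G + 2 * W')
      + (- \<tau>) * (v z * dp + p z * G + p z * v z * L)
      + (- \<tau>) * (dQ * (v z * v z) + Q z * (v z * v z) * dA + 2 * Q z * v z * AV)"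
    unfolding Fj T_def L_def W_def W'_def Y' dA_def dp_def dQ_def
    unfolding AV_def[symmetric] G_def[symmetric]
    by (simp only: sum.distrib sum_subtractf sum_negf sum_distrib_left[symmetric]
        sum_distrib_right[symmetric]) (simp add: AV_def[symmetric] G_def[symmetric])
  then show "(- (\<Sum>b\<in>Basis. pderivative (0, b) (V b) z) - Q z * v z) *
      (Vt z + 2 * \<tau> * (\<Sum>b\<in>Basis. a b z * V b z) + \<tau> * p z * v z) =
    pderivative (1, 0) Ft z + (\<Sum>j\<in>Basis. pderivative (0, j) (F j) z) +
    (2 * \<tau> * (\<Sum>j\<in>Basis. \<Sum>i\<in>Basis. pderivative (0, j) (a i) z * V i z * V j z) +
     \<tau> * (p z - (\<Sum>j\<in>Basis. pderivative (0, j) (a j) z)) * (\<Sum>b\<in>Basis. V b z * V b z) +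
     \<tau> * v z * (\<Sum>j\<in>Basis. pderivative (0, j) p z * V j z) +
     (1 / 2 * pderivative (1, 0) Q z + \<tau> * (\<Sum>j\<in>Basis. pderivative (0, j) Q z * a j z) +
       \<tau> * Q z * ((\<Sum>j\<in>Basis. pderivative (0, j) (a j) z) - p z)) * (v z * v z))"
    unfolding 0 WW
    unfolding H_def[symmetric] L_def[symmetric] AV_def[symmetric] G_def[symmetric]
      dA_def[symmetric] Y_def[symmetric] dp_def[symmetric] dQ_def[symmetric]
    by (simp add: field_simps)
qed

section \<open>The Carleman estimate\<close>

text \<open>The right-hand side is the closed form of the commutator terms at one point, with
  \<open>s\<close> the squared distance to \<open>x0\<close>, \<open>G\<close> the squared gradient
  and \<open>Y\<close> the derivative along \<open>x - x0\<close>. The \<open>\<tau>^3\<close> term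
  decides: half of it is kept, the other half pays for the lower orders, which \<open>M\<close>
  collects.\<close>

lemma carleman_coefficient_bound:
  fixes \<mu> \<tau> A A0 s \<gamma> \<gamma>' Y G v q M :: real
  assumes "0 < \<mu>" "1 \<le> \<tau>" "0 < A0" "A0 \<le> A" "2 \<le> \<mu> * s" "0 \<le> G"
    and M: "A * q\<^sup>2 / (32 * \<mu>\<^sup>2) + \<bar>\<gamma>'\<bar> / 2 + 6 * \<bar>\<gamma>\<bar> * \<mu> * A + 36 * \<mu>\<^sup>2 * A\<^sup>2 \<le> M"
    and \<tau>M: "M \<le> 24 * \<mu>\<^sup>2 * A0 ^ 3 * \<tau>"
  shows "2 * \<tau> * \<mu> * A0 * G + 24 * \<mu>\<^sup>2 * A0 ^ 3 * \<tau> ^ 3 * (v * v) \<le>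
    2 * \<tau> * (A * (4 * \<mu>\<^sup>2 * Y\<^sup>2 - 2 * \<mu> * G)) + \<tau> * (6 * \<mu> * A) * G + \<tau> * v * (A * q * Y) +
    (1 / 2 * (- \<tau> * \<gamma>') +
     \<tau> * (- 2 * \<mu> * s * A * (4 * \<tau>\<^sup>2 * \<mu>\<^sup>2 * (2 - 4 * \<mu> * s) * A\<^sup>2 - 12 * \<tau> * \<mu>\<^sup>2 * A)) +
     \<tau> * (4 * \<tau>\<^sup>2 * \<mu>\<^sup>2 * (s * A\<^sup>2) - \<tau> * \<gamma> + 6 * \<tau> * \<mu> * A) * (- 6 * \<mu> * A)) * (v * v)"
    (is "?L \<le> ?R")
proof -
  have A: "A > 0" and \<tau>: "\<tau> > 0" using assms(2-4) by linarith+
  have "0 < \<mu> * s" using assms(5) by linarith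
  then have s: "s > 0" using assms(1) by (rule zero_less_mult_pos)
  \<comment> \<open>Completing the square: the radial part of the Hessian supplies
    \<open>8 * \<mu>\<^sup>2 * Y\<^sup>2\<close>, which absorbs the cross term with the gradient of
    \<open>p\<close>.\<close>
  have sq: "8 * \<mu>\<^sup>2 * Y\<^sup>2 + v * q * Y \<ge> - (q\<^sup>2 / (32 * \<mu>\<^sup>2)) * (v * v)"
  proof -
    have "0 \<le> 8 * \<mu>\<^sup>2 * (Y + v * q / (16 * \<mu>\<^sup>2))\<^sup>2" by simp
    also have "\<dots> = 8 * \<mu>\<^sup>2 * Y\<^sup>2 + v * q * Y + (q\<^sup>2 / (32 * \<mu>\<^sup>2)) * (v * v)"
      using assms(1) by (simp add: field_simps power2_eq_square)
    finally show ?thesis by simp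
  qed
  have R: "?R = 2 * \<tau> * \<mu> * A * G + \<tau> * A * (8 * \<mu>\<^sup>2 * Y\<^sup>2 + v * q * Y) +
    (\<tau> ^ 3 * (4 * \<mu> ^ 3 * s * A ^ 3 * (8 * \<mu> * s - 10)) + 24 * \<tau>\<^sup>2 * \<mu> ^ 3 * s * A\<^sup>2
      - \<tau> * \<gamma>' / 2 + 6 * \<tau>\<^sup>2 * \<gamma> * \<mu> * A - 36 * \<tau>\<^sup>2 * \<mu>\<^sup>2 * A\<^sup>2) * (v * v)"
    by (simp add: algebra_simps power2_eq_square power3_eq_cube)
  have g1: "2 * \<tau> * \<mu> * A0 * G \<le> 2 * \<tau> * \<mu> * A * G"
    using assms(1,4,6) \<tau> by (intro mult_right_mono mult_left_mono) auto
  have g2: "\<tau> * A * (8 * \<mu>\<^sup>2 * Y\<^sup>2 + v * q * Y) \<ge> - (\<tau> * (A * q\<^sup>2 / (32 * \<mu>\<^sup>2))) * (v * v)"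
    using mult_left_mono[OF sq, of "\<tau> * A"] A \<tau> by (simp add: mult_ac)
  \<comment> \<open>\<open>2 \<le> \<mu> * s\<close> gives
    \<open>8 * \<mu> * s - 10 \<ge> 6\<close>, and the remaining factor \<open>\<mu> * s\<close>
    gives another 2. The coefficient is thus at least \<open>4 * 12 = 48\<close> times
    \<open>\<mu>\<^sup>2 * A0 ^ 3\<close>, twice what the conclusion keeps.\<close>
  have c3: "48 * \<mu>\<^sup>2 * A0 ^ 3 \<le> 4 * \<mu> ^ 3 * s * A ^ 3 * (8 * \<mu> * s - 10)"
  proof -
    have "48 * \<mu>\<^sup>2 * A0 ^ 3 \<le> 48 * \<mu>\<^sup>2 * A ^ 3"
      using assms(3,4) by (intro mult_left_mono power_mono) auto
    also have "\<dots> = 4 * \<mu>\<^sup>2 * A ^ 3 * (2 * 6)" by simp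
    also have "\<dots> \<le> 4 * \<mu>\<^sup>2 * A ^ 3 * ((\<mu> * s) * (8 * \<mu> * s - 10))"
      using assms(1,5) A by (intro mult_left_mono mult_mono) auto
    finally show ?thesis by (simp add: power2_eq_square power3_eq_cube mult_ac)
  qed
  \<comment> \<open>Since \<open>\<tau> \<ge> 1\<close>, the terms linear in \<open>\<tau>\<close>
    are raised to order \<open>\<tau>\<^sup>2\<close>, so that one threshold for
    \<open>\<tau>\<close> handles all lower orders.\<close>
  have t2: "\<tau> * x \<le> \<tau>\<^sup>2 * x" if "0 \<le> x" for x
    using assms(2) that by (intro mult_right_mono) (auto simp: power2_eq_square)
  have b1: "\<tau> * (A * q\<^sup>2 / (32 * \<mu>\<^sup>2)) \<le> \<tau>\<^sup>2 * (A * q\<^sup>2 / (32 * \<mu>\<^sup>2))"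
    using A by (intro t2) auto
  have b2: "\<tau> * \<gamma>' / 2 \<le> \<tau>\<^sup>2 * (\<bar>\<gamma>'\<bar> / 2)"
  proof -
    have "\<tau> * (\<gamma>' / 2) \<le> \<tau> * (\<bar>\<gamma>'\<bar> / 2)" using \<tau> by (intro mult_left_mono) auto
    also have "\<dots> \<le> \<tau>\<^sup>2 * (\<bar>\<gamma>'\<bar> / 2)" by (rule t2) simp
    finally show ?thesis by (simp only: times_divide_eq_right)
  qed
  have b3: "- (6 * \<tau>\<^sup>2 * \<gamma> * \<mu> * A) \<le> \<tau>\<^sup>2 * (6 * \<bar>\<gamma>\<bar> * \<mu> * A)"
  proof -
    have "\<tau>\<^sup>2 * (6 * (- \<gamma>) * \<mu> * A) \<le> \<tau>\<^sup>2 * (6 * \<bar>\<gamma>\<bar> * \<mu> * A)"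
      using assms(1) A by (intro mult_left_mono mult_right_mono) auto
    moreover have "\<tau>\<^sup>2 * (6 * (- \<gamma>) * \<mu> * A) = - (6 * \<tau>\<^sup>2 * \<gamma> * \<mu> * A)" by (simp only: mult_ac mult_minus_left mult_minus_right)
    ultimately show ?thesis by (simp only:)
  qed
  have b4: "0 \<le> 24 * \<tau>\<^sup>2 * \<mu> ^ 3 * s * A\<^sup>2" using assms(1) s by simp
  have "\<tau>\<^sup>2 * (A * q\<^sup>2 / (32 * \<mu>\<^sup>2) + \<bar>\<gamma>'\<bar> / 2 + 6 * \<bar>\<gamma>\<bar> * \<mu> * A + 36 * \<mu>\<^sup>2 * A\<^sup>2) \<le> \<tau>\<^sup>2 * M"
    by (rule mult_left_mono[OF M]) simp
  also have "\<dots> \<le> \<tau>\<^sup>2 * (24 * \<mu>\<^sup>2 * A0 ^ 3 * \<tau>)"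
    by (rule mult_left_mono[OF \<tau>M]) simp
  also have "\<dots> = 24 * \<mu>\<^sup>2 * A0 ^ 3 * \<tau> ^ 3" by (simp add: power2_eq_square power3_eq_cube)
  finally have low: "\<tau>\<^sup>2 * (A * q\<^sup>2 / (32 * \<mu>\<^sup>2)) + \<tau>\<^sup>2 * (\<bar>\<gamma>'\<bar> / 2) + \<tau>\<^sup>2 * (6 * \<bar>\<gamma>\<bar> * \<mu> * A)
      + 36 * \<tau>\<^sup>2 * \<mu>\<^sup>2 * A\<^sup>2 \<le> 24 * \<mu>\<^sup>2 * A0 ^ 3 * \<tau> ^ 3" by (simp only: distrib_left mult_ac)
  have "\<tau> ^ 3 * (48 * \<mu>\<^sup>2 * A0 ^ 3) \<le> \<tau> ^ 3 * (4 * \<mu> ^ 3 * s * A ^ 3 * (8 * \<mu> * s - 10))"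
    using c3 \<tau> by (intro mult_left_mono) auto
  then have high: "2 * (24 * \<mu>\<^sup>2 * A0 ^ 3 * \<tau> ^ 3) \<le> \<tau> ^ 3 * (4 * \<mu> ^ 3 * s * A ^ 3 * (8 * \<mu> * s - 10))"
    by (simp only: mult_ac)
  have lin: "l \<le> h + t4 - t2 + t3 - t5 - t1"
    if "t1 \<le> u1" "t2 \<le> u2" "- t3 \<le> u3" "0 \<le> t4" "u1 + u2 + u3 + t5 \<le> l" "2 * l \<le> h"
    for l h t1 t2 t3 t4 t5 u1 u2 u3 :: real
    using that by linarith
  have "24 * \<mu>\<^sup>2 * A0 ^ 3 * \<tau> ^ 3 \<le> \<tau> ^ 3 * (4 * \<mu> ^ 3 * s * A ^ 3 * (8 * \<mu> * s - 10)) + 24 * \<tau>\<^sup>2 * \<mu> ^ 3 * s * A\<^sup>2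
      - \<tau> * \<gamma>' / 2 + 6 * \<tau>\<^sup>2 * \<gamma> * \<mu> * A - 36 * \<tau>\<^sup>2 * \<mu>\<^sup>2 * A\<^sup>2 - \<tau> * (A * q\<^sup>2 / (32 * \<mu>\<^sup>2))"
    by (rule lin[OF b1 b2 b3 b4 low high])
  from mult_right_mono[OF this zero_le_square[of v]]
  have "24 * \<mu>\<^sup>2 * A0 ^ 3 * \<tau> ^ 3 * (v * v) \<le>
      (\<tau> ^ 3 * (4 * \<mu> ^ 3 * s * A ^ 3 * (8 * \<mu> * s - 10)) + 24 * \<tau>\<^sup>2 * \<mu> ^ 3 * s * A\<^sup>2
      - \<tau> * \<gamma>' / 2 + 6 * \<tau>\<^sup>2 * \<gamma> * \<mu> * A - 36 * \<tau>\<^sup>2 * \<mu>\<^sup>2 * A\<^sup>2) * (v * v)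
      - \<tau> * (A * q\<^sup>2 / (32 * \<mu>\<^sup>2)) * (v * v)"
    by (simp only: left_diff_distrib)
  moreover have "l1 + l2 \<le> r1 + x + y" if "l1 \<le> r1" "- k * w \<le> x" "l2 \<le> y - k * w"
    for l1 l2 r1 x y k w :: real using that by simp
  ultimately show ?thesis unfolding R using g1 g2 by blast
qed

section \<open>The Gaussian weight and its derivatives\<close>

definition spatial_sqdist :: "'a::euclidean_space \<Rightarrow> real \<times> 'a \<Rightarrow> real" where
  "spatial_sqdist x0 z = (snd z - x0) \<bullet> (snd z - x0)"

lemma C2_inner_snd_diff: "C2_local UNIV (\<lambda>z::real \<times> 'a::euclidean_space. (snd z - x0) \<bullet> b)"
proof -
  have "C2_local UNIV (\<lambda>z::real \<times> 'a. snd z \<bullet> b + - (x0 \<bullet> b))"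
    by (intro C2_local_add C2_local_linear C2_local_const bounded_linear_inner_left_comp
        bounded_linear_snd) auto
  then show ?thesis by (simp add: inner_diff_left)
qed

lemma C2_spatial_sqdist: "C2_local UNIV (spatial_sqdist x0)"
proof -
  have "C2_local UNIV (\<lambda>z::real \<times> 'a. \<Sum>b\<in>Basis. ((snd z - x0) \<bullet> b) * ((snd z - x0) \<bullet> b))"
    by (intro C2_local_sum C2_local_mult C2_inner_snd_diff) auto
  also have "(\<lambda>z::real \<times> 'a. \<Sum>b\<in>Basis. ((snd z - x0) \<bullet> b) * ((snd z - x0) \<bullet> b)) = spatial_sqdist x0"
    unfolding spatial_sqdist_def by (rule ext, rule euclidean_inner[symmetric])
  finally show ?thesis .
qed

text \<open>The symmetric part contains the time derivative of the weight, and the commutator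
  differentiates it once more; hence \<open>g\<close> comes with two derivatives. Its concrete shape
  matters only when the cutoff errors are compared, so it stays abstract here.\<close>

locale carleman_weight =
  fixes x0 :: "'a::euclidean_space" and \<mu> :: real and g \<gamma> \<gamma>' :: "real \<Rightarrow> real"
  assumes \<mu>_pos: "0 < \<mu>"
    and g: "\<And>t. (g has_field_derivative \<gamma> t) (at t)"
    and \<gamma>: "\<And>t. (\<gamma> has_field_derivative \<gamma>' t) (at t)"
    and \<gamma>': "continuous_on UNIV \<gamma>'"
begin

text \<open>The function \<open>a b\<close> is the derivative of \<open>\<phi>\<close> in direction \<open>b\<close>. The symmetric part of the
  operator conjugated with \<open>exp (\<tau> * \<phi>)\<close> is minus the Laplacian minus \<open>Q \<tau>\<close>, where the multiple \<open>6 * \<tau> * \<mu> * A\<close>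
  of the identity has been moved over from the antisymmetric part: it compensates the negative
  part of the Hessian of \<open>A\<close>.\<close>

definition X :: "'a \<Rightarrow> real \<times> 'a \<Rightarrow> real" where "X b z = (snd z - x0) \<bullet> b"
abbreviation s :: "real \<times> 'a \<Rightarrow> real" where "s \<equiv> spatial_sqdist x0"
definition A :: "real \<times> 'a \<Rightarrow> real" where "A z = exp (- \<mu> * s z)"
definition \<phi> :: "real \<times> 'a \<Rightarrow> real" where "\<phi> z = A z + (- 1) * g (fst z)"
definition a :: "'a \<Rightarrow> real \<times> 'a \<Rightarrow> real" where "a b z = (- 2 * \<mu>) * (X b z * A z)"
text \<open>The Laplacian of \<open>\<phi>\<close> plus \<open>6 * \<mu> * A\<close>. The part
  \<open>- 2 * \<mu> * A\<close> of the Hessian enters the commutator as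
  \<open>- 4 * \<tau> * \<mu> * A\<close> times the squared gradient, so the shift must exceed
  \<open>4 * \<mu> * A\<close>; with 6 a margin of \<open>2 * \<tau> * \<mu> * A\<close>
  remains.\<close>

definition p :: "real \<times> 'a \<Rightarrow> real" where
  "p z = A z * (4 * \<mu>\<^sup>2 * s z + (6 * \<mu> - 2 * \<mu> * real DIM('a)))"
definition Q :: "real \<Rightarrow> real \<times> 'a \<Rightarrow> real" where
  "Q \<tau> z = 4 * \<tau>\<^sup>2 * \<mu>\<^sup>2 * (s z * (A z * A z)) + ((- \<tau>) * \<gamma> (fst z) + 6 * \<tau> * \<mu> * A z)"

lemma sum_X_X: "(\<Sum>b\<in>Basis. X b z * X b z) = s z"
  unfolding spatial_sqdist_def X_def by (rule euclidean_inner[symmetric])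

lemma C2_X: "C2_local UNIV (X b)"
  unfolding X_def by (rule C2_inner_snd_diff)

lemma pderivative_X: "pderivative e (X b) z = snd e \<bullet> b"
  unfolding X_def by (rule pderivative_eqI) (auto intro!: derivative_eq_intros)

lemma pderivative_s: "pderivative e s z = 2 * ((snd z - x0) \<bullet> snd e)"
  unfolding spatial_sqdist_def by (rule pderivative_eqI) (auto intro!: derivative_eq_intros simp: inner_commute)

lemma C2_A: "C2_local UNIV A"
  unfolding A_def
  by (rule C2_local_compose[where h = "\<lambda>x. exp (- \<mu> * x)" and h' = "\<lambda>x. - \<mu> * exp (- \<mu> * x)"
        and h'' = "\<lambda>x. \<mu>\<^sup>2 * exp (- \<mu> * x)"])
    (auto intro!: C2_spatial_sqdist derivative_eq_intros continuous_intros simp: power2_eq_square)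

lemma pderivative_A: "pderivative e A z = (- 2 * \<mu>) * (X (snd e) z * A z)"
proof -
  have "pderivative e (\<lambda>z. exp (- \<mu> * s z)) z = (- \<mu> * exp (- \<mu> * s z)) * pderivative e s z"
    by (rule pderivative_compose[where h = "\<lambda>x. exp (- \<mu> * x)"])
      (auto intro!: derivative_eq_intros C1_local_differentiable[OF C2_local_imp_C1[OF C2_spatial_sqdist]])
  then show ?thesis by (simp add: A_def[abs_def] pderivative_s X_def)
qed

lemma C2_g: "C2_local UNIV (\<lambda>z::real \<times> 'a. g (fst z))"
  by (rule C2_local_compose[OF _ _ g \<gamma> \<gamma>']) (auto intro: C2_local_linear bounded_linear_fst)

lemma continuous_\<gamma>: "continuous_on UNIV \<gamma>"
  using \<gamma> by (meson DERIV_continuous_on has_field_derivative_at_within)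

lemma C1_\<gamma>: "C1_local UNIV (\<lambda>z::real \<times> 'a. \<gamma> (fst z))"
  by (rule C1_local_compose[OF _ \<gamma> \<gamma>']) (auto intro: C1_local_linear bounded_linear_fst)

lemma pderivative_g: "pderivative e (\<lambda>z::real \<times> 'a. g (fst z)) z = \<gamma> (fst z) * fst e"
  using pderivative_compose[OF g, of fst z e] pderivative_linear[OF bounded_linear_fst, of e z]
  by (simp add: bounded_linear_imp_differentiable bounded_linear_fst)

lemma pderivative_\<gamma>: "pderivative e (\<lambda>z::real \<times> 'a. \<gamma> (fst z)) z = \<gamma>' (fst z) * fst e"
  using pderivative_compose[OF \<gamma>, of fst z e] pderivative_linear[OF bounded_linear_fst, of e z]
  by (simp add: bounded_linear_imp_differentiable bounded_linear_fst)

lemmas C1s = C2_local_imp_C1[OF C2_X] C2_local_imp_C1[OF C2_spatial_sqdist] C2_local_imp_C1[OF C2_A]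
  C2_local_imp_C1[OF C2_g] C1_\<gamma>

lemmas diffs = C1s[THEN C1_local_differentiable, OF UNIV_I]

lemma C2_\<phi>: "C2_local UNIV \<phi>"
  unfolding \<phi>_def by (intro C2_local_add C2_local_mult C2_local_const C2_A C2_g) auto

lemma pderivative_\<phi>: "pderivative e \<phi> z = a (snd e) z - \<gamma> (fst z) * fst e"
proof -
  have "pderivative e \<phi> z = pderivative e A z + (- 1) * pderivative e (\<lambda>z. g (fst z)) z"
    unfolding \<phi>_def
    by (simp only: pderivative_add pderivative_cmult diffs differentiable_mult differentiable_const)
  then show ?thesis by (simp add: pderivative_A pderivative_g a_def)
qed

lemma C1_a: "C1_local UNIV (a b)"
  unfolding a_def by (intro C1_local_cmult C1_local_mult C1s)

lemma pderivative_a: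
  "pderivative (0, c) (a b) z = A z * (4 * \<mu>\<^sup>2 * (X b z * X c z) - 2 * \<mu> * (c \<bullet> b))"
proof -
  have "pderivative (0, c) (a b) z =
      (- 2 * \<mu>) * (X b z * pderivative (0, c) A z + pderivative (0, c) (X b) z * A z)"
    unfolding a_def by (simp only: pderivative_cmult pderivative_mult diffs differentiable_mult)
  then show ?thesis by (simp add: pderivative_A pderivative_X algebra_simps power2_eq_square)
qed

lemma C1_p: "C1_local UNIV p"
  unfolding p_def by (intro C1_local_mult C1_local_add C1_local_const C1s)

lemma pderivative_p:
  "pderivative (0, b) p z = A z * (8 * \<mu>\<^sup>2 - 8 * \<mu> ^ 3 * s z
     - 2 * \<mu> * (6 * \<mu> - 2 * \<mu> * real DIM('a))) * X b z"
proof -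
  have "pderivative (0, b) p z = A z * (4 * \<mu>\<^sup>2 * pderivative (0, b) s z + 0) +
      pderivative (0, b) A z * (4 * \<mu>\<^sup>2 * s z + (6 * \<mu> - 2 * \<mu> * real DIM('a)))"
    unfolding p_def
    by (simp only: pderivative_cmult pderivative_mult pderivative_add pderivative_const
        differentiable_add differentiable_mult differentiable_const diffs)
  then show ?thesis
    by (simp add: pderivative_A pderivative_s algebra_simps power2_eq_square power3_eq_cube)
      (simp add: X_def algebra_simps)
qed

lemma C1_Q: "C1_local UNIV (Q \<tau>)"
  unfolding Q_def by (intro C1_local_mult C1_local_add C1_local_const C1s)

lemma pderivative_Q: "pderivative e (Q \<tau>) z =
  4 * \<tau>\<^sup>2 * \<mu>\<^sup>2 * (2 - 4 * \<mu> * s z) * (A z)\<^sup>2 * X (snd e) z - 12 * \<tau> * \<mu>\<^sup>2 * A z * X (snd e) z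
  - \<tau> * \<gamma>' (fst z) * fst e"
proof -
  have "pderivative e (Q \<tau>) z = 4 * \<tau>\<^sup>2 * \<mu>\<^sup>2 *
      (s z * (A z * pderivative e A z + pderivative e A z * A z) + pderivative e s z * (A z * A z)) +
      ((- \<tau>) * pderivative e (\<lambda>z. \<gamma> (fst z)) z + 6 * \<tau> * \<mu> * pderivative e A z)"
    unfolding Q_def
    by (simp only: pderivative_cmult pderivative_mult pderivative_add
        differentiable_add differentiable_mult differentiable_const diffs)
  moreover have "(snd z - x0) \<bullet> snd e = X (snd e) z" by (simp add: X_def)
  ultimately show ?thesis
    by (simp add: pderivative_A pderivative_s pderivative_\<gamma> algebra_simps power2_eq_square)
qed

section \<open>Conjugation with the weight and the commutator form\<close>

lemma conjugated_heat_operator: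
  fixes \<tau> :: real
  assumes w: "C2_local UNIV w"
  defines "v \<equiv> \<lambda>z. exp (\<tau> * \<phi> z) * w z"
  shows "C2_local UNIV v"
    and "pderivative (0, b) v z =
      exp (\<tau> * \<phi> z) * (pderivative (0, b) w z + \<tau> * a b z * w z)"
    and "exp (\<tau> * \<phi> z) *
        (pderivative (1, 0) w z - (\<Sum>b\<in>Basis. pderivative (0, b) (pderivative (0, b) w) z)) =
      (- (\<Sum>b\<in>Basis. pderivative (0, b) (pderivative (0, b) v) z) - Q \<tau> z * v z) +
      (pderivative (1, 0) v z + 2 * \<tau> * (\<Sum>b\<in>Basis. a b z * pderivative (0, b) v z) + \<tau> * p z * v z)"
proof -
  define E where "E z = exp (\<tau> * \<phi> z)" for z
  have E2: "C2_local UNIV E"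
    unfolding E_def
    by (rule C2_local_compose[where h = "\<lambda>x. exp (\<tau> * x)" and h' = "\<lambda>x. \<tau> * exp (\<tau> * x)"
          and h'' = "\<lambda>x. \<tau>\<^sup>2 * exp (\<tau> * x)"])
      (auto intro!: C2_\<phi> derivative_eq_intros continuous_intros simp: power2_eq_square)
  have v_eq: "v = (\<lambda>z. E z * w z)" by (simp add: v_def E_def)
  show "C2_local UNIV v" unfolding v_eq by (intro C2_local_mult E2 w) simp
  note c = C2_local_imp_C1[OF E2] C2_local_imp_C1[OF w] C2_local_imp_C1_pderivative[OF w] C1_a
    C2_local_imp_C1[OF C2_\<phi>]
  note d = c[THEN C1_local_differentiable, OF UNIV_I]
  have DE: "pderivative e E z = \<tau> * E z * (a (snd e) z - \<gamma> (fst z) * fst e)" for e z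
  proof -
    have "pderivative e (\<lambda>z. exp (\<tau> * \<phi> z)) z = (\<tau> * exp (\<tau> * \<phi> z)) * pderivative e \<phi> z"
      by (rule pderivative_compose[where h = "\<lambda>x. exp (\<tau> * x)"])
        (auto intro!: derivative_eq_intros d)
    then show ?thesis by (simp add: E_def[abs_def] pderivative_\<phi>)
  qed
  have Db: "pderivative (0, b) v z = E z * (pderivative (0, b) w z + \<tau> * a b z * w z)" for b z
    unfolding v_eq by (simp add: pderivative_mult d DE algebra_simps)
  then show "pderivative (0, b) v z = exp (\<tau> * \<phi> z) * (pderivative (0, b) w z + \<tau> * a b z * w z)"
    by (simp add: E_def)
  have Dt: "pderivative (1, 0) v z = E z * (pderivative (1, 0) w z - \<tau> * \<gamma> (fst z) * w z)"
    unfolding v_eq by (simp add: pderivative_mult d DE algebra_simps a_def X_def)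
  have Dbb: "pderivative (0, b) (pderivative (0, b) v) z =
      E z * (pderivative (0, b) (pderivative (0, b) w) z + 2 * \<tau> * (a b z * pderivative (0, b) w z)
        + \<tau> * w z * pderivative (0, b) (a b) z + \<tau>\<^sup>2 * w z * (a b z * a b z))" for b
  proof -
    have "pderivative (0, b) (pderivative (0, b) v) z =
        pderivative (0, b) (\<lambda>z. E z * (pderivative (0, b) w z + \<tau> * (a b z * w z))) z"
      by (simp add: Db[abs_def] mult.assoc)
    also have "\<dots> = E z * (pderivative (0, b) (pderivative (0, b) w) z +
          \<tau> * (a b z * pderivative (0, b) w z + pderivative (0, b) (a b) z * w z)) +
        pderivative (0, b) E z * (pderivative (0, b) w z + \<tau> * (a b z * w z))"
      by (simp only: pderivative_mult pderivative_add pderivative_const d differentiable_add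
          differentiable_mult differentiable_const mult_zero_left add_0_right)
    finally show ?thesis by (simp add: DE algebra_simps power2_eq_square)
  qed
  define L aw da aa where "L = (\<Sum>b\<in>Basis. pderivative (0, b) (pderivative (0, b) w) z)"
    and "aw = (\<Sum>b\<in>Basis. a b z * pderivative (0, b) w z)"
    and "da = (\<Sum>b\<in>Basis. pderivative (0, b) (a b) z)" and "aa = (\<Sum>b\<in>Basis. a b z * a b z)"
  have s1: "(\<Sum>b\<in>Basis. pderivative (0, b) (pderivative (0, b) v) z) =
      E z * (L + 2 * \<tau> * aw + \<tau> * w z * da + \<tau>\<^sup>2 * w z * aa)"
    unfolding Dbb L_def aw_def da_def aa_def
    by (simp add: sum_distrib_left sum.distrib algebra_simps)
  have "(\<Sum>b\<in>Basis. a b z * pderivative (0, b) v z) =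
      (\<Sum>b\<in>Basis. E z * (a b z * pderivative (0, b) w z) + E z * \<tau> * w z * (a b z * a b z))"
    unfolding Db by (intro sum.cong refl) (simp add: algebra_simps)
  also have "\<dots> = E z * (aw + \<tau> * w z * aa)"
    unfolding aw_def aa_def by (simp add: sum_distrib_left sum.distrib algebra_simps)
  finally have s2: "(\<Sum>b\<in>Basis. a b z * pderivative (0, b) v z) = E z * (aw + \<tau> * w z * aa)" .
  have aa: "aa = 4 * \<mu>\<^sup>2 * (s z * (A z * A z))"
  proof -
    have "aa = (\<Sum>b\<in>Basis. 4 * \<mu>\<^sup>2 * (A z * A z) * (X b z * X b z))"
      unfolding aa_def a_def by (intro sum.cong refl) (simp add: algebra_simps power2_eq_square)
    then show ?thesis by (simp add: sum_X_X flip: sum_distrib_left)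
  qed
  have da: "da = A z * (4 * \<mu>\<^sup>2 * s z - 2 * \<mu> * real DIM('a))"
    unfolding da_def pderivative_a
    by (simp add: sum_X_X sum_subtractf flip: sum_distrib_left)
  \<comment> \<open>Here \<open>aa\<close> is the squared gradient of the weight and
    \<open>da\<close> its Laplacian. The shift \<open>p - da\<close> enters
    \<open>- Q \<tau> z * v z\<close> with a minus sign and \<open>\<tau> * p z * v z\<close> with a
    plus sign, so the sum of both parts contains only \<open>da\<close>.\<close>
  have Qp: "Q \<tau> z = \<tau>\<^sup>2 * aa - \<tau> * \<gamma> (fst z) + \<tau> * (p z - da)"
    unfolding Q_def p_def aa da by (simp add: algebra_simps)
  show "exp (\<tau> * \<phi> z) *
        (pderivative (1, 0) w z - (\<Sum>b\<in>Basis. pderivative (0, b) (pderivative (0, b) w) z)) =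
      (- (\<Sum>b\<in>Basis. pderivative (0, b) (pderivative (0, b) v) z) - Q \<tau> z * v z) +
      (pderivative (1, 0) v z + 2 * \<tau> * (\<Sum>b\<in>Basis. a b z * pderivative (0, b) v z) + \<tau> * p z * v z)"
    unfolding s1 s2 Dt Qp L_def[symmetric] unfolding v_def E_def[symmetric]
    by (simp add: algebra_simps power2_eq_square)
qed

text \<open>The terms of \<open>carleman_identity\<close> outside the divergence, for the present
  \<open>a\<close>, \<open>p\<close> and \<open>Q \<tau>\<close>: the quadratic form whose
  positivity yields the estimate.\<close>

definition remainder :: "real \<Rightarrow> (real \<times> 'a \<Rightarrow> real) \<Rightarrow> real \<times> 'a \<Rightarrow> real" where
  "remainder \<tau> v z =
    2 * \<tau> * (\<Sum>j\<in>Basis. \<Sum>i\<in>Basis. pderivative (0, j) (a i) z * pderivative (0, i) v z * pderivative (0, j) v z) +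
     \<tau> * (p z - (\<Sum>j\<in>Basis. pderivative (0, j) (a j) z)) * (\<Sum>b\<in>Basis. pderivative (0, b) v z * pderivative (0, b) v z) +
     \<tau> * v z * (\<Sum>j\<in>Basis. pderivative (0, j) p z * pderivative (0, j) v z) +
     (1 / 2 * pderivative (1, 0) (Q \<tau>) z + \<tau> * (\<Sum>j\<in>Basis. pderivative (0, j) (Q \<tau>) z * a j z) +
       \<tau> * Q \<tau> z * ((\<Sum>j\<in>Basis. pderivative (0, j) (a j) z) - p z)) * (v z * v z)"

text \<open>The Hessian of the Gaussian is a rank-one matrix in \<open>x - x0\<close> plus a
  multiple of the identity, and the spatial gradients of \<open>p\<close> and
  \<open>Q \<tau>\<close> are radial. The form therefore depends on the gradient of \<open>v\<close>
  only through \<open>Y\<close> and \<open>G\<close>, which reduces positivity to scalars.\<close>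

lemma remainder_eq:
  fixes v z
  defines "Y \<equiv> \<Sum>b\<in>Basis. X b z * pderivative (0, b) v z"
  defines "G \<equiv> \<Sum>b\<in>Basis. pderivative (0, b) v z * pderivative (0, b) v z"
  defines "q \<equiv> 8 * \<mu>\<^sup>2 - 8 * \<mu> ^ 3 * s z - 2 * \<mu> * (6 * \<mu> - 2 * \<mu> * real DIM('a))"
  shows "remainder \<tau> v z =
    2 * \<tau> * (A z * (4 * \<mu>\<^sup>2 * Y\<^sup>2 - 2 * \<mu> * G)) + \<tau> * (6 * \<mu> * A z) * G + \<tau> * v z * (A z * q * Y) +
    (1 / 2 * (- \<tau> * \<gamma>' (fst z)) +
     \<tau> * (- 2 * \<mu> * s z * A z * (4 * \<tau>\<^sup>2 * \<mu>\<^sup>2 * (2 - 4 * \<mu> * s z) * (A z)\<^sup>2 - 12 * \<tau> * \<mu>\<^sup>2 * A z)) +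
     \<tau> * (4 * \<tau>\<^sup>2 * \<mu>\<^sup>2 * (s z * (A z)\<^sup>2) - \<tau> * \<gamma> (fst z) + 6 * \<tau> * \<mu> * A z) * (- 6 * \<mu> * A z)) * (v z * v z)"
proof -
  have "(\<Sum>j\<in>Basis. \<Sum>i\<in>Basis. pderivative (0, j) (a i) z * pderivative (0, i) v z * pderivative (0, j) v z)
      = (\<Sum>j\<in>Basis. 4 * \<mu>\<^sup>2 * A z * Y * (X j z * pderivative (0, j) v z)
          - 2 * \<mu> * A z * (pderivative (0, j) v z * pderivative (0, j) v z))"
  proof (rule sum.cong[OF refl])
    fix j :: 'a assume j: "j \<in> Basis"
    have "(\<Sum>i\<in>Basis. pderivative (0, j) (a i) z * pderivative (0, i) v z * pderivative (0, j) v z) =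
      (\<Sum>i\<in>Basis. 4 * \<mu>\<^sup>2 * A z * (X j z * pderivative (0, j) v z) * (X i z * pderivative (0, i) v z)
         - 2 * \<mu> * A z * pderivative (0, j) v z * ((j \<bullet> i) * pderivative (0, i) v z))"
      unfolding pderivative_a by (intro sum.cong refl) (simp add: algebra_simps)
    also have "\<dots> = 4 * \<mu>\<^sup>2 * A z * (X j z * pderivative (0, j) v z) * Y
        - 2 * \<mu> * A z * pderivative (0, j) v z * (\<Sum>i\<in>Basis. (j \<bullet> i) * pderivative (0, i) v z)"
      by (simp only: sum_subtractf sum_distrib_left[symmetric] Y_def)
    also have "(\<Sum>i\<in>Basis. (j \<bullet> i) * pderivative (0, i) v z) = pderivative (0, j) v z"
      using j by (simp add: inner_Basis if_distrib[of "\<lambda>x. x * _"] cong: if_cong)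
    finally show "(\<Sum>i\<in>Basis. pderivative (0, j) (a i) z * pderivative (0, i) v z * pderivative (0, j) v z) =
        4 * \<mu>\<^sup>2 * A z * Y * (X j z * pderivative (0, j) v z)
          - 2 * \<mu> * A z * (pderivative (0, j) v z * pderivative (0, j) v z)"
      by (simp add: mult_ac)
  qed
  also have "\<dots> = A z * (4 * \<mu>\<^sup>2 * Y\<^sup>2 - 2 * \<mu> * G)"
    by (simp only: sum_subtractf sum_distrib_left[symmetric] Y_def[symmetric] G_def[symmetric])
      (simp add: algebra_simps power2_eq_square)
  finally have 1: "(\<Sum>j\<in>Basis. \<Sum>i\<in>Basis. pderivative (0, j) (a i) z * pderivative (0, i) v z * pderivative (0, j) v z)
      = A z * (4 * \<mu>\<^sup>2 * Y\<^sup>2 - 2 * \<mu> * G)" .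
  have "(\<Sum>j\<in>Basis. pderivative (0, j) (a j) z) = A z * (4 * \<mu>\<^sup>2 * s z - 2 * \<mu> * real DIM('a))"
    unfolding pderivative_a
    by (simp add: sum_X_X sum_subtractf flip: sum_distrib_left)
  then have 2: "(\<Sum>j\<in>Basis. pderivative (0, j) (a j) z) = p z - 6 * \<mu> * A z"
    by (simp add: p_def algebra_simps)
  have 3: "(\<Sum>j\<in>Basis. pderivative (0, j) p z * pderivative (0, j) v z) = A z * q * Y"
    unfolding pderivative_p q_def[symmetric] Y_def by (simp add: sum_distrib_left mult_ac)
  have 4: "pderivative (1, 0) (Q \<tau>) z = - \<tau> * \<gamma>' (fst z)"
    by (simp add: pderivative_Q X_def)
  have "(\<Sum>j\<in>Basis. pderivative (0, j) (Q \<tau>) z * a j z) =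
      (\<Sum>j\<in>Basis. - 2 * \<mu> * A z * (4 * \<tau>\<^sup>2 * \<mu>\<^sup>2 * (2 - 4 * \<mu> * s z) * (A z)\<^sup>2 - 12 * \<tau> * \<mu>\<^sup>2 * A z) * (X j z * X j z))"
    unfolding pderivative_Q a_def by (intro sum.cong refl) (simp add: algebra_simps)
  also have "\<dots> = - 2 * \<mu> * s z * A z * (4 * \<tau>\<^sup>2 * \<mu>\<^sup>2 * (2 - 4 * \<mu> * s z) * (A z)\<^sup>2 - 12 * \<tau> * \<mu>\<^sup>2 * A z)"
    by (simp only: sum_distrib_left[symmetric] sum_X_X) (simp add: mult_ac)
  finally have 5: "(\<Sum>j\<in>Basis. pderivative (0, j) (Q \<tau>) z * a j z) =
      - 2 * \<mu> * s z * A z * (4 * \<tau>\<^sup>2 * \<mu>\<^sup>2 * (2 - 4 * \<mu> * s z) * (A z)\<^sup>2 - 12 * \<tau> * \<mu>\<^sup>2 * A z)" .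
  have 6: "Q \<tau> z = 4 * \<tau>\<^sup>2 * \<mu>\<^sup>2 * (s z * (A z)\<^sup>2) - \<tau> * \<gamma> (fst z) + 6 * \<tau> * \<mu> * A z"
    by (simp add: Q_def power2_eq_square)
  show ?thesis
    unfolding remainder_def 1 2 3 4 5 6 G_def[symmetric] by simp
qed

text \<open>The fluxes contain at most first derivatives of \<open>v\<close>, so for a C2 function
  they are C1 with support in \<open>K\<close> and their divergence integrates to zero. What remains
  is the product of the two parts, at most a quarter of the square of their sum.\<close>

lemma integral_remainder:
  fixes \<tau> :: real
  assumes w: "C2_local UNIV w" and K: "compact K" and supp: "\<And>z. z \<notin> K \<Longrightarrow> w z = 0"
  defines "v \<equiv> \<lambda>z. exp (\<tau> * \<phi> z) * w z"
  shows "integrable lborel (remainder \<tau> v)"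
    and "(\<integral>z. remainder \<tau> v z \<partial>lborel) \<le> 1 / 4 * (\<integral>z. exp (2 * \<tau> * \<phi> z) * (pderivative (1, 0) w z
          - (\<Sum>b\<in>Basis. pderivative (0, b) (pderivative (0, b) w) z))\<^sup>2 \<partial>lborel)"
proof -
  note v = conjugated_heat_operator[OF w, where \<tau> = \<tau>, folded v_def]
  define Ft where "Ft z = 1 / 2 * (\<Sum>b\<in>Basis. pderivative (0, b) v z * pderivative (0, b) v z)
      + (- 1 / 2) * (Q \<tau> z * (v z * v z))" for z
  define F where "F j z = (- 1) * (pderivative (1, 0) v z * pderivative (0, j) v z)
      + ((- 2 * \<tau>) * (pderivative (0, j) v z * (\<Sum>i\<in>Basis. a i z * pderivative (0, i) v z))
      + (\<tau> * (a j z * (\<Sum>i\<in>Basis. pderivative (0, i) v z * pderivative (0, i) v z))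
      + ((- \<tau>) * (p z * (v z * pderivative (0, j) v z)) + (- \<tau>) * (Q \<tau> z * (a j z * (v z * v z))))))" for j z
  define Sv where "Sv z = - (\<Sum>b\<in>Basis. pderivative (0, b) (pderivative (0, b) v) z) - Q \<tau> z * v z" for z
  define Av where "Av z = pderivative (1, 0) v z + 2 * \<tau> * (\<Sum>b\<in>Basis. a b z * pderivative (0, b) v z) + \<tau> * p z * v z" for z
  note id = carleman_identity(1)[where a = a, OF v(1) C1_Q[of \<tau>] C1_p C1_a, where \<tau> = \<tau>, folded Ft_def F_def, folded remainder_def Sv_def Av_def]
    carleman_identity(2)[OF v(1) C1_Q[of \<tau>] C1_p C1_a, folded Ft_def]
    carleman_identity(3)[where a = a, OF v(1) C1_Q[of \<tau>] C1_p C1_a, where \<tau> = \<tau>, folded F_def]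
  have v3: "exp (\<tau> * \<phi> z) * (pderivative (1, 0) w z
      - (\<Sum>b\<in>Basis. pderivative (0, b) (pderivative (0, b) w) z)) = Sv z + Av z" for z
    unfolding Sv_def Av_def v_def by (rule conjugated_heat_operator(3)[OF w])
  have Kc: "closed K" using K by (rule compact_imp_closed)
  have v0: "v z = 0" if "z \<notin> K" for z using supp[OF that] by (simp add: v_def)
  have Dv0: "pderivative e v z = 0" if "z \<notin> K" for e z
    using pderivative_eq_0_outside[OF Kc v0 that] .
  have DDv0: "pderivative h (pderivative e v) z = 0" if "z \<notin> K" for e h z
    by (rule pderivative_eq_0_outside[OF Kc Dv0 that])
  have Ft0: "Ft z = 0" and F0: "F j z = 0" and Sv0: "Sv z = 0" and Av0: "Av z = 0" if "z \<notin> K" for j z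
    using v0[OF that] Dv0[OF that] DDv0[OF that] by (auto simp: Ft_def F_def Sv_def Av_def)
  have cDD: "continuous_on UNIV (pderivative h (pderivative e v))" for e h
    by (intro C1_local_continuous_on_pderivative C2_local_imp_C1_pderivative v(1))
  note cs = cDD C1_local_imp_continuous_on[OF C2_local_imp_C1_pderivative[OF v(1)]]
    C1_local_imp_continuous_on[OF C2_local_imp_C1[OF v(1)]] C1_Q[THEN C1_local_imp_continuous_on]
    C1_p[THEN C1_local_imp_continuous_on] C1_a[THEN C1_local_imp_continuous_on]
  have cS: "continuous_on UNIV Sv" unfolding Sv_def by (intro continuous_intros cs)
  have cA: "continuous_on UNIV Av" unfolding Av_def by (intro continuous_intros cs)
  have i1: "integrable lborel (\<lambda>z. Sv z * Av z)"
    by (rule integrable_compact_support[OF _ K]) (auto intro!: continuous_intros cS cA simp: Sv0)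
  have i2: "integrable lborel (\<lambda>z. (Sv z + Av z)\<^sup>2)"
    by (rule integrable_compact_support[OF _ K]) (auto intro!: continuous_intros cS cA simp: Sv0 Av0)
  have it: "integrable lborel (pderivative (1, 0) Ft)"
    using pderivative_eq_0_outside[OF Kc Ft0]
    by (intro integrable_compact_support[OF _ K] C1_local_continuous_on_pderivative id(2))
  have ij: "integrable lborel (pderivative (0, j) (F j))" for j
    using pderivative_eq_0_outside[OF Kc F0[where j = j]]
    by (intro integrable_compact_support[OF _ K] C1_local_continuous_on_pderivative id(3))
  have R: "remainder \<tau> v = (\<lambda>z. Sv z * Av z - pderivative (1, 0) Ft z - (\<Sum>j\<in>Basis. pderivative (0, j) (F j) z))"
  proof
    fix z show "remainder \<tau> v z = Sv z * Av z - pderivative (1, 0) Ft z - (\<Sum>j\<in>Basis. pderivative (0, j) (F j) z)"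
      using id(1)[of z] by linarith
  qed
  show "integrable lborel (remainder \<tau> v)"
    unfolding R by (intro Bochner_Integration.integrable_diff Bochner_Integration.integrable_sum i1 it ij)
  have "(\<integral>z. remainder \<tau> v z \<partial>lborel) = (\<integral>z. Sv z * Av z \<partial>lborel)
      - (\<integral>z. pderivative (1, 0) Ft z \<partial>lborel) - (\<Sum>j\<in>Basis. \<integral>z. pderivative (0, j) (F j) z \<partial>lborel)"
    unfolding R using i1 it ij by (simp add: Bochner_Integration.integral_sum)
  also have "\<dots> = (\<integral>z. Sv z * Av z \<partial>lborel)"
    using integral_pderivative_eq_0[OF id(2) K Ft0] integral_pderivative_eq_0[OF id(3) K F0] by simp
  also have "\<dots> \<le> (\<integral>z. 1 / 4 * (Sv z + Av z)\<^sup>2 \<partial>lborel)"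
  proof (intro integral_mono i1 integrable_mult_right i2)
    fix z show "Sv z * Av z \<le> 1 / 4 * (Sv z + Av z)\<^sup>2"
      using zero_le_power2[of "Sv z - Av z"] by (simp add: power2_eq_square algebra_simps)
  qed
  also have "\<dots> = 1 / 4 * (\<integral>z. (Sv z + Av z)\<^sup>2 \<partial>lborel)" by simp
  also have "(\<lambda>z. (Sv z + Av z)\<^sup>2) = (\<lambda>z. exp (2 * \<tau> * \<phi> z) * (pderivative (1, 0) w z
          - (\<Sum>b\<in>Basis. pderivative (0, b) (pderivative (0, b) w) z))\<^sup>2)"
  proof
    fix z
    have "(exp (\<tau> * \<phi> z))\<^sup>2 = exp (2 * \<tau> * \<phi> z)"
      by (simp add: power2_eq_square mult.assoc flip: exp_add)
    then show "(Sv z + Av z)\<^sup>2 = exp (2 * \<tau> * \<phi> z) * (pderivative (1, 0) w z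
          - (\<Sum>b\<in>Basis. pderivative (0, b) (pderivative (0, b) w) z))\<^sup>2"
      unfolding v3[symmetric] power_mult_distrib by simp
  qed
  finally show "(\<integral>z. remainder \<tau> v z \<partial>lborel) \<le> 1 / 4 * (\<integral>z. exp (2 * \<tau> * \<phi> z) * (pderivative (1, 0) w z
          - (\<Sum>b\<in>Basis. pderivative (0, b) (pderivative (0, b) w) z))\<^sup>2 \<partial>lborel)" .
qed

text \<open>On the compact set \<open>K\<close> all coefficients have uniform bounds, so the
  constants do not depend on \<open>\<tau>\<close> or \<open>w\<close>. Returning from
  \<open>v\<close> to \<open>w\<close> costs a multiple of
  \<open>\<tau>\<^sup>2 * v\<^sup>2\<close>, since differentiating the exponential brings down a
  factor \<open>\<tau>\<close>; the cubic gain covers it.\<close>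

theorem carleman_estimate:
  assumes K: "compact K" and Ks: "\<And>z. z \<in> K \<Longrightarrow> 2 \<le> \<mu> * s z"
  obtains c \<tau>0 where "0 < c" "1 \<le> \<tau>0"
    "\<And>\<tau> w. \<tau>0 \<le> \<tau> \<Longrightarrow> C2_local UNIV w \<Longrightarrow> (\<And>z. z \<notin> K \<Longrightarrow> w z = 0) \<Longrightarrow>
      c * (\<integral>z. exp (2 * \<tau> * \<phi> z) * ((w z)\<^sup>2 + (\<Sum>b\<in>Basis. (pderivative (0, b) w z)\<^sup>2)) \<partial>lborel) \<le>
      (\<integral>z. exp (2 * \<tau> * \<phi> z) * (pderivative (1, 0) w z
          - (\<Sum>b\<in>Basis. pderivative (0, b) (pderivative (0, b) w) z))\<^sup>2 \<partial>lborel)"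
proof -
  have cs: "continuous_on S s" and cA: "continuous_on S A" for S
    using C1_local_imp_continuous_on[OF C1s(2)] C1_local_imp_continuous_on[OF C1s(3)]
    by (auto intro: continuous_on_subset)
  have c\<gamma>: "continuous_on S (\<lambda>z::real \<times> 'a. \<gamma> (fst z))" for S
    using continuous_\<gamma> by (auto intro!: continuous_on_compose2[OF continuous_\<gamma>] continuous_intros)
  have c\<gamma>': "continuous_on S (\<lambda>z::real \<times> 'a. \<gamma>' (fst z))" for S
    by (auto intro!: continuous_on_compose2[OF \<gamma>'] continuous_intros)
  define q where "q z = 8 * \<mu>\<^sup>2 - 8 * \<mu> ^ 3 * s z - 2 * \<mu> * (6 * \<mu> - 2 * \<mu> * real DIM('a))" for z
  obtain N0 where N0: "\<And>z. z \<in> K \<Longrightarrow> \<bar>s z\<bar> \<le> N0"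
    using continuous_bounded_on_compact[OF K cs] by blast
  define A0 where "A0 = exp (- \<mu> * N0)"
  have A0: "0 < A0" by (simp add: A0_def)
  have AA0: "A0 \<le> A z" if "z \<in> K" for z
    using N0[OF that] \<mu>_pos by (simp add: A0_def A_def)
  obtain M where M: "\<And>z. z \<in> K \<Longrightarrow> \<bar>A z * (q z)\<^sup>2 / (32 * \<mu>\<^sup>2) + \<bar>\<gamma>' (fst z)\<bar> / 2
      + 6 * \<bar>\<gamma> (fst z)\<bar> * \<mu> * A z + 36 * \<mu>\<^sup>2 * (A z)\<^sup>2\<bar> \<le> M"
  proof (rule continuous_bounded_on_compact[OF K])
    show "continuous_on K (\<lambda>z. A z * (q z)\<^sup>2 / (32 * \<mu>\<^sup>2) + \<bar>\<gamma>' (fst z)\<bar> / 2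
      + 6 * \<bar>\<gamma> (fst z)\<bar> * \<mu> * A z + 36 * \<mu>\<^sup>2 * (A z)\<^sup>2)"
      unfolding q_def using \<mu>_pos by (intro continuous_intros cs cA c\<gamma> c\<gamma>') auto
  qed blast
  \<comment> \<open>The bounded function is the squared spatial gradient of the weight, the factor
    in the loss when passing back from \<open>v\<close> to \<open>w\<close>.\<close>
  obtain N where N: "0 \<le> N" "\<And>z. z \<in> K \<Longrightarrow> \<bar>4 * \<mu>\<^sup>2 * (s z * (A z)\<^sup>2)\<bar> \<le> N"
  proof (rule continuous_bounded_on_compact[OF K])
    show "continuous_on K (\<lambda>z. 4 * \<mu>\<^sup>2 * (s z * (A z)\<^sup>2))" by (intro continuous_intros cs cA)
  qed blast
  define \<tau>0 where "\<tau>0 = max 1 (M / (24 * \<mu>\<^sup>2 * A0 ^ 3))"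
  \<comment> \<open>The gains are \<open>2 * \<tau> * \<mu> * A0 * G\<close> and the cubic term, the
    demands are \<open>2 * G\<close> and \<open>(1 + 2 * N) * \<tau>\<^sup>2 * v\<^sup>2\<close>;
    the minimum meets both because \<open>\<tau> \<ge> 1\<close>.\<close>
  define c where "c = min (\<mu> * A0) (24 * \<mu>\<^sup>2 * A0 ^ 3 / (1 + 2 * N))"
  have c: "0 < c" using \<mu>_pos A0 N(1) by (simp add: c_def)
  have est: "c * (exp (2 * \<tau> * \<phi> z) * ((w z)\<^sup>2 + (\<Sum>b\<in>Basis. (pderivative (0, b) w z)\<^sup>2)))
      \<le> remainder \<tau> (\<lambda>z. exp (\<tau> * \<phi> z) * w z) z"
    if \<tau>: "\<tau>0 \<le> \<tau>" and w: "C2_local UNIV w" and supp: "\<And>z. z \<notin> K \<Longrightarrow> w z = 0" for \<tau> w z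
  proof (cases "z \<in> K")
    case False
    have Dw: "pderivative e w z = 0" for e
      using pderivative_eq_0_outside[OF compact_imp_closed[OF K] supp False] .
    have Dv: "pderivative (0, b) (\<lambda>z. exp (\<tau> * \<phi> z) * w z) z = 0" for b
      using conjugated_heat_operator(2)[OF w] supp[OF False] Dw by simp
    show ?thesis using supp[OF False] by (simp add: remainder_def Dw Dv)
  next
    case True
    define v where "v z = exp (\<tau> * \<phi> z) * w z" for z
    define E where "E = exp (\<tau> * \<phi> z)"
    define G where "G = (\<Sum>b\<in>Basis. pderivative (0, b) v z * pderivative (0, b) v z)"
    have G0: "0 \<le> G" unfolding G_def by (intro sum_nonneg) simp
    have \<tau>1: "1 \<le> \<tau>" using \<tau> by (simp add: \<tau>0_def)
    have d: "0 < 24 * \<mu>\<^sup>2 * A0 ^ 3" using \<mu>_pos A0 by simp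
    have "M / (24 * \<mu>\<^sup>2 * A0 ^ 3) \<le> \<tau>" using \<tau> by (simp add: \<tau>0_def)
    then have \<tau>M: "M \<le> 24 * \<mu>\<^sup>2 * A0 ^ 3 * \<tau>"
      unfolding pos_divide_le_eq[OF d] by (simp only: mult.commute)
    have low: "2 * \<tau> * \<mu> * A0 * G + 24 * \<mu>\<^sup>2 * A0 ^ 3 * \<tau> ^ 3 * (v z * v z) \<le> remainder \<tau> v z"
      unfolding remainder_eq G_def
      by (rule carleman_coefficient_bound[OF \<mu>_pos \<tau>1 A0 AA0[OF True] Ks[OF True] G0[unfolded G_def]
            order_trans[OF abs_ge_self M[OF True, unfolded q_def]] \<tau>M])
    have E2: "exp (2 * \<tau> * \<phi> z) = E * E"
      by (simp add: E_def mult.assoc flip: exp_add)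
    have vw: "v z * v z = E * E * (w z)\<^sup>2" by (simp add: v_def E_def power2_eq_square mult_ac)
    have "E * E * (\<Sum>b\<in>Basis. (pderivative (0, b) w z)\<^sup>2) = (\<Sum>b\<in>Basis. (E * pderivative (0, b) w z)\<^sup>2)"
      by (simp add: sum_distrib_left power_mult_distrib power2_eq_square mult_ac)
    also have "\<dots> \<le> (\<Sum>b\<in>Basis. 2 * (pderivative (0, b) v z * pderivative (0, b) v z)
        + 2 * \<tau>\<^sup>2 * (v z * v z) * (a b z * a b z))"
    proof (rule sum_mono)
      fix b :: 'a
      have "pderivative (0, b) v z = E * (pderivative (0, b) w z + \<tau> * a b z * w z)"
        unfolding v_def[abs_def] E_def by (rule conjugated_heat_operator(2)[OF w])
      then have e: "E * pderivative (0, b) w z = pderivative (0, b) v z - \<tau> * a b z * v z"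
        by (simp add: v_def E_def algebra_simps)
      have "(x - y)\<^sup>2 \<le> 2 * (x * x) + 2 * (y * y)" for x y :: real
        using zero_le_power2[of "x + y"] by (simp add: power2_eq_square algebra_simps)
      from this[of "pderivative (0, b) v z" "\<tau> * a b z * v z"]
      show "(E * pderivative (0, b) w z)\<^sup>2 \<le> 2 * (pderivative (0, b) v z * pderivative (0, b) v z)
        + 2 * \<tau>\<^sup>2 * (v z * v z) * (a b z * a b z)"
        unfolding e by (simp add: power2_eq_square mult_ac)
    qed
    also have "\<dots> = 2 * G + 2 * \<tau>\<^sup>2 * (v z * v z) * (\<Sum>b\<in>Basis. a b z * a b z)"
      by (simp add: G_def sum.distrib sum_distrib_left)
    also have "(\<Sum>b\<in>Basis. a b z * a b z) = (\<Sum>b\<in>Basis. 4 * \<mu>\<^sup>2 * (A z)\<^sup>2 * (X b z * X b z))"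
      unfolding a_def by (intro sum.cong refl) (simp add: power2_eq_square mult_ac)
    also have "\<dots> = 4 * \<mu>\<^sup>2 * (s z * (A z)\<^sup>2)"
      by (simp only: sum_distrib_left[symmetric] sum_X_X) (simp add: mult_ac)
    also have "2 * \<tau>\<^sup>2 * (v z * v z) * \<dots> \<le> 2 * \<tau>\<^sup>2 * (v z * v z) * N"
      using N(2)[OF True] by (intro mult_left_mono) auto
    finally have "E * E * (\<Sum>b\<in>Basis. (pderivative (0, b) w z)\<^sup>2) \<le> 2 * G + 2 * \<tau>\<^sup>2 * (v z * v z) * N"
      by simp
    moreover have "v z * v z \<le> \<tau>\<^sup>2 * (v z * v z)"
      using \<tau>1 mult_right_mono[of 1 "\<tau>\<^sup>2" "v z * v z"] by simp
    ultimately have up: "exp (2 * \<tau> * \<phi> z) * ((w z)\<^sup>2 + (\<Sum>b\<in>Basis. (pderivative (0, b) w z)\<^sup>2))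
        \<le> 2 * G + (1 + 2 * N) * (\<tau>\<^sup>2 * (v z * v z))"
      unfolding E2 distrib_left vw[symmetric] by (simp add: algebra_simps)
    have c1: "c \<le> \<tau> * (\<mu> * A0)"
    proof -
      have "c \<le> 1 * (\<mu> * A0)" by (simp add: c_def)
      also have "\<dots> \<le> \<tau> * (\<mu> * A0)" using \<tau>1 \<mu>_pos A0 by (intro mult_right_mono) auto
      finally show ?thesis .
    qed
    have "c \<le> 24 * \<mu>\<^sup>2 * A0 ^ 3 / (1 + 2 * N)" by (simp add: c_def)
    then have "c * (1 + 2 * N) \<le> 24 * \<mu>\<^sup>2 * A0 ^ 3" using N(1) by (simp add: pos_le_divide_eq)
    also have "\<dots> \<le> 24 * \<mu>\<^sup>2 * A0 ^ 3 * \<tau>"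
      using mult_left_mono[OF \<tau>1 less_imp_le[OF d]] by (simp only: mult_1_right)
    finally have c2: "c * (1 + 2 * N) * (\<tau>\<^sup>2 * (v z * v z)) \<le> 24 * \<mu>\<^sup>2 * A0 ^ 3 * \<tau> * (\<tau>\<^sup>2 * (v z * v z))"
      by (rule mult_right_mono) simp
    have "c * (exp (2 * \<tau> * \<phi> z) * ((w z)\<^sup>2 + (\<Sum>b\<in>Basis. (pderivative (0, b) w z)\<^sup>2)))
        \<le> c * (2 * G + (1 + 2 * N) * (\<tau>\<^sup>2 * (v z * v z)))"
      using up c by (intro mult_left_mono) auto
    also have "\<dots> = c * (2 * G) + c * (1 + 2 * N) * (\<tau>\<^sup>2 * (v z * v z))"
      by (simp add: algebra_simps)
    also have "\<dots> \<le> \<tau> * (\<mu> * A0) * (2 * G) + 24 * \<mu>\<^sup>2 * A0 ^ 3 * \<tau> * (\<tau>\<^sup>2 * (v z * v z))"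
      using c1 G0 by (intro add_mono mult_right_mono c2) auto
    also have "\<dots> = 2 * \<tau> * \<mu> * A0 * G + 24 * \<mu>\<^sup>2 * A0 ^ 3 * \<tau> ^ 3 * (v z * v z)"
      by (simp add: power2_eq_square power3_eq_cube)
    also note low
    finally show ?thesis by (simp add: v_def[abs_def])
  qed
  show ?thesis
  proof (rule that[of c \<tau>0])
    fix \<tau> w
    assume \<tau>: "\<tau>0 \<le> \<tau>" and w: "C2_local UNIV w" and supp: "\<And>z. z \<notin> K \<Longrightarrow> w z = 0"
    note ir = integral_remainder[OF w K supp, of \<tau>]
    let ?f = "\<lambda>z. exp (2 * \<tau> * \<phi> z) * ((w z)\<^sup>2 + (\<Sum>b\<in>Basis. (pderivative (0, b) w z)\<^sup>2))"
    let ?I = "\<integral>z. exp (2 * \<tau> * \<phi> z) * (pderivative (1, 0) w z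
          - (\<Sum>b\<in>Basis. pderivative (0, b) (pderivative (0, b) w) z))\<^sup>2 \<partial>lborel"
    have if1: "integrable lborel ?f"
    proof (rule integrable_compact_support[OF _ K])
      show "continuous_on UNIV ?f"
        by (intro continuous_intros C1_local_imp_continuous_on[OF C2_local_imp_C1[OF C2_\<phi>]]
            C1_local_imp_continuous_on[OF C2_local_imp_C1[OF w]]
            C1_local_continuous_on_pderivative C2_local_imp_C1[OF w])
      show "?f z = 0" if "z \<notin> K" for z
        using supp[OF that] pderivative_eq_0_outside[OF compact_imp_closed[OF K] supp that] by simp
    qed
    have "c * (\<integral>z. ?f z \<partial>lborel) = (\<integral>z. c * ?f z \<partial>lborel)" by simp
    also have "\<dots> \<le> (\<integral>z. remainder \<tau> (\<lambda>z. exp (\<tau> * \<phi> z) * w z) z \<partial>lborel)"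
      by (intro integral_mono integrable_mult_right if1 ir(1) est[OF \<tau> w supp])
    also have "\<dots> \<le> 1 / 4 * ?I" by (rule ir(2))
    also have "\<dots> \<le> ?I"
      using Bochner_Integration.integral_nonneg[of lborel "\<lambda>z. exp (2 * \<tau> * \<phi> z) * (pderivative (1, 0) w z
          - (\<Sum>b\<in>Basis. pderivative (0, b) (pderivative (0, b) w) z))\<^sup>2"] by simp
    finally show "c * (\<integral>z. ?f z \<partial>lborel) \<le> ?I" .
  qed (use c in \<open>auto simp: \<tau>0_def\<close>)
qed

end

section \<open>Cutoff functions\<close>

text \<open>Away from 0 the function is locally zero or a power. At 0 the difference quotient is
  again a positive power of \<open>max 0 h\<close>, which is why the exponent starts at 2.\<close>

lemma DERIV_max_0_power:
  "((\<lambda>x::real. max 0 x ^ Suc (Suc n)) has_field_derivative real (Suc (Suc n)) * max 0 x ^ Suc n) (at x)"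
proof -
  consider "x < 0" | "x = 0" | "x > 0" by linarith
  then show ?thesis
  proof cases
    case 1
    have "((\<lambda>x::real. 0) has_field_derivative real (Suc (Suc n)) * max 0 x ^ Suc n) (at x)"
      using 1 by simp
    then show ?thesis
      by (rule DERIV_cong_ev[THEN iffD1, rotated -1])
        (use 1 eventually_nhds_in_open[of "{..<0}" x] in \<open>auto elim!: eventually_mono\<close>)
  next
    case 2
    have "((\<lambda>h::real. max 0 h ^ Suc n) \<longlongrightarrow> max 0 0 ^ Suc n) (at 0)"
      by (intro tendsto_intros)
    then have "((\<lambda>h::real. max 0 h ^ Suc (Suc n) / h) \<longlongrightarrow> 0) (at 0)"
    proof (rule Lim_transform_eventually[THEN tendsto_eq_rhs])
      have "max 0 h ^ Suc n = max 0 h ^ Suc (Suc n) / h" if "h \<noteq> 0" for h :: real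
        using that by (cases "h < 0") auto
      then show "\<forall>\<^sub>F h::real in at 0. max 0 h ^ Suc n = max 0 h ^ Suc (Suc n) / h"
        unfolding eventually_at_filter by (intro always_eventually) auto
    qed simp
    then show ?thesis using 2 by (simp add: DERIV_def)
  next
    case 3
    have "((\<lambda>x::real. x ^ Suc (Suc n)) has_field_derivative real (Suc (Suc n)) * max 0 x ^ Suc n) (at x)"
      using DERIV_pow[of "Suc (Suc n)" x UNIV] 3 by (simp del: power_Suc)
    then show ?thesis
      by (rule DERIV_cong_ev[THEN iffD1, rotated -1])
        (use 3 eventually_nhds_in_open[of "{0<..}" x] in \<open>auto elim!: eventually_mono\<close>)
  qed
qed

lemma DERIV_max_0_power_2: "((\<lambda>x::real. max 0 x ^ 2) has_field_derivative 2 * max 0 x) (at x)"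
  and DERIV_max_0_power_3: "((\<lambda>x::real. max 0 x ^ 3) has_field_derivative 3 * max 0 x ^ 2) (at x)"
  using DERIV_max_0_power[of 0 x] DERIV_max_0_power[of 1 x]
  by (simp_all add: numeral_2_eq_2 numeral_3_eq_3)

text \<open>The inner truncation flattens the step at 0 and the outer one at 1. The cube is the
  lowest integer power of \<open>max 0 x\<close> with a continuous second derivative.\<close>

definition smooth_step :: "real \<Rightarrow> real" where
  "smooth_step x = 1 + (- 1) * max 0 (1 + (- 1) * max 0 x ^ 3) ^ 3"

lemma smooth_step_eq_0: "x \<le> 0 \<Longrightarrow> smooth_step x = 0"
  by (simp add: smooth_step_def)

lemma smooth_step_eq_1: "1 \<le> x \<Longrightarrow> smooth_step x = 1"
  using one_le_power[of x 3] by (simp add: smooth_step_def)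

lemma smooth_step_bounds: "0 \<le> smooth_step x" "smooth_step x \<le> 1"
proof -
  have "max 0 (1 + (- 1) * max 0 x ^ 3) ^ 3 \<le> (1::real)" by (intro power_le_one) auto
  then show "0 \<le> smooth_step x" by (simp add: smooth_step_def)
qed (simp add: smooth_step_def)

lemma C2_max_0_power_3:
  "open S \<Longrightarrow> C2_local S f \<Longrightarrow> C2_local S (\<lambda>z. max 0 (f z) ^ 3)"
  by (rule C2_local_compose[where h = "\<lambda>x. max 0 x ^ 3" and h' = "\<lambda>x. 3 * max 0 x ^ 2"
        and h'' = "\<lambda>x. 3 * (2 * max 0 x)"],
      assumption, assumption, rule DERIV_max_0_power_3, rule DERIV_cmult[OF DERIV_max_0_power_2])
    (intro continuous_intros)

lemma C2_smooth_step: "open S \<Longrightarrow> C2_local S f \<Longrightarrow> C2_local S (\<lambda>z. smooth_step (f z))"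
  unfolding smooth_step_def
  by (intro C2_local_add C2_local_mult C2_local_const C2_max_0_power_3)

section \<open>The estimate with an exponential parameter\<close>

definition energy_density :: "(real \<times> 'a::euclidean_space \<Rightarrow> real) \<Rightarrow> real \<times> 'a \<Rightarrow> real" where
  "energy_density u z = (u z)\<^sup>2 + (\<Sum>b\<in>Basis. (pderivative (0, b) u z)\<^sup>2)"

text \<open>The heat operator with derivatives taken in directions of the product space instead of
  on slices, so that the rules above apply; \<open>heat_op_eq\<close> identifies it with
  \<open>heat_op\<close>.\<close>

definition heat :: "(real \<times> 'a::euclidean_space \<Rightarrow> real) \<Rightarrow> real \<times> 'a \<Rightarrow> real" where
  "heat u z = pderivative (1, 0) u z - (\<Sum>b\<in>Basis. pderivative (0, b) (pderivative (0, b) u) z)"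

lemma energy_density_nonneg: "0 \<le> energy_density u z"
  by (auto simp: energy_density_def intro!: add_nonneg_nonneg sum_nonneg)

lemma spatial_sqdist_less: "0 < r \<Longrightarrow> spatial_sqdist x0 z < r\<^sup>2 \<longleftrightarrow> dist (snd z) x0 < r"
  unfolding spatial_sqdist_def dist_norm power2_norm_eq_inner[symmetric]
  using abs_le_square_iff[of r "norm (snd z - x0)"] by (simp add: linorder_not_le[symmetric])

lemma spatial_sqdist_le: "0 < r \<Longrightarrow> spatial_sqdist x0 z \<le> r\<^sup>2 \<longleftrightarrow> dist (snd z) x0 \<le> r"
  unfolding spatial_sqdist_def dist_norm power2_norm_eq_inner[symmetric]
  using abs_le_square_iff[of "norm (snd z - x0)" r] by simp

lemma continuous_on_energy_density: "C2_local S u \<Longrightarrow> continuous_on S (energy_density u)"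
  unfolding energy_density_def
  by (intro continuous_intros C1_local_imp_continuous_on C1_local_continuous_on_pderivative C2_local_imp_C1)

lemma continuous_on_heat: "C2_local S u \<Longrightarrow> continuous_on S (heat u)"
  unfolding heat_def
  by (intro continuous_intros C1_local_continuous_on_pderivative C2_local_imp_C1 C2_local_imp_C1_pderivative)

lemma heat_mult:
  assumes f: "C2_local UNIV f" and g: "C2_local UNIV g"
  shows "heat (\<lambda>z. f z * g z) z = f z * heat g z + g z * heat f z
    - 2 * (\<Sum>b\<in>Basis. pderivative (0, b) f z * pderivative (0, b) g z)"
proof -
  note c = C2_local_imp_C1[OF f] C2_local_imp_C1[OF g]
    C2_local_imp_C1_pderivative[OF f] C2_local_imp_C1_pderivative[OF g]
  note d = c[THEN C1_local_differentiable, OF UNIV_I]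
  have D: "pderivative e (\<lambda>z. f z * g z) = (\<lambda>z. f z * pderivative e g z + pderivative e f z * g z)" for e
    by (simp add: fun_eq_iff pderivative_mult d del: split_paired_All)
  have "pderivative (0, b) (pderivative (0, b) (\<lambda>z. f z * g z)) z =
      f z * pderivative (0, b) (pderivative (0, b) g) z
      + 2 * (pderivative (0, b) f z * pderivative (0, b) g z)
      + g z * pderivative (0, b) (pderivative (0, b) f) z" for b
    unfolding D by (simp add: pderivative_add pderivative_mult differentiable_mult d)
  then show ?thesis
    by (simp add: heat_def D sum.distrib sum_distrib_left algebra_simps)
qed

lemma integrable_cylinder:
  fixes f :: "real \<times> 'a::euclidean_space \<Rightarrow> real"
  assumes "continuous_on UNIV f"
  shows "integrable lborel (\<lambda>z. indicator ({a<..<b} \<times> ball x r) z * f z)"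
proof -
  have "compact ({a..b} \<times> cball x r)" by (intro compact_Times) auto
  then have "set_integrable lborel ({a..b} \<times> cball x r) f"
    unfolding set_integrable_def
    using assms by (intro borel_integrable_compact) (auto intro: continuous_on_subset)
  then have "set_integrable lborel ({a<..<b} \<times> ball x r) f"
    by (rule set_integrable_subset) (auto intro!: borel_open open_Times)
  then show ?thesis by (simp add: set_integrable_def)
qed

definition cylinder_integral ::
    "real \<Rightarrow> real \<Rightarrow> 'a::euclidean_space \<Rightarrow> real \<Rightarrow> (real \<times> 'a \<Rightarrow> real) \<Rightarrow> real" where
  "cylinder_integral a b x r f = (\<integral>z. indicator ({a<..<b} \<times> ball x r) z * f z \<partial>lborel)"

section \<open>Weight in time and cutoff in space and time\<close>

lemma time_weight_exists:
  fixes m l :: real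
  assumes "0 \<le> m" "m < l"
  obtains g \<gamma> \<gamma>' :: "real \<Rightarrow> real"
  where "\<And>t. (g has_field_derivative \<gamma> t) (at t)" "\<And>t. (\<gamma> has_field_derivative \<gamma>' t) (at t)"
    "continuous_on UNIV \<gamma>'" "\<And>t. 0 \<le> g t" "\<And>t. \<bar>t - c\<bar> \<le> m \<Longrightarrow> g t = 0" "\<And>t. l \<le> \<bar>t - c\<bar> \<Longrightarrow> 1 \<le> g t"
proof -
  define D where "D = l\<^sup>2 - m\<^sup>2"
  have D: "0 < D" using assms by (simp add: D_def power_strict_mono)
  \<comment> \<open>A quadratic polynomial that is at most 0 for
    \<open>\<bar>t - c\<bar> \<le> m\<close> and at least 1 for
    \<open>\<bar>t - c\<bar> \<ge> l\<close>; the cube of its positive part is C2 with the required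
    values. Its growth for large times is harmless, since only a lower bound is asked of
    \<open>g\<close> there.\<close>
  define y where "y t = ((t - c)\<^sup>2 - m\<^sup>2) / D" for t
  have dy: "(y has_field_derivative 2 * (t - c) / D) (at t)" for t
    unfolding y_def using D by (auto intro!: derivative_eq_intros)
  have d1: "((\<lambda>t. max 0 (y t) ^ 3) has_field_derivative 3 * max 0 (y t) ^ 2 * (2 * (t - c) / D)) (at t)" for t
    by (rule DERIV_chain2[OF DERIV_max_0_power_3 dy])
  have d2: "((\<lambda>t. max 0 (y t) ^ 2) has_field_derivative 2 * max 0 (y t) * (2 * (t - c) / D)) (at t)" for t
    by (rule DERIV_chain2[OF DERIV_max_0_power_2 dy])
  have d3: "((\<lambda>t. 3 * max 0 (y t) ^ 2 * (2 * (t - c) / D)) has_field_derivative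
      3 * (2 * max 0 (y t) * (2 * (t - c) / D)) * (2 * (t - c) / D) + 2 / D * (3 * max 0 (y t) ^ 2)) (at t)" for t
    by (rule DERIV_mult[OF DERIV_cmult[OF d2]]) (use D in \<open>auto intro!: derivative_eq_intros\<close>)
  have cy: "continuous_on UNIV y" using dy by (meson DERIV_continuous_on has_field_derivative_at_within)
  show ?thesis
  proof (rule that[OF d1 d3])
    show "continuous_on UNIV (\<lambda>t. 3 * (2 * max 0 (y t) * (2 * (t - c) / D)) * (2 * (t - c) / D) + 2 / D * (3 * max 0 (y t) ^ 2))"
      using D by (intro continuous_intros cy) auto
    show "0 \<le> max 0 (y t) ^ 3" for t by simp
    show "max 0 (y t) ^ 3 = 0" if "\<bar>t - c\<bar> \<le> m" for t
    proof -
      have "(t - c)\<^sup>2 \<le> m\<^sup>2" using that assms by (simp add: abs_le_square_iff[symmetric])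
      then have "y t \<le> 0" using D by (simp add: y_def divide_le_0_iff)
      then show ?thesis by simp
    qed
    show "1 \<le> max 0 (y t) ^ 3" if "l \<le> \<bar>t - c\<bar>" for t
    proof -
      have "l\<^sup>2 \<le> (t - c)\<^sup>2" using that assms by (simp add: abs_le_square_iff[symmetric])
      then have "1 \<le> y t" using D by (simp add: y_def D_def)
      then show ?thesis by (intro one_le_power) simp
    qed
  qed
qed

lemma space_time_cutoff_exists:
  fixes x0 :: "'a::euclidean_space" and c :: real
  assumes "0 < r" "r < r'" "r' < r3" "r3 < r4" "0 < l" "l < l'"
  obtains \<eta> :: "real \<times> 'a \<Rightarrow> real" where "C2_local UNIV \<eta>" "\<And>z. 0 \<le> \<eta> z" "\<And>z. \<eta> z \<le> 1"
    "\<And>z. \<bar>fst z - c\<bar> < l \<Longrightarrow> r' < dist (snd z) x0 \<Longrightarrow> dist (snd z) x0 < r3 \<Longrightarrow> \<eta> z = 1"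
    "\<And>z. \<not> (\<bar>fst z - c\<bar> \<le> l' \<and> r \<le> dist (snd z) x0 \<and> dist (snd z) x0 \<le> r4) \<Longrightarrow> \<eta> z = 0"
proof -
  let ?s = "spatial_sqdist x0"
  \<comment> \<open>Squares of time and distance are smooth, unlike the absolute values. Each
    function is at least 1 on one side of its transition layer and at most 0 on the other;
    \<open>f2\<close> increases with the distance and cuts out the ball around
    \<open>x0\<close>.\<close>
  define f1 f2 f3 :: "real \<times> 'a \<Rightarrow> real" where
    "f1 z = 1 / (l'\<^sup>2 - l\<^sup>2) * (l'\<^sup>2 + (- 1) * ((fst z + - c) * (fst z + - c)))" and
    "f2 z = 1 / (r'\<^sup>2 - r\<^sup>2) * (?s z + - r\<^sup>2)" and
    "f3 z = 1 / (r4\<^sup>2 - r3\<^sup>2) * (r4\<^sup>2 + (- 1) * ?s z)" for z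
  have c: "C2_local UNIV f1" "C2_local UNIV f2" "C2_local UNIV f3"
    unfolding f1_def f2_def f3_def
    by (intro C2_local_add C2_local_mult C2_local_const C2_spatial_sqdist
        C2_local_linear[OF bounded_linear_fst] open_UNIV)+
  define \<eta> where "\<eta> z = smooth_step (f1 z) * (smooth_step (f2 z) * smooth_step (f3 z))" for z
  have pos: "0 < l'\<^sup>2 - l\<^sup>2" "0 < r'\<^sup>2 - r\<^sup>2" "0 < r4\<^sup>2 - r3\<^sup>2"
    using assms by (auto intro!: power_strict_mono)
  have rs: "0 < r" "0 < r'" "0 < r3" "0 < r4" using assms by auto
  show ?thesis
  proof (rule that[of \<eta>])
    show "C2_local UNIV \<eta>" unfolding \<eta>_def
      by (intro C2_local_mult C2_smooth_step c open_UNIV)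
    show "0 \<le> \<eta> z" "\<eta> z \<le> 1" for z
      unfolding \<eta>_def using smooth_step_bounds by (auto intro!: mult_nonneg_nonneg mult_le_one)
    show "\<eta> z = 1" if "\<bar>fst z - c\<bar> < l" "r' < dist (snd z) x0" "dist (snd z) x0 < r3" for z
    proof -
      have "(fst z - c)\<^sup>2 \<le> l\<^sup>2" using that(1) assms by (simp add: abs_le_square_iff[symmetric])
      then have "1 \<le> f1 z" using pos by (simp add: f1_def power2_eq_square)
      moreover have "r'\<^sup>2 \<le> ?s z" using spatial_sqdist_less[OF rs(2), of x0 z] that by simp
      then have "1 \<le> f2 z" using pos by (simp add: f2_def)
      moreover have "?s z \<le> r3\<^sup>2" using spatial_sqdist_le[OF rs(3), of x0 z] that by simp
      then have "1 \<le> f3 z" using pos by (simp add: f3_def)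
      ultimately show ?thesis by (simp add: \<eta>_def smooth_step_eq_1)
    qed
    show "\<eta> z = 0" if nz: "\<not> (\<bar>fst z - c\<bar> \<le> l' \<and> r \<le> dist (snd z) x0 \<and> dist (snd z) x0 \<le> r4)" for z
    proof -
      consider "l' < \<bar>fst z - c\<bar>" | "dist (snd z) x0 < r" | "r4 < dist (snd z) x0" using nz by linarith
      then show ?thesis
      proof cases
        case 1
        then have "l'\<^sup>2 \<le> (fst z - c)\<^sup>2" using assms by (simp add: abs_le_square_iff[symmetric])
        then have "f1 z \<le> 0" using pos by (simp add: f1_def power2_eq_square divide_le_0_iff)
        then show ?thesis by (simp add: \<eta>_def smooth_step_eq_0)
      next
        case 2
        then have "?s z < r\<^sup>2" using spatial_sqdist_less[OF rs(1), of x0 z] by simp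
        then have "f2 z \<le> 0" using pos by (simp add: f2_def divide_le_0_iff)
        then show ?thesis by (simp add: \<eta>_def smooth_step_eq_0)
      next
        case 3
        then have "r4\<^sup>2 < ?s z" using spatial_sqdist_le[OF rs(4), of x0 z] by simp
        then have "f3 z \<le> 0" using pos by (simp add: f3_def divide_le_0_iff)
        then show ?thesis by (simp add: \<eta>_def smooth_step_eq_0)
      qed
    qed
  qed
qed

text \<open>The commutator with the cutoff is \<open>U z * heat \<eta> z\<close> minus twice the
  product of the gradients, and Cauchy-Schwarz bounds its square by the energy density. The bound is
  pointwise: \<open>N\<close> may depend on \<open>z\<close>, which records where the cutoff is
  locally constant 1 and causes no error.\<close>

lemma heat_cutoff_square_bound:
  fixes \<eta> U :: "real \<times> 'a::euclidean_space \<Rightarrow> real"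
  assumes \<eta>: "C2_local UNIV \<eta>" and U: "C2_local UNIV U" and "\<bar>\<eta> z\<bar> \<le> 1"
    and N: "(heat \<eta> z)\<^sup>2 + 4 * (\<Sum>b\<in>Basis. (pderivative (0, b) \<eta> z)\<^sup>2) \<le> N"
  shows "(heat (\<lambda>z. \<eta> z * U z) z)\<^sup>2 \<le> 3 * (heat U z)\<^sup>2 + 3 * N * energy_density U z"
proof -
  define P where "P = (\<Sum>b\<in>Basis. pderivative (0, b) \<eta> z * pderivative (0, b) U z)"
  define G where "G = (\<Sum>b\<in>Basis. (pderivative (0, b) U z)\<^sup>2)"
  define H where "H = (\<Sum>b\<in>Basis. (pderivative (0, b) \<eta> z)\<^sup>2)"
  have pos: "0 \<le> G" "0 \<le> H" by (auto simp: G_def H_def intro!: sum_nonneg)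
  have cs: "P\<^sup>2 \<le> H * G" unfolding P_def G_def H_def by (rule Cauchy_Schwarz_ineq_sum)
  have h: "heat (\<lambda>z. \<eta> z * U z) z = \<eta> z * heat U z + U z * heat \<eta> z - 2 * P"
    unfolding P_def by (rule heat_mult[OF \<eta> U])
  have "(x + y - w)\<^sup>2 \<le> 3 * x\<^sup>2 + 3 * y\<^sup>2 + 3 * w\<^sup>2" for x y w :: real
    using zero_le_power2[of "x - y"] zero_le_power2[of "x + w"] zero_le_power2[of "y + w"]
    by (simp add: power2_eq_square algebra_simps)
  from this[of "\<eta> z * heat U z" "U z * heat \<eta> z" "2 * P"]
  have 1: "(heat (\<lambda>z. \<eta> z * U z) z)\<^sup>2 \<le>
      3 * ((\<eta> z)\<^sup>2 * (heat U z)\<^sup>2) + 3 * ((U z)\<^sup>2 * (heat \<eta> z)\<^sup>2) + 12 * P\<^sup>2"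
    unfolding h by (simp add: power_mult_distrib)
  have "(\<eta> z)\<^sup>2 \<le> 1" using assms(3) by (simp add: abs_square_le_1)
  then have 2: "(\<eta> z)\<^sup>2 * (heat U z)\<^sup>2 \<le> (heat U z)\<^sup>2"
    by (intro mult_left_le_one_le) auto
  have N': "(heat \<eta> z)\<^sup>2 + 4 * H \<le> N" using N by (simp add: H_def)
  have "(heat \<eta> z)\<^sup>2 \<le> N" using N' pos by linarith
  then have 3: "(U z)\<^sup>2 * (heat \<eta> z)\<^sup>2 \<le> (U z)\<^sup>2 * N" by (intro mult_left_mono) auto
  have "4 * H \<le> N" using N' zero_le_power2[of "heat \<eta> z"] by linarith
  then have "4 * H * G \<le> N * G" using pos by (intro mult_right_mono)
  then have 4: "4 * P\<^sup>2 \<le> N * G" using cs by linarith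
  have "(heat (\<lambda>z. \<eta> z * U z) z)\<^sup>2 \<le> 3 * (heat U z)\<^sup>2 + 3 * ((U z)\<^sup>2 * N) + 3 * (N * G)"
    using 1 2 3 4 by linarith
  then show ?thesis by (simp add: energy_density_def G_def algebra_simps)
qed

theorem three_cylinders_exponential:
  fixes x0 :: "'a::euclidean_space"
  assumes r: "0 < r1" "r1 < r2" "r2 < r5" and \<epsilon>: "0 < \<epsilon>" "2 * \<epsilon> < T"
  obtains C \<alpha> \<beta> \<tau>0 where "0 < C" "0 < \<alpha>" "0 < \<beta>" "0 < \<tau>0"
    "\<And>\<tau> U. \<tau>0 \<le> \<tau> \<Longrightarrow> C2_local UNIV U \<Longrightarrow>
      cylinder_integral \<epsilon> (T - \<epsilon>) x0 r2 (energy_density U) \<le>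
      C * (exp (\<alpha> * \<tau>) * (cylinder_integral 0 T x0 r1 (energy_density U)
              + cylinder_integral 0 T x0 r5 (\<lambda>z. (heat U z)\<^sup>2))
        + exp (- \<beta> * \<tau>) * cylinder_integral 0 T x0 r5 (energy_density U))"
proof -
  \<comment> \<open>\<open>m\<close> is half the length of the inner time interval; \<open>l\<close>
    and \<open>l'\<close> divide the gap between \<open>m\<close> and \<open>T / 2\<close> into
    thirds, and \<open>r3\<close>, \<open>r4\<close> do the same between \<open>r2\<close> and
    \<open>r5\<close>. Weight and cutoff share the threshold \<open>l\<close>: \<open>g\<close> has
    reached 1 by the time the cutoff starts to fall.\<close>
  define m where "m = T / 2 - \<epsilon>"
  define l where "l = T / 2 - 2 * \<epsilon> / 3"
  define l' where "l' = T / 2 - \<epsilon> / 3"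
  define r3 where "r3 = (2 * r2 + r5) / 3"
  define r4 where "r4 = (r2 + 2 * r5) / 3"
  define \<rho> where "\<rho> = r1 / 4"
  have l: "0 < m" "m < l" "l < l'" "l' < T / 2" using \<epsilon> by (auto simp: m_def l_def l'_def field_simps)
  have rr: "0 < \<rho>" "\<rho> < r1 / 2" "r1 / 2 < r1" "r1 / 2 < r3" "r2 < r3" "r3 < r4" "r4 < r5"
    using r by (auto simp: \<rho>_def r3_def r4_def field_simps)
  obtain g \<gamma> \<gamma>' where g: "\<And>t. (g has_field_derivative \<gamma> t) (at t)"
      "\<And>t. (\<gamma> has_field_derivative \<gamma>' t) (at t)" "continuous_on UNIV \<gamma>'"
    and g0: "\<And>t. 0 \<le> g t" and gm: "\<And>t. \<bar>t - T / 2\<bar> \<le> m \<Longrightarrow> g t = 0"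
    and gl: "\<And>t. l \<le> \<bar>t - T / 2\<bar> \<Longrightarrow> 1 \<le> g t"
    using time_weight_exists[of m l "T / 2"] l by (metis less_imp_le)
  \<comment> \<open>The smallest value with \<open>2 \<le> \<mu> * s\<close> outside the ball of
    radius \<open>\<rho>\<close>, as the Carleman estimate demands.\<close>
  define \<mu> where "\<mu> = 2 / \<rho>\<^sup>2"
  have \<mu>: "0 < \<mu>" using rr by (simp add: \<mu>_def)
  interpret carleman_weight x0 \<mu> g \<gamma> \<gamma>' by unfold_locales (fact \<mu> g)+
  define K where "K = {z::real \<times> 'a. \<bar>fst z - T / 2\<bar> \<le> l' \<and> \<rho> \<le> dist (snd z) x0 \<and> dist (snd z) x0 \<le> r4}"
  obtain \<eta> :: "real \<times> 'a \<Rightarrow> real" where \<eta>: "C2_local UNIV \<eta>" "\<And>z. 0 \<le> \<eta> z" "\<And>z. \<eta> z \<le> 1"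
    and \<eta>1: "\<And>z. \<bar>fst z - T / 2\<bar> < l \<Longrightarrow> r1 / 2 < dist (snd z) x0 \<Longrightarrow> dist (snd z) x0 < r3 \<Longrightarrow> \<eta> z = 1"
    and \<eta>0: "\<And>z. z \<notin> K \<Longrightarrow> \<eta> z = 0"
  proof (rule space_time_cutoff_exists[where r = \<rho> and r' = "r1 / 2" and ?r3.0 = r3 and ?r4.0 = r4
        and l = l and l' = l' and ?x0.0 = x0 and c = "T / 2"])
    show "0 < l" using l by linarith
  qed (use rr l in \<open>auto simp: K_def\<close>)
  have K: "compact K"
  proof (rule compact_eq_bounded_closed[THEN iffD2], intro conjI)
    have "K \<subseteq> cball (T / 2) l' \<times> cball x0 r4"
      by (auto simp: K_def dist_real_def dist_commute abs_minus_commute)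
    then show "bounded K" by (rule bounded_subset[rotated]) (auto intro: bounded_Times)
    show "closed K" unfolding K_def
      by (intro closed_Collect_conj closed_Collect_le continuous_intros)
  qed
  have Ks: "2 \<le> \<mu> * s z" if "z \<in> K" for z
  proof -
    have "\<rho>\<^sup>2 \<le> s z" using spatial_sqdist_less[OF rr(1), of x0 z] that by (auto simp: K_def)
    then have "\<mu> * \<rho>\<^sup>2 \<le> \<mu> * s z" using \<mu> by (intro mult_left_mono) auto
    then show ?thesis using rr by (simp add: \<mu>_def)
  qed
  obtain c \<tau>0 where c: "0 < c" "1 \<le> \<tau>0" and carleman: "\<And>\<tau> w. \<tau>0 \<le> \<tau> \<Longrightarrow> C2_local UNIV w \<Longrightarrow> (\<And>z. z \<notin> K \<Longrightarrow> w z = 0) \<Longrightarrow>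
      c * (\<integral>z. exp (2 * \<tau> * \<phi> z) * energy_density w z \<partial>lborel) \<le>
      (\<integral>z. exp (2 * \<tau> * \<phi> z) * (heat w z)\<^sup>2 \<partial>lborel)"
    unfolding energy_density_def heat_def using carleman_estimate[OF K Ks] by blast
  \<comment> \<open>This \<open>\<kappa>\<close> is not the interpolation exponent: it measures the
    commutator with the cutoff, and vanishes wherever \<open>\<eta>\<close> is locally
    constant.\<close>
  define \<kappa> where "\<kappa> z = (heat \<eta> z)\<^sup>2 + 4 * (\<Sum>b\<in>Basis. (pderivative (0, b) \<eta> z)\<^sup>2)" for z
  have c\<kappa>: "continuous_on S \<kappa>" for S
  proof (rule continuous_on_subset)
    show "continuous_on UNIV \<kappa>" unfolding \<kappa>_def
      by (intro continuous_intros continuous_on_heat C1_local_continuous_on_pderivative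
          C2_local_imp_C1 \<eta>)
  qed simp
  obtain N where N: "0 \<le> N" "\<And>z. z \<in> K \<Longrightarrow> \<bar>\<kappa> z\<bar> \<le> N"
    using continuous_bounded_on_compact[OF K c\<kappa>] by blast
  define Gd where "Gd = {z::real \<times> 'a. \<bar>fst z - T / 2\<bar> < l \<and> r1 / 2 < dist (snd z) x0 \<and> dist (snd z) x0 < r3}"
  have Gd: "open Gd" unfolding Gd_def
    by (intro open_Collect_conj open_Collect_less continuous_intros)
  have \<eta>G: "\<eta> z = 1" if "z \<in> Gd" for z using \<eta>1 that by (auto simp: Gd_def)
  have D\<eta>G: "pderivative e \<eta> z = 0" if "z \<in> Gd" for e z
    using pderivative_cong[OF Gd that \<eta>G] by simp
  have DD\<eta>G: "pderivative h (pderivative e \<eta>) z = 0" if "z \<in> Gd" for e h z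
    using pderivative_cong[OF Gd that, of "pderivative e \<eta>" "\<lambda>_. 0" h] D\<eta>G by simp
  have \<kappa>G: "\<kappa> z = 0" if "z \<in> Gd" for z using D\<eta>G[OF that] DD\<eta>G[OF that] by (simp add: \<kappa>_def heat_def)
  define \<phi>2 \<phi>3 where "\<phi>2 = exp (- \<mu> * r2\<^sup>2)" and "\<phi>3 = exp (- \<mu> * r3\<^sup>2)"
  have \<phi>23: "\<phi>3 < \<phi>2" "\<phi>2 < 1" "0 < \<phi>3"
    using \<mu> r rr by (auto simp: \<phi>2_def \<phi>3_def intro!: power_strict_mono)
  have A1: "A z \<le> 1" for z using \<mu> by (simp add: A_def spatial_sqdist_def)
  have \<phi>1: "\<phi> z \<le> 1" for z
    using g0[of "fst z"] A1[of z] by (simp add: \<phi>_def)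
  \<comment> \<open>Both error regions lie below the level \<open>\<phi>3\<close>: beyond
    \<open>r3\<close> because the Gaussian decreases, and near the ends of the time interval because
    \<open>A \<le> 1 \<le> g\<close> makes the weight at most 0.\<close>
  have \<phi>_bad: "\<phi> z \<le> \<phi>3" if "r3 \<le> dist (snd z) x0 \<or> l \<le> \<bar>fst z - T / 2\<bar>" for z
    using that
  proof
    assume "r3 \<le> dist (snd z) x0"
    then have "r3\<^sup>2 \<le> s z" using spatial_sqdist_less[of r3 x0 z] r rr by auto
    then have "A z \<le> \<phi>3" using \<mu> by (simp add: A_def \<phi>3_def)
    then show ?thesis using g0[of "fst z"] by (simp add: \<phi>_def)
  next
    assume "l \<le> \<bar>fst z - T / 2\<bar>"
    then have "1 \<le> g (fst z)" by (rule gl)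
    then show ?thesis using \<phi>23 A1[of z] by (simp add: \<phi>_def)
  qed
  define Z1 Z2 Z5 where "Z1 = {0<..<T} \<times> ball x0 r1" and "Z2 = {\<epsilon><..<T - \<epsilon>} \<times> ball x0 r2"
    and "Z5 = {0<..<T} \<times> ball x0 r5"
  have KZ5: "z \<in> Z5" if "z \<in> K" for z
    using that l rr by (cases z) (auto simp: K_def Z5_def dist_commute abs_le_iff abs_less_iff field_simps)
  have KZ1: "z \<in> Z1" if "z \<in> K" "dist (snd z) x0 \<le> r1 / 2" for z
    using that l rr by (cases z) (auto simp: K_def Z1_def dist_commute abs_le_iff abs_less_iff field_simps)
  \<comment> \<open>The summand 1 accounts for the part of the target near \<open>x0\<close>, where
    the cutoff may vanish and the energy is bounded directly by that on the small cylinder.\<close>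
  define C where "C = 1 + 3 * (1 + N) / c"
  \<comment> \<open>The Carleman estimate is divided by \<open>exp (2 * \<tau> * \<phi>2)\<close>, a
    lower bound for the weight on the target outside the small cylinder. Terms weighted by
    \<open>exp (2 * \<tau>)\<close> then grow at rate \<open>\<alpha>\<close>, those weighted by
    \<open>exp (2 * \<tau> * \<phi>3)\<close> decay at rate \<open>\<beta>\<close>.\<close>
  define \<alpha> \<beta> where "\<alpha> = 2 * (1 - \<phi>2)" and "\<beta> = 2 * (\<phi>2 - \<phi>3)"
  have C: "0 < C" "3 * (1 + N) / c \<le> C" "1 + 3 * (1 + N) / c \<le> C"
    using c N by (auto simp: C_def add_pos_nonneg)
  show ?thesis
  proof (rule that[of C \<alpha> \<beta> \<tau>0])
    show "0 < C" "0 < \<alpha>" "0 < \<beta>" "0 < \<tau>0" using C \<phi>23 c by (auto simp: \<alpha>_def \<beta>_def)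
    fix \<tau> U assume \<tau>: "\<tau>0 \<le> \<tau>" and U: "C2_local UNIV (U :: real \<times> 'a \<Rightarrow> real)"
    have \<tau>p: "0 < \<tau>" using \<tau> c by linarith
    define h where "h = energy_density U"
    define w where "w z = \<eta> z * U z" for z
    have w: "C2_local UNIV w" unfolding w_def by (intro C2_local_mult \<eta> U open_UNIV)
    have w0: "w z = 0" if "z \<notin> K" for z using \<eta>0[OF that] by (simp add: w_def)
    have Dw0: "pderivative e w z = 0" if "z \<notin> K" for e z
      using pderivative_eq_0_outside[OF compact_imp_closed[OF K] w0 that] .
    have DDw0: "pderivative k (pderivative e w) z = 0" if "z \<notin> K" for e k z
      by (rule pderivative_eq_0_outside[OF compact_imp_closed[OF K] Dw0 that])
    have hw0: "heat w z = 0" and ew0: "energy_density w z = 0" if "z \<notin> K" for z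
      using w0[OF that] Dw0[OF that] DDw0[OF that] by (auto simp: heat_def energy_density_def)
    have h0: "0 \<le> h z" for z by (simp add: h_def energy_density_nonneg)
    have wG: "energy_density w z = h z" if "z \<in> Gd" for z
    proof -
      have "w y = U y" if "y \<in> Gd" for y using \<eta>G[OF that] by (simp add: w_def)
      then show ?thesis using pderivative_cong[OF Gd \<open>z \<in> Gd\<close>, of w U] that
        by (simp add: h_def energy_density_def)
    qed
    define f where "f z = 3 * exp (2 * \<tau>) * (indicator Z5 z * (heat U z)\<^sup>2)
        + (3 * N * exp (2 * \<tau>) * (indicator Z1 z * h z) + 3 * N * exp (2 * \<tau> * \<phi>3) * (indicator Z5 z * h z))" for z
    have f0: "0 \<le> f z" for z
      unfolding f_def using N h0[of z] by (intro add_nonneg_nonneg mult_nonneg_nonneg) auto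
    have up: "exp (2 * \<tau> * \<phi> z) * (heat w z)\<^sup>2 \<le> f z" for z
    proof (cases "z \<in> K")
      case False
      then show ?thesis using hw0 f0 by simp
    next
      case True
      have e1: "exp (2 * \<tau> * \<phi> z) \<le> exp (2 * \<tau>)" using \<phi>1[of z] \<tau>p by simp
      have \<eta>z: "\<bar>\<eta> z\<bar> \<le> 1" using \<eta>(2,3) by (simp add: abs_le_iff)
      have hU: "exp (2 * \<tau> * \<phi> z) * (3 * (heat U z)\<^sup>2) \<le> 3 * exp (2 * \<tau>) * (indicator Z5 z * (heat U z)\<^sup>2)"
        using mult_right_mono[OF e1, of "3 * (heat U z)\<^sup>2"] KZ5[OF True] by simp
      have "(heat w z)\<^sup>2 \<le> 3 * (heat U z)\<^sup>2 + 3 * \<kappa> z * h z"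
        unfolding w_def h_def by (rule heat_cutoff_square_bound[OF \<eta>(1) U \<eta>z]) (simp add: \<kappa>_def)
      then have "exp (2 * \<tau> * \<phi> z) * (heat w z)\<^sup>2 \<le>
          exp (2 * \<tau> * \<phi> z) * (3 * (heat U z)\<^sup>2 + 3 * \<kappa> z * h z)" by (intro mult_left_mono) auto
      also have "\<dots> = exp (2 * \<tau> * \<phi> z) * (3 * (heat U z)\<^sup>2) + exp (2 * \<tau> * \<phi> z) * (3 * \<kappa> z * h z)"
        by (rule distrib_left)
      also have "\<dots> \<le> f z"
        unfolding f_def
      proof (rule add_mono[OF hU])
        have \<kappa>N: "3 * \<kappa> z * h z \<le> 3 * N * h z"
          using N(2)[OF True] h0[of z] by (intro mult_right_mono) auto
        \<comment> \<open>On \<open>Gd\<close> the cutoff is locally 1 and there is no commutator.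
          Near \<open>x0\<close> the crude bound \<open>\<phi> \<le> 1\<close> is good enough, since
          the energy there is the observed one. Elsewhere the weight is below
          \<open>\<phi>3\<close>.\<close>
        consider "z \<in> Gd" | "dist (snd z) x0 \<le> r1 / 2" | "r3 \<le> dist (snd z) x0 \<or> l \<le> \<bar>fst z - T / 2\<bar>"
          unfolding Gd_def mem_Collect_eq by linarith
        then show "exp (2 * \<tau> * \<phi> z) * (3 * \<kappa> z * h z) \<le>
            3 * N * exp (2 * \<tau>) * (indicator Z1 z * h z) + 3 * N * exp (2 * \<tau> * \<phi>3) * (indicator Z5 z * h z)"
        proof cases
          case 1
          then show ?thesis using \<kappa>G N h0[of z] by (auto intro!: add_nonneg_nonneg mult_nonneg_nonneg)
        next
          case 2
          have "exp (2 * \<tau> * \<phi> z) * (3 * \<kappa> z * h z) \<le> exp (2 * \<tau>) * (3 * N * h z)"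
            using N h0[of z] by (intro order_trans[OF mult_left_mono[OF \<kappa>N] mult_right_mono[OF e1]]) auto
          moreover have "0 \<le> 3 * N * exp (2 * \<tau> * \<phi>3) * (indicator Z5 z * h z)"
            using N h0[of z] by (intro mult_nonneg_nonneg) auto
          ultimately show ?thesis using KZ1[OF True 2] by (simp add: mult_ac)
        next
          case 3
          have e3: "exp (2 * \<tau> * \<phi> z) \<le> exp (2 * \<tau> * \<phi>3)" using \<phi>_bad[OF 3] \<tau>p by simp
          have "exp (2 * \<tau> * \<phi> z) * (3 * \<kappa> z * h z) \<le> exp (2 * \<tau> * \<phi>3) * (3 * N * h z)"
            using N h0[of z] by (intro order_trans[OF mult_left_mono[OF \<kappa>N] mult_right_mono[OF e3]]) auto
          moreover have "0 \<le> 3 * N * exp (2 * \<tau>) * (indicator Z1 z * h z)"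
            using N h0[of z] by (intro mult_nonneg_nonneg) auto
          ultimately show ?thesis using KZ5[OF True] by (simp add: mult_ac)
        qed
      qed
      finally show ?thesis .
    qed
    \<comment> \<open>A target point outside the small cylinder lies in \<open>Gd\<close>, where
      \<open>w\<close> agrees with \<open>U\<close> nearby. As \<open>g\<close> vanishes at its
      time, the weight is at least \<open>exp (2 * \<tau> * \<phi>2)\<close>, so the factor in front
      of the energy density is at least 1.\<close>
    have low: "indicator Z2 z * h z \<le>
        indicator Z1 z * h z + exp (- 2 * \<tau> * \<phi>2) * (exp (2 * \<tau> * \<phi> z) * energy_density w z)" for z
    proof -
      have nn: "0 \<le> exp (- 2 * \<tau> * \<phi>2) * (exp (2 * \<tau> * \<phi> z) * energy_density w z)"
        by (simp add: energy_density_nonneg)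
      consider "z \<notin> Z2" | "z \<in> Z1" | "z \<in> Z2" "z \<notin> Z1" by blast
      then show ?thesis
      proof cases
        case 1 then show ?thesis using nn h0[of z] by (simp add: add_nonneg_nonneg)
      next
        case 2 then show ?thesis using nn h0[of z] by (simp add: indicator_def)
      next
        case 3
        have t: "\<bar>fst z - T / 2\<bar> < m" and d2: "dist (snd z) x0 < r2"
          using 3(1) by (auto simp: Z2_def m_def abs_less_iff dist_commute field_simps)
        have "r1 \<le> dist (snd z) x0"
          using 3 \<epsilon> by (cases z) (auto simp: Z1_def Z2_def dist_commute not_less)
        then have G: "z \<in> Gd" using t d2 l r rr by (auto simp: Gd_def)
        have "s z \<le> r2\<^sup>2" using spatial_sqdist_less[of r2 x0 z] d2 r by auto
        then have "\<phi>2 \<le> A z" using \<mu> by (simp add: \<phi>2_def A_def)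
        then have "\<phi>2 \<le> \<phi> z" using gm[of "fst z"] t by (simp add: \<phi>_def)
        then have "0 \<le> - 2 * \<tau> * \<phi>2 + 2 * \<tau> * \<phi> z" using \<tau>p by simp
        then have "1 \<le> exp (- 2 * \<tau> * \<phi>2) * exp (2 * \<tau> * \<phi> z)"
          unfolding exp_add[symmetric] by (simp only: one_le_exp_iff)
        from mult_right_mono[OF this h0[of z]] show ?thesis
          using 3 wG[OF G] by (simp add: mult_ac)
      qed
    qed
    have ch: "continuous_on UNIV h" unfolding h_def by (rule continuous_on_energy_density[OF U])
    have cH: "continuous_on UNIV (\<lambda>z. (heat U z)\<^sup>2)" by (intro continuous_intros continuous_on_heat U)
    have c\<phi>: "continuous_on UNIV \<phi>" by (rule C1_local_imp_continuous_on[OF C2_local_imp_C1[OF C2_\<phi>]])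
    have i1: "integrable lborel (\<lambda>z. indicator Z1 z * h z)" "integrable lborel (\<lambda>z. indicator Z2 z * h z)"
      "integrable lborel (\<lambda>z. indicator Z5 z * h z)" "integrable lborel (\<lambda>z. indicator Z5 z * (heat U z)\<^sup>2)"
      unfolding Z1_def Z2_def Z5_def by (intro integrable_cylinder ch cH)+
    have i2: "integrable lborel (\<lambda>z. exp (2 * \<tau> * \<phi> z) * energy_density w z)"
      by (rule integrable_compact_support[OF _ K])
        (auto intro!: continuous_intros c\<phi> continuous_on_energy_density w simp: ew0)
    have i3: "integrable lborel (\<lambda>z. exp (2 * \<tau> * \<phi> z) * (heat w z)\<^sup>2)"
      by (rule integrable_compact_support[OF _ K])
        (auto intro!: continuous_intros c\<phi> continuous_on_heat w simp: hw0)
    have if': "integrable lborel f"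
      unfolding f_def by (intro Bochner_Integration.integrable_add integrable_mult_right i1)
    define I1 I2 I5 F where "I1 = (\<integral>z. indicator Z1 z * h z \<partial>lborel)"
      and "I2 = (\<integral>z. indicator Z2 z * h z \<partial>lborel)" and "I5 = (\<integral>z. indicator Z5 z * h z \<partial>lborel)"
      and "F = (\<integral>z. indicator Z5 z * (heat U z)\<^sup>2 \<partial>lborel)"
    have nn: "0 \<le> I1" "0 \<le> I5" "0 \<le> F"
      unfolding I1_def I5_def F_def using h0 by (auto intro!: Bochner_Integration.integral_nonneg)
    define J where "J = (\<integral>z. exp (2 * \<tau> * \<phi> z) * energy_density w z \<partial>lborel)"
    have "c * J \<le> (\<integral>z. exp (2 * \<tau> * \<phi> z) * (heat w z)\<^sup>2 \<partial>lborel)"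
      unfolding J_def by (rule carleman[OF \<tau> w w0])
    also have "\<dots> \<le> (\<integral>z. f z \<partial>lborel)" by (intro integral_mono i3 if' up)
    also have "\<dots> = 3 * exp (2 * \<tau>) * F + (3 * N * exp (2 * \<tau>) * I1 + 3 * N * exp (2 * \<tau> * \<phi>3) * I5)"
      unfolding f_def F_def I1_def I5_def using i1 by simp
    also have "\<dots> \<le> 3 * (1 + N) * (exp (2 * \<tau>) * (I1 + F) + exp (2 * \<tau> * \<phi>3) * I5)"
    proof -
      have "0 \<le> exp (2 * \<tau>) * I1" "0 \<le> N * (exp (2 * \<tau>) * F)" "0 \<le> exp (2 * \<tau> * \<phi>3) * I5"
        using nn N by auto
      then show ?thesis by (simp add: algebra_simps)
    qed
    finally have cJ: "J \<le> 3 * (1 + N) / c * (exp (2 * \<tau>) * (I1 + F) + exp (2 * \<tau> * \<phi>3) * I5)"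
      using c by (simp add: field_simps)
    have "I2 \<le> (\<integral>z. indicator Z1 z * h z + exp (- 2 * \<tau> * \<phi>2) * (exp (2 * \<tau> * \<phi> z) * energy_density w z) \<partial>lborel)"
      unfolding I2_def
      by (intro integral_mono Bochner_Integration.integrable_add integrable_mult_right i1 i2 low)
    also have "\<dots> = I1 + exp (- 2 * \<tau> * \<phi>2) * J"
      unfolding I1_def J_def using i1 i2 by simp
    also have "\<dots> \<le> I1 + exp (- 2 * \<tau> * \<phi>2) * (3 * (1 + N) / c * (exp (2 * \<tau>) * (I1 + F) + exp (2 * \<tau> * \<phi>3) * I5))"
      by (intro add_left_mono mult_left_mono cJ) simp
    also have "\<dots> = I1 + 3 * (1 + N) / c * (exp (\<alpha> * \<tau>) * (I1 + F) + exp (- \<beta> * \<tau>) * I5)"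
    proof -
      have e: "exp (\<alpha> * \<tau>) = exp (- 2 * \<tau> * \<phi>2) * exp (2 * \<tau>)"
        "exp (- \<beta> * \<tau>) = exp (- 2 * \<tau> * \<phi>2) * exp (2 * \<tau> * \<phi>3)"
        unfolding exp_add[symmetric] by (simp_all add: \<alpha>_def \<beta>_def algebra_simps)
      show ?thesis unfolding e by (simp add: algebra_simps)
    qed
    also have "\<dots> \<le> C * (exp (\<alpha> * \<tau>) * (I1 + F) + exp (- \<beta> * \<tau>) * I5)"
    proof -
      have "1 \<le> exp (\<alpha> * \<tau>)" using \<phi>23 \<tau>p by (simp add: \<alpha>_def)
      then have "1 * I1 \<le> exp (\<alpha> * \<tau>) * (I1 + F)" using nn by (intro mult_mono) auto
      moreover have "0 \<le> exp (- \<beta> * \<tau>) * I5" using nn by simp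
      ultimately have "I1 \<le> exp (\<alpha> * \<tau>) * (I1 + F) + exp (- \<beta> * \<tau>) * I5" by linarith
      then show ?thesis unfolding C_def distrib_right by simp
    qed
    finally show "cylinder_integral \<epsilon> (T - \<epsilon>) x0 r2 (energy_density U) \<le>
      C * (exp (\<alpha> * \<tau>) * (cylinder_integral 0 T x0 r1 (energy_density U)
              + cylinder_integral 0 T x0 r5 (\<lambda>z. (heat U z)\<^sup>2))
        + exp (- \<beta> * \<tau>) * cylinder_integral 0 T x0 r5 (energy_density U))"
      unfolding I1_def I2_def I5_def F_def h_def Z1_def Z2_def Z5_def cylinder_integral_def .
  qed
qed

section \<open>Optimisation of the exponential parameter\<close>

lemma interpolation_from_exponential:
  fixes C \<alpha> \<beta> \<tau>0 X Y Z :: real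
  assumes C: "0 < C" "0 < \<alpha>" "0 < \<beta>" "0 \<le> X" "0 \<le> Y" "Z \<le> Y"
    and le: "\<And>\<tau>. \<tau>0 \<le> \<tau> \<Longrightarrow> Z \<le> C * (exp (\<alpha> * \<tau>) * X + exp (- \<beta> * \<tau>) * Y)"
  defines "\<kappa> \<equiv> \<beta> / (\<alpha> + \<beta>)"
  shows "Z \<le> (1 + C * (exp (\<alpha> * \<tau>0) + exp (- \<beta> * \<tau>0))) * (X powr \<kappa> * Y powr (1 - \<kappa>))"
proof -
  have \<kappa>: "0 < \<kappa>" "\<kappa> < 1" "1 - \<kappa> = \<alpha> / (\<alpha> + \<beta>)" using C by (auto simp: \<kappa>_def field_simps)
  let ?P = "X powr \<kappa> * Y powr (1 - \<kappa>)"
  let ?D = "C * (exp (\<alpha> * \<tau>0) + exp (- \<beta> * \<tau>0))"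
  have D: "0 \<le> ?D" using C by (intro mult_nonneg_nonneg add_nonneg_nonneg) auto
  \<comment> \<open>Only the last case balances the two exponentials. For \<open>X = 0\<close> the
    best parameter is infinite, which is why a limit is taken; for \<open>Y \<le> X\<close>
    balancing gives no parameter above \<open>\<tau>0\<close>, and the trivial bound
    \<open>Z \<le> Y\<close> is used instead.\<close>
  consider "Y = 0" | "X = 0" | "0 < Y" "Y \<le> X" | "0 < X" "X < Y" using C by linarith
  then show ?thesis
  proof cases
    case 1
    then show ?thesis using C by simp
  next
    case 2
    have "((\<lambda>\<tau>. C * (exp (- \<beta> * \<tau>) * Y)) \<longlongrightarrow> C * (0 * Y)) at_top"
    proof (intro tendsto_intros)
      have "filterlim (\<lambda>\<tau>. - \<beta> * \<tau>) at_bot at_top"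
        using C by (intro filterlim_tendsto_neg_mult_at_bot[where c = "- \<beta>"] filterlim_ident) auto
      then show "((\<lambda>\<tau>. exp (- \<beta> * \<tau>)) \<longlongrightarrow> 0) at_top" by (rule filterlim_compose[OF exp_at_bot])
    qed
    moreover have "eventually (\<lambda>\<tau>. Z \<le> C * (exp (- \<beta> * \<tau>) * Y)) at_top"
      using eventually_ge_at_top[of \<tau>0] by (rule eventually_mono) (use le 2 in auto)
    ultimately have "Z \<le> C * (0 * Y)" by (intro tendsto_lowerbound) auto
    then show ?thesis using 2 by simp
  next
    case 3
    have "Y = Y powr \<kappa> * Y powr (1 - \<kappa>)" using 3 by (simp flip: powr_add)
    also have "\<dots> \<le> ?P" using 3 \<kappa> by (intro mult_right_mono powr_mono2) auto
    finally have "Z \<le> 1 * ?P" using C by linarith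
    also have "\<dots> \<le> (1 + ?D) * ?P" using D by (intro mult_right_mono) auto
    finally show ?thesis .
  next
    case 4
    \<comment> \<open>Without the summand \<open>\<tau>0\<close> this value makes
      \<open>exp (\<alpha> * \<tau>) * X\<close> and \<open>exp (- \<beta> * \<tau>) * Y\<close>
      equal, both to \<open>X powr \<kappa> * Y powr (1 - \<kappa>)\<close>. The shift makes it
      admissible and only multiplies the two terms by constants.\<close>
    define \<tau> where "\<tau> = \<tau>0 + ln (Y / X) / (\<alpha> + \<beta>)"
    have ln_pos: "0 < ln (Y / X)" using 4 by simp
    have "\<tau>0 \<le> \<tau>" using ln_pos C by (simp add: \<tau>_def)
    then have Z: "Z \<le> C * (exp (\<alpha> * \<tau>) * X + exp (- \<beta> * \<tau>) * Y)" by (rule le)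
    have P: "?P = exp (\<kappa> * ln X + (1 - \<kappa>) * ln Y)"
      using 4 by (simp add: powr_def exp_add mult.commute)
    have lnYX: "ln (Y / X) = ln Y - ln X" using 4 by (simp add: ln_div)
    define L where "L = ln Y - ln X"
    have a: "\<alpha> * \<tau> = \<alpha> * \<tau>0 + (1 - \<kappa>) * L"
      unfolding \<tau>_def lnYX \<kappa>(3) L_def[symmetric] by (simp add: distrib_left)
    have b: "- \<beta> * \<tau> = - \<beta> * \<tau>0 - \<kappa> * L"
      unfolding \<tau>_def lnYX \<kappa>_def L_def[symmetric] by (simp add: distrib_left)
    have "exp (\<alpha> * \<tau>) * X = exp (\<alpha> * \<tau> + ln X)" using 4 by (simp add: exp_add)
    also have "\<alpha> * \<tau> + ln X = \<alpha> * \<tau>0 + (\<kappa> * ln X + (1 - \<kappa>) * ln Y)" unfolding a L_def by (simp add: algebra_simps)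
    finally have A: "exp (\<alpha> * \<tau>) * X = exp (\<alpha> * \<tau>0) * ?P" unfolding P by (simp only: exp_add)
    have "exp (- \<beta> * \<tau>) * Y = exp (- \<beta> * \<tau> + ln Y)" unfolding exp_add using 4 by simp
    also have "- \<beta> * \<tau> + ln Y = - \<beta> * \<tau>0 + (\<kappa> * ln X + (1 - \<kappa>) * ln Y)" unfolding b L_def by (simp add: algebra_simps)
    finally have B: "exp (- \<beta> * \<tau>) * Y = exp (- \<beta> * \<tau>0) * ?P" unfolding P by (simp only: exp_add)
    have "Z \<le> ?D * ?P" using Z unfolding A B by (simp only: distrib_right mult.assoc)
    also have "\<dots> \<le> (1 + ?D) * ?P" by (intro mult_right_mono) auto
    finally show ?thesis .
  qed
qed

section \<open>Translation to extended norms\<close>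

lemma ennpowr_ennreal: "0 \<le> x \<Longrightarrow> ennpowr (ennreal x) p = ennreal (x powr p)"
  by (simp add: ennpowr_def)

lemma ennpowr_mono:
  assumes "a \<le> b" "0 \<le> p"
  shows "ennpowr a p \<le> ennpowr b p"
proof (cases "b = top")
  case False
  then have ab: "a \<noteq> top" "b < top" using assms(1) by (auto simp: less_top top_unique)
  then have "enn2real a powr p \<le> enn2real b powr p"
    using assms by (intro powr_mono2 enn2real_mono) auto
  then show ?thesis using ab False by (simp add: ennpowr_def ennreal_leI)
qed (simp add: ennpowr_def)

text \<open>True at \<open>top\<close> as well, so the root inside the H1 norm and the square
  outside it cancel without any finiteness.\<close>

lemma ennpowr_half_power2: "(ennpowr a (1 / 2))\<^sup>2 = a"
proof (cases a)
  case (real r)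
  then have "(r powr (1 / 2))\<^sup>2 = r" by (simp add: powr_half_sqrt)
  then show ?thesis using real by (simp add: ennpowr_ennreal ennreal_power)
qed (simp add: ennpowr_def power2_eq_square)

lemma power2_norm_grad:
  "(norm (grad v x))\<^sup>2 = (\<Sum>b\<in>Basis. (pderivative b v x)\<^sup>2)"
proof -
  have "grad v x \<bullet> b = pderivative b v x" if "b \<in> Basis" for b
    using that by (simp add: grad_def inner_sum_left inner_Basis if_distrib cong: if_cong)
  then show ?thesis
    using euclidean_inner[of "grad v x" "grad v x"]
    unfolding power2_norm_eq_inner by (simp add: power2_eq_square)
qed

lemma pderivative_slice: "pderivative b (\<lambda>y. u (t, y)) x = pderivative (0, b) u (t, x)"
  by (simp add: pderivative_def)

lemma slice_energy_density:
  "(u (t, x))\<^sup>2 + (norm (grad (\<lambda>y. u (t, y)) x))\<^sup>2 = energy_density u (t, x)"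
  by (simp add: power2_norm_grad energy_density_def pderivative_slice)

text \<open>The inner root cancels against the square, and Tonelli turns the iterated integral into
  one over the cylinder. Continuity of the energy density on an open set provides joint
  measurability; infinite values are included.\<close>

lemma L2_H1_norm_eq:
  assumes "open S" "S \<subseteq> \<Omega>" "C2_local (UNIV \<times> \<Omega>) u"
  shows "L2_H1_norm a b S u =
    ennpowr (\<integral>\<^sup>+ z\<in>{a<..<b} \<times> S. ennreal (energy_density u z) \<partial>lborel) (1 / 2)"
proof -
  let ?f = "\<lambda>z. ennreal (energy_density u z) * indicator ({a<..<b} \<times> S) z"
  have "continuous_on ({a<..<b} \<times> S) (energy_density u)"
    using assms by (intro continuous_on_energy_density[OF C2_local_subset]) auto
  then have "(\<lambda>z. indicator ({a<..<b} \<times> S) z *\<^sub>R energy_density u z) \<in> borel_measurable borel"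
    using assms by (intro borel_measurable_continuous_on_indicator) (auto intro!: borel_open open_Times)
  then have "(\<lambda>z. ennreal (indicator ({a<..<b} \<times> S) z *\<^sub>R energy_density u z)) \<in> borel_measurable borel"
    by measurable
  also have "(\<lambda>z. ennreal (indicator ({a<..<b} \<times> S) z *\<^sub>R energy_density u z)) = ?f"
    by (auto simp: indicator_def)
  finally have meas: "?f \<in> borel_measurable (lborel \<Otimes>\<^sub>M lborel)" unfolding lborel_prod by simp
  have "(\<integral>\<^sup>+ t\<in>{a<..<b}. (H1_norm_on S (\<lambda>x. u (t, x)))\<^sup>2 \<partial>lborel) =
      (\<integral>\<^sup>+ t. \<integral>\<^sup>+ x. ?f (t, x) \<partial>lborel \<partial>lborel)"
  proof (rule nn_integral_cong)
    fix t
    have "(H1_norm_on S (\<lambda>x. u (t, x)))\<^sup>2 * indicator {a<..<b} t =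
        (\<integral>\<^sup>+ x. ennreal (energy_density u (t, x)) * indicator S x \<partial>lborel) * indicator {a<..<b} t"
      unfolding H1_norm_on_def ennpowr_half_power2 slice_energy_density ..
    also have "\<dots> = (\<integral>\<^sup>+ x. ?f (t, x) \<partial>lborel)"
      by (cases "t \<in> {a<..<b}") (auto simp: indicator_def)
    finally show "(H1_norm_on S (\<lambda>x. u (t, x)))\<^sup>2 * indicator {a<..<b} t = (\<integral>\<^sup>+ x. ?f (t, x) \<partial>lborel)" .
  qed
  also have "\<dots> = (\<integral>\<^sup>+ z. ?f z \<partial>lborel)"
    using lborel.nn_integral_fst[OF meas] by (simp add: lborel_prod)
  finally show ?thesis by (simp add: L2_H1_norm_def)
qed

lemma heat_op_eq:
  assumes "C1_local S u" "z \<in> S"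
  shows "heat_op u z = heat u z"
proof -
  obtain t x where z: "z = (t, x)" by (cases z)
  have "((\<lambda>r. u ((0, x) + r *\<^sub>R (1, 0))) has_field_derivative pderivative (1, 0) u ((0, x) + t *\<^sub>R (1, 0))) (at t)"
    using C1_local_differentiable[OF assms(1), of "(t, x)"] assms(2) z by (intro DERIV_along_line) auto
  then have "deriv (\<lambda>s. u (s, x)) t = pderivative (1, 0) u (t, x)" by (simp add: DERIV_imp_deriv)
  moreover have "laplacian (\<lambda>y. u (t, y)) x = (\<Sum>b\<in>Basis. pderivative (0, b) (pderivative (0, b) u) (t, x))"
    unfolding laplacian_def pderivative_slice ..
  ultimately show ?thesis by (simp add: z heat_op_def heat_def)
qed

lemma nn_integral_cylinder:
  assumes f: "continuous_on UNIV f" "\<And>z. 0 \<le> f z"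
    and eq: "\<And>z. z \<in> UNIV \<times> ball x r \<Longrightarrow> f' z = f z"
  shows "(\<integral>\<^sup>+ z\<in>{a<..<b} \<times> ball x r. ennreal (f' z) \<partial>lborel) = ennreal (cylinder_integral a b x r f)"
proof -
  have "(\<integral>\<^sup>+ z\<in>{a<..<b} \<times> ball x r. ennreal (f' z) \<partial>lborel) =
      (\<integral>\<^sup>+ z. ennreal (indicator ({a<..<b} \<times> ball x r) z * f z) \<partial>lborel)"
    using eq by (intro nn_integral_cong) (auto simp: indicator_def)
  also have "\<dots> = ennreal (cylinder_integral a b x r f)"
    unfolding cylinder_integral_def using f
    by (intro nn_integral_eq_integral integrable_cylinder) auto
  finally show ?thesis .
qed

section \<open>Balls inside the domain and extension to the whole space\<close>

lemma cball_subset_of_edist_to_frontier: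
  fixes x0 :: "'a::real_normed_vector"
  assumes "x0 \<in> \<Omega>" "0 \<le> R" "ereal R < edist_to x0 (frontier \<Omega>)"
  shows "cball x0 R \<subseteq> \<Omega>"
proof (rule ccontr)
  assume "\<not> cball x0 R \<subseteq> \<Omega>"
  moreover have "cball x0 R \<inter> \<Omega> \<noteq> {}" using assms by force
  \<comment> \<open>A connected set that meets both \<open>\<Omega>\<close> and its complement meets
    the boundary, here at distance at most \<open>R\<close> from \<open>x0\<close>.\<close>
  ultimately obtain y where y: "dist x0 y \<le> R" "y \<in> frontier \<Omega>"
    using connected_Int_frontier[of "cball x0 R" \<Omega>] convex_connected[OF convex_cball] by auto
  have "edist_to x0 (frontier \<Omega>) \<le> ereal (dist x0 y)"
    unfolding edist_to_def using y(2) by (rule INF_lower)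
  then show False using assms(3) y(1) by (metis ereal_less_eq(3) leD order_trans)
qed

text \<open>The exponential estimate is stated for functions smooth on the whole space. A cutoff in
  space alone is enough, since \<open>u\<close> is already smooth for all times; equality on an open
  cylinder carries over to all derivatives there.\<close>

lemma C2_extension_from_ball:
  fixes x0 :: "'a::euclidean_space"
  assumes "open \<Omega>" "0 < r" "r < R" "cball x0 R \<subseteq> \<Omega>" and u: "C2_local (UNIV \<times> \<Omega>) (u :: real \<times> 'a \<Rightarrow> real)"
  obtains U where "C2_local UNIV U" "\<And>z. z \<in> UNIV \<times> ball x0 r \<Longrightarrow> U z = u z"
proof -
  define f where "f z = 1 / (R\<^sup>2 - r\<^sup>2) * (R\<^sup>2 + (- 1) * spatial_sqdist x0 z)" for z
  have pos: "0 < R\<^sup>2 - r\<^sup>2" using assms by (simp add: power_strict_mono)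
  have R: "0 < R" using assms by linarith
  define \<eta> where "\<eta> z = smooth_step (f z)" for z
  have "C2_local UNIV \<eta>" unfolding \<eta>_def f_def
    by (intro C2_smooth_step C2_local_add C2_local_mult C2_local_const C2_spatial_sqdist open_UNIV)
  moreover have "\<eta> z = 0" if "z \<notin> UNIV \<times> cball x0 R" for z
  proof -
    have "R\<^sup>2 < spatial_sqdist x0 z"
      using that spatial_sqdist_le[OF R, of x0 z] by (cases z) (auto simp: dist_commute)
    then have "f z \<le> 0" using pos by (simp add: f_def divide_le_0_iff)
    then show ?thesis by (simp add: \<eta>_def smooth_step_eq_0)
  qed
  ultimately have "C2_local UNIV (\<lambda>z. \<eta> z * u z)"
    using assms by (intro C2_local_extend[of "UNIV \<times> \<Omega>" "UNIV \<times> cball x0 R"])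
      (auto intro!: open_Times closed_Times)
  moreover have "\<eta> z * u z = u z" if "z \<in> UNIV \<times> ball x0 r" for z
  proof -
    have "spatial_sqdist x0 z < r\<^sup>2"
      using that spatial_sqdist_less[OF assms(2), of x0 z] by (auto simp: dist_commute)
    then have "1 \<le> f z" using pos by (simp add: f_def)
    then show ?thesis by (simp add: \<eta>_def smooth_step_eq_1)
  qed
  ultimately show ?thesis using that by blast
qed

lemma energy_density_heat_cong:
  assumes "open S" "z \<in> S" "\<And>y. y \<in> S \<Longrightarrow> u y = v y"
  shows "energy_density u z = energy_density v z" "heat u z = heat v z"
proof -
  have D: "pderivative e u y = pderivative e v y" if "y \<in> S" for e y
    by (rule pderivative_cong[OF assms(1) that assms(3)])
  have "pderivative h (pderivative e u) z = pderivative h (pderivative e v) z" for e h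
    by (rule pderivative_cong[OF assms(1,2)]) (rule D)
  then show "energy_density u z = energy_density v z" "heat u z = heat v z"
    using D[OF assms(2)] assms(2,3) by (auto simp: energy_density_def heat_def)
qed

lemma cylinder_integral_mono:
  fixes x :: "'a::euclidean_space"
  assumes "continuous_on UNIV f" "\<And>z. 0 \<le> f z" "a' \<le> a" "b \<le> b'" "r \<le> r'"
  shows "cylinder_integral a b x r f \<le> cylinder_integral a' b' x r' f"
  unfolding cylinder_integral_def
proof (intro integral_mono integrable_cylinder assms(1))
  fix z :: "real \<times> 'a"
  have "{a<..<b} \<times> ball x r \<subseteq> {a'<..<b'} \<times> ball x r'" using assms by auto
  then show "indicator ({a<..<b} \<times> ball x r) z * f z \<le> indicator ({a'<..<b'} \<times> ball x r') z * f z"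
    using assms(2) by (intro mult_right_mono) (auto simp: indicator_def)
qed

section \<open>The interpolation inequality in the norms of the statement\<close>

theorem three_cylinders:
  fixes \<Omega> :: "'a::euclidean_space set" and x0 :: 'a and r1 r2 T \<epsilon> :: real
  assumes \<Omega>: "open \<Omega>" "x0 \<in> \<Omega>" and r: "0 < r1" "r1 < r2" "ereal r2 < edist_to x0 (frontier \<Omega>)"
    and \<epsilon>: "0 < \<epsilon>" "2 * \<epsilon> < T"
  shows "\<exists>C \<kappa> :: real. 0 < C \<and> 0 < \<kappa> \<and> \<kappa> < 1 \<and>
    (\<forall>u :: real \<times> 'a \<Rightarrow> real. C2_on (UNIV \<times> \<Omega>) u \<longrightarrow>
      L2_H1_norm \<epsilon> (T - \<epsilon>) (rel_ball \<Omega> x0 r2) u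
        \<le> ennreal C
          * ennpowr (L2_H1_norm 0 T (rel_ball \<Omega> x0 r1) u
                     + L2_norm_on ({0<..<T} \<times> \<Omega>) (heat_op u)) \<kappa>
          * ennpowr (L2_H1_norm 0 T \<Omega> u) (1 - \<kappa>))"
proof -
  obtain R where R: "r2 < R" "ereal R < edist_to x0 (frontier \<Omega>)"
    using ereal_dense2[OF r(3)] by auto
  have cb: "cball x0 R \<subseteq> \<Omega>"
    using cball_subset_of_edist_to_frontier[OF \<Omega>(2) _ R(2)] r R by simp
  \<comment> \<open>This radius leaves room on both sides: beyond \<open>r2\<close> for the cutoff
    in the Carleman argument, below \<open>R\<close> for the cutoff that extends
    \<open>u\<close>.\<close>
  define r5 where "r5 = (r2 + R) / 2"
  have r5: "r2 < r5" "r5 < R" "0 < r5" using R r by (auto simp: r5_def)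
  obtain C0 \<alpha> \<beta> \<tau>0 where c: "0 < C0" "0 < \<alpha>" "0 < \<beta>" "0 < \<tau>0" and
    est: "\<And>\<tau> U. \<tau>0 \<le> \<tau> \<Longrightarrow> C2_local UNIV U \<Longrightarrow>
      cylinder_integral \<epsilon> (T - \<epsilon>) x0 r2 (energy_density U) \<le>
      C0 * (exp (\<alpha> * \<tau>) * (cylinder_integral 0 T x0 r1 (energy_density U)
              + cylinder_integral 0 T x0 r5 (\<lambda>z. (heat U z)\<^sup>2))
        + exp (- \<beta> * \<tau>) * cylinder_integral 0 T x0 r5 (energy_density U))"
    using three_cylinders_exponential[OF r(1,2) r5(1) \<epsilon>] by blast
  define \<kappa> where "\<kappa> = \<beta> / (\<alpha> + \<beta>)"
  have \<kappa>: "0 < \<kappa>" "\<kappa> < 1" using c by (auto simp: \<kappa>_def field_simps)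
  define D where "D = 1 + C0 * (exp (\<alpha> * \<tau>0) + exp (- \<beta> * \<tau>0))"
  have D: "0 < D" unfolding D_def using c by (intro add_pos_nonneg mult_nonneg_nonneg add_nonneg_nonneg) auto
  have main: "L2_H1_norm \<epsilon> (T - \<epsilon>) (rel_ball \<Omega> x0 r2) u
        \<le> ennreal (D powr (1 / 2))
          * ennpowr (L2_H1_norm 0 T (rel_ball \<Omega> x0 r1) u
                     + L2_norm_on ({0<..<T} \<times> \<Omega>) (heat_op u)) \<kappa>
          * ennpowr (L2_H1_norm 0 T \<Omega> u) (1 - \<kappa>)"
    if u0: "C2_on (UNIV \<times> \<Omega>) u" for u :: "real \<times> 'a \<Rightarrow> real"
  proof -
    have u: "C2_local (UNIV \<times> \<Omega>) u"
      using u0 \<Omega> by (intro C2_on_imp_C2_local) (auto intro: open_Times)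
    obtain U where U: "C2_local UNIV U" and Uu: "\<And>z. z \<in> UNIV \<times> ball x0 r5 \<Longrightarrow> U z = u z"
      using C2_extension_from_ball[OF \<Omega>(1) r5(3,2) cb u] by blast
    have op: "open (UNIV \<times> ball x0 r5 :: (real \<times> 'a) set)" by (intro open_Times) auto
    have eqU: "energy_density u z = energy_density U z" "heat u z = heat U z"
      if "z \<in> UNIV \<times> ball x0 r5" for z
      using energy_density_heat_cong[OF op that Uu] by auto
    have ball\<Omega>: "ball x0 \<rho> \<subseteq> \<Omega>" if "\<rho> \<le> r5" for \<rho>
    proof -
      have "ball x0 \<rho> \<subseteq> cball x0 R" using that r5 by auto
      then show ?thesis using cb by (rule order_trans)
    qed
    have rel: "rel_ball \<Omega> x0 \<rho> = ball x0 \<rho>" if "\<rho> \<le> r5" for \<rho>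
      using ball\<Omega>[OF that] by (auto simp: rel_ball_def dist_commute)
    let ?h = "energy_density U" and ?H = "\<lambda>z. (heat U z)\<^sup>2"
    have ch: "continuous_on UNIV ?h" by (rule continuous_on_energy_density[OF U])
    have cH: "continuous_on UNIV ?H" by (intro continuous_intros continuous_on_heat U)
    have norm_eq: "L2_H1_norm a b (ball x0 \<rho>) u = ennreal (cylinder_integral a b x0 \<rho> ?h powr (1 / 2))"
      if \<rho>: "\<rho> \<le> r5" for a b \<rho>
    proof -
      have "(\<integral>\<^sup>+ z\<in>{a<..<b} \<times> ball x0 \<rho>. ennreal (energy_density u z) \<partial>lborel)
          = ennreal (cylinder_integral a b x0 \<rho> ?h)"
        using eqU \<rho> by (intro nn_integral_cylinder ch energy_density_nonneg) auto
      moreover have "0 \<le> cylinder_integral a b x0 \<rho> ?h"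
        unfolding cylinder_integral_def
        by (intro Bochner_Integration.integral_nonneg mult_nonneg_nonneg energy_density_nonneg) auto
      ultimately show ?thesis
        by (simp add: L2_H1_norm_eq[OF open_ball ball\<Omega>[OF \<rho>] u] ennpowr_ennreal)
    qed
    define I1 I2 I5 F where "I1 = cylinder_integral 0 T x0 r1 ?h"
      and "I2 = cylinder_integral \<epsilon> (T - \<epsilon>) x0 r2 ?h" and "I5 = cylinder_integral 0 T x0 r5 ?h"
      and "F = cylinder_integral 0 T x0 r5 ?H"
    have nn: "0 \<le> I1" "0 \<le> I2" "0 \<le> I5" "0 \<le> F"
      unfolding I1_def I2_def I5_def F_def cylinder_integral_def
      by (intro Bochner_Integration.integral_nonneg mult_nonneg_nonneg energy_density_nonneg; simp)+
    \<comment> \<open>This supplies \<open>Z \<le> Y\<close> in the interpolation lemma, where it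
      settles the case that the data exceed the a priori bound.\<close>
    have "I2 \<le> I5" unfolding I2_def I5_def
      using \<epsilon> r5 by (intro cylinder_integral_mono ch energy_density_nonneg) auto
    then have I2: "I2 \<le> D * ((I1 + F) powr \<kappa> * I5 powr (1 - \<kappa>))"
      unfolding D_def \<kappa>_def using nn est[OF _ U]
      by (intro interpolation_from_exponential[OF c(1-3)]) (auto simp: I1_def I2_def I5_def F_def)
    \<comment> \<open>The estimate runs through the finite quantity \<open>I5\<close>, and the
      possibly infinite norm over \<open>\<Omega>\<close> comes in only by comparison. So vanishing
      data force a vanishing left side even when that norm is \<open>top\<close>, in accordance with
      \<open>0 * top = 0\<close>.\<close>
    have N5: "ennreal (I5 powr (1 / 2)) \<le> L2_H1_norm 0 T \<Omega> u"
    proof -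
      have "ennreal (I5 powr (1 / 2)) = L2_H1_norm 0 T (ball x0 r5) u"
        unfolding I5_def by (rule norm_eq[symmetric]) simp
      also have "\<dots> \<le> L2_H1_norm 0 T \<Omega> u"
        unfolding L2_H1_norm_eq[OF open_ball ball\<Omega>[OF order_refl] u] L2_H1_norm_eq[OF \<Omega>(1) order_refl u]
        using ball\<Omega>[OF order_refl]
        by (intro ennpowr_mono nn_integral_mono) (auto simp: indicator_def)
      finally show ?thesis .
    qed
    have NF: "ennreal (F powr (1 / 2)) \<le> L2_norm_on ({0<..<T} \<times> \<Omega>) (heat_op u)"
    proof -
      have "ennreal F = (\<integral>\<^sup>+ z\<in>{0<..<T} \<times> ball x0 r5. ennreal ((heat u z)\<^sup>2) \<partial>lborel)"
        unfolding F_def using eqU by (intro nn_integral_cylinder[symmetric] cH) auto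
      also have "\<dots> \<le> (\<integral>\<^sup>+ z\<in>{0<..<T} \<times> \<Omega>. ennreal ((heat_op u z)\<^sup>2) \<partial>lborel)"
        using ball\<Omega>[OF order_refl] heat_op_eq[OF C2_local_imp_C1[OF u]]
        by (intro nn_integral_mono) (auto simp: indicator_def)
      finally show ?thesis unfolding L2_norm_on_def ennpowr_ennreal[OF nn(4), symmetric]
        by (intro ennpowr_mono) auto
    qed
    \<comment> \<open>\<open>I1\<close> and \<open>F\<close> are squares of norms, while the
      statement adds the norms themselves; subadditivity of the square root passes from one to the
      other.\<close>
    have sub: "(I1 + F) powr (1 / 2) \<le> I1 powr (1 / 2) + F powr (1 / 2)"
      using nn sqrt_add_le_add_sqrt[of I1 F] by (simp add: powr_half_sqrt)
    have "I2 powr (1 / 2) \<le> (D * ((I1 + F) powr \<kappa> * I5 powr (1 - \<kappa>))) powr (1 / 2)"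
      using I2 nn by (intro powr_mono2) auto
    also have "\<dots> = D powr (1 / 2) * (((I1 + F) powr (1 / 2)) powr \<kappa> * (I5 powr (1 / 2)) powr (1 - \<kappa>))"
      using D nn by (simp add: powr_mult powr_powr mult.commute)
    also have "\<dots> \<le> D powr (1 / 2) * ((I1 powr (1 / 2) + F powr (1 / 2)) powr \<kappa> * (I5 powr (1 / 2)) powr (1 - \<kappa>))"
      using sub \<kappa> by (intro mult_left_mono mult_right_mono powr_mono2) auto
    finally have fin: "I2 powr (1 / 2) \<le> D powr (1 / 2) * ((I1 powr (1 / 2) + F powr (1 / 2)) powr \<kappa>
        * (I5 powr (1 / 2)) powr (1 - \<kappa>))" .
    have "L2_H1_norm \<epsilon> (T - \<epsilon>) (rel_ball \<Omega> x0 r2) u = ennreal (I2 powr (1 / 2))"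
      using r5 by (simp add: rel norm_eq I2_def)
    also have "\<dots> \<le> ennreal (D powr (1 / 2) * ((I1 powr (1 / 2) + F powr (1 / 2)) powr \<kappa>
        * (I5 powr (1 / 2)) powr (1 - \<kappa>)))" by (rule ennreal_leI[OF fin])
    also have "\<dots> = ennreal (D powr (1 / 2)) * ennpowr (ennreal (I1 powr (1 / 2)) + ennreal (F powr (1 / 2))) \<kappa>
        * ennpowr (ennreal (I5 powr (1 / 2))) (1 - \<kappa>)"
      by (simp add: ennpowr_ennreal ennreal_mult mult.assoc flip: ennreal_plus)
    also have "\<dots> \<le> ennreal (D powr (1 / 2))
          * ennpowr (L2_H1_norm 0 T (rel_ball \<Omega> x0 r1) u
                     + L2_norm_on ({0<..<T} \<times> \<Omega>) (heat_op u)) \<kappa>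
          * ennpowr (L2_H1_norm 0 T \<Omega> u) (1 - \<kappa>)"
    proof (intro mult_mono ennpowr_mono add_mono N5 NF order_refl)
      show "ennreal (I1 powr (1 / 2)) \<le> L2_H1_norm 0 T (rel_ball \<Omega> x0 r1) u"
        using r r5 by (simp add: rel norm_eq I1_def)
    qed (use \<kappa> in auto)
    finally show ?thesis .
  qed
  show ?thesis
    using D \<kappa> main by (intro exI[of _ "D powr (1 / 2)"] exI[of _ \<kappa>]) auto
qed

theorem theorem7:
  fixes \<Omega> :: "(real ^ 'n) set" and x0 :: "real ^ 'n" and r1 r2 T \<epsilon> :: real
  assumes "open \<Omega>" and "x0 \<in> \<Omega>"
    and "0 < r1" and "r1 < r2" and "ereal r2 < edist_to x0 (frontier \<Omega>)"
    and "0 < T" and "0 < \<epsilon>" and "\<epsilon> < T"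
  shows "\<exists>C \<kappa> :: real. 0 < C \<and> 0 < \<kappa> \<and> \<kappa> < 1 \<and>
    (\<forall>u :: real \<times> (real ^ 'n) \<Rightarrow> real. C2_on (UNIV \<times> \<Omega>) u \<longrightarrow>
      L2_H1_norm \<epsilon> (T - \<epsilon>) (rel_ball \<Omega> x0 r2) u
        \<le> ennreal C
          * ennpowr (L2_H1_norm 0 T (rel_ball \<Omega> x0 r1) u
                     + L2_norm_on ({0<..<T} \<times> \<Omega>) (heat_op u)) \<kappa>
          * ennpowr (L2_H1_norm 0 T \<Omega> u) (1 - \<kappa>))"
proof (cases "2 * \<epsilon> < T")
  case True
  then show ?thesis using assms by (intro three_cylinders)
next
  \<comment> \<open>For \<open>T \<le> 2 * \<epsilon>\<close> the inner time interval is empty and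
    the left side is 0, so any constants will do.\<close>
  case False
  then have "{\<epsilon><..<T - \<epsilon>} = {}" by auto
  then have "L2_H1_norm \<epsilon> (T - \<epsilon>) S u = 0" for S and u :: "real \<times> (real ^ 'n) \<Rightarrow> real"
    by (simp add: L2_H1_norm_def ennpowr_def)
  then show ?thesis by (intro exI[of _ 1] exI[of _ "1 / 2"]) auto
qed

end
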